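(* Let $\mathcal{S}_{f_1,f_2,f_3}\subset \mathrm{PG}(6,q)$ be the hypersurface $F(X_0,X_1,X_2,X_3,X_4,X_5,X_6)=0$, where $F$ is the homogenization of $$F(1,X_1,\dots,X_6)=(X_1-X_4)\big(f_3(X_4,X_5,X_6)-f_3(X_1,X_2,X_3)\big)+(X_2-X_5)\big(f_2(X_4,X_5,X_6)-f_2(X_1,X_2,X_3)\big)+(X_3-X_6)\big(f_1(X_4,X_5,X_6)-f_1(X_1,X_2,X_3)\big).$$ Assume that $q > 6.3\,(d+1)^{13/3}$, where $d=\max\{\deg(f_1),\deg(f_2),\deg(f_3)\}$, and that $\mathcal{S}_{f_1,f_2,f_3}$ contains an absolutely irreducible component $\mathcal{V}$ defined over $\mathbb{F}_q$. Then $\mathcal{O}_7(f_1,f_2,f_3)$ is not an ovoid of $Q$.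
   Context: Let $q$ be a power of a prime $p$. Let $Q$ be the hyperbolic quadric $Q^+(7,q)$ of $\mathrm{PG}(7,q)$ with equation $X_0X_7+X_1X_6+X_2X_5+X_3X_4=0$; an ovoid of $Q$ is a set of points of $Q$ meeting every generator (maximal totally singular subspace) of $Q$ in exactly one point. Let $f_1,f_2,f_3\in\mathbb{F}_q[X,Y,Z]$ with $f_i(0,0,0)=0$, and let $$\mathcal{O}_7(f_1,f_2,f_3)=\{(1,x,y,z,f_1(x,y,z),f_2(x,y,z),f_3(x,y,z),-zf_1(x,y,z)-yf_2(x,y,z)-xf_3(x,y,z)) : x,y,z\in\mathbb{F}_q\}\cup\{(0,0,0,0,0,0,0,1)\}.$$ $\mathcal{O}_7(f_1,f_2,f_3)$ is an ovoid of $Q$ if and only if $\mathcal{S}_{f_1,f_2,f_3}$ has no affine $\mathbb{F}_q$-rational points outside the 3-space $X_1-X_4=X_2-X_5=X_3-X_6=0$. *)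

theory Defs
  imports
    "HOL-Analysis.Cartesian_Space"
    "HOL-Library.Poly_Mapping"
    "HOL-Algebra.Algebraic_Closure_Type"
begin

section \<open>Multivariate polynomials\<close>

text \<open>
  Polynomials in the variables \<open>X\<^sub>0, X\<^sub>1, X\<^sub>2, \<dots>\<close>: a monomial is a finitely supported map from
  variable indices to exponents.
\<close>

type_synonym 'a mpoly = "(nat \<Rightarrow>\<^sub>0 nat) \<Rightarrow>\<^sub>0 'a"

definition mvar :: "nat \<Rightarrow> 'a::comm_semiring_1 mpoly" where
  "mvar i = Poly_Mapping.single (Poly_Mapping.single i 1) 1"

definition mconst :: "'a::zero \<Rightarrow> 'a mpoly" where
  "mconst c = Poly_Mapping.single 0 c"

definition mvars :: "'a::zero mpoly \<Rightarrow> nat set" where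
  "mvars p = (\<Union>m\<in>Poly_Mapping.keys p. Poly_Mapping.keys m)"

definition monom_deg :: "(nat \<Rightarrow>\<^sub>0 nat) \<Rightarrow> nat" where
  "monom_deg m = (\<Sum>i\<in>Poly_Mapping.keys m. Poly_Mapping.lookup m i)"

text \<open>The total degree; the zero polynomial has degree \<open>0\<close>.\<close>

definition total_deg :: "'a::zero mpoly \<Rightarrow> nat" where
  "total_deg p = Max (insert 0 (monom_deg ` Poly_Mapping.keys p))"

definition monom_eval :: "(nat \<Rightarrow> 'b::comm_semiring_1) \<Rightarrow> (nat \<Rightarrow>\<^sub>0 nat) \<Rightarrow> 'b" where
  "monom_eval \<sigma> m = (\<Prod>i\<in>Poly_Mapping.keys m. \<sigma> i ^ Poly_Mapping.lookup m i)"

definition mpoly_eval :: "(nat \<Rightarrow> 'a) \<Rightarrow> 'a::comm_semiring_1 mpoly \<Rightarrow> 'a" where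
  "mpoly_eval \<sigma> p = (\<Sum>m\<in>Poly_Mapping.keys p. Poly_Mapping.lookup p m * monom_eval \<sigma> m)"

definition mpoly_subst :: "(nat \<Rightarrow> 'a mpoly) \<Rightarrow> 'a::comm_semiring_1 mpoly \<Rightarrow> 'a mpoly" where
  "mpoly_subst \<sigma> p =
     (\<Sum>m\<in>Poly_Mapping.keys p. mconst (Poly_Mapping.lookup p m) * monom_eval \<sigma> m)"

text \<open>
  The ring of polynomials in three variables \<open>X, Y, Z\<close>, which are \<open>X\<^sub>0, X\<^sub>1, X\<^sub>2\<close> here, with
  evaluation and substitution. Out-of-range list accesses never occur for its elements.
\<close>

definition polys3 :: "'a::zero mpoly set" where
  "polys3 = {f. mvars f \<subseteq> {0, 1, 2}}"

definition eval3 :: "'a::comm_semiring_1 mpoly \<Rightarrow> 'a \<Rightarrow> 'a \<Rightarrow> 'a \<Rightarrow> 'a" where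
  "eval3 f x y z = mpoly_eval ((!) [x, y, z]) f"

definition subst3 ::
  "'a::comm_semiring_1 mpoly \<Rightarrow> 'a mpoly \<Rightarrow> 'a mpoly \<Rightarrow> 'a mpoly \<Rightarrow> 'a mpoly" where
  "subst3 f a b c = mpoly_subst ((!) [a, b, c]) f"

definition homogeneous :: "'a::zero mpoly \<Rightarrow> bool" where
  "homogeneous p \<longleftrightarrow> (\<exists>n. \<forall>m\<in>Poly_Mapping.keys p. monom_deg m = n)"

text \<open>Homogenization with respect to \<open>X\<^sub>0\<close>, for polynomials in which \<open>X\<^sub>0\<close> does not occur.\<close>

definition homogenize :: "'a::comm_semiring_1 mpoly \<Rightarrow> 'a mpoly" where
  "homogenize p = (\<Sum>m\<in>Poly_Mapping.keys p.
     Poly_Mapping.single (m + Poly_Mapping.single 0 (total_deg p - monom_deg m))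
       (Poly_Mapping.lookup p m))"


section \<open>Hypersurfaces and their components\<close>

text \<open>Irreducibility is taken in the polynomial ring over the algebraic closure.\<close>

definition absolutely_irreducible :: "'a::field mpoly \<Rightarrow> bool" where
  "absolutely_irreducible G \<longleftrightarrow> irreducible (Poly_Mapping.map to_ac G :: 'a alg_closure mpoly)"

text \<open>
  A hypersurface of \<open>PG(n,q)\<close> is given by a homogeneous polynomial \<open>F\<close> in \<open>X\<^sub>0, \<dots>, X\<^sub>n\<close>. An
  absolutely irreducible component of it that is defined over the ground field is an absolutely
  irreducible hypersurface whose polynomial \<open>G\<close> has its coefficients in the ground field and is
  a factor of \<open>F\<close>.
\<close>

definition abs_irred_component :: "nat \<Rightarrow> 'a::field mpoly \<Rightarrow> 'a mpoly \<Rightarrow> bool" where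
  "abs_irred_component n F G \<longleftrightarrow>
     mvars G \<subseteq> {0..n} \<and> homogeneous G \<and> absolutely_irreducible G \<and> G dvd F"

definition S_affine_poly ::
  "'a::field mpoly \<Rightarrow> 'a mpoly \<Rightarrow> 'a mpoly \<Rightarrow> 'a mpoly" where
  "S_affine_poly f1 f2 f3 =
     (mvar 1 - mvar 4) *
       (subst3 f3 (mvar 4) (mvar 5) (mvar 6) - subst3 f3 (mvar 1) (mvar 2) (mvar 3)) +
     (mvar 2 - mvar 5) *
       (subst3 f2 (mvar 4) (mvar 5) (mvar 6) - subst3 f2 (mvar 1) (mvar 2) (mvar 3)) +
     (mvar 3 - mvar 6) *
       (subst3 f1 (mvar 4) (mvar 5) (mvar 6) - subst3 f1 (mvar 1) (mvar 2) (mvar 3))"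

definition S_poly :: "'a::field mpoly \<Rightarrow> 'a mpoly \<Rightarrow> 'a mpoly \<Rightarrow> 'a mpoly" where
  "S_poly f1 f2 f3 = homogenize (S_affine_poly f1 f2 f3)"


section \<open>The quadric \<open>Q\<^sup>+(7,q)\<close> and its ovoids\<close>

text \<open>
  Points of \<open>PG(7,q)\<close> are the one-dimensional subspaces of \<open>'a ^ 8\<close>. Components of vectors are
  numbered from 1, so the homogeneous coordinate \<open>X\<^sub>i\<close> is component \<open>i + 1\<close>.
\<close>

definition pg_points :: "('a::field ^ 8) set set" where
  "pg_points = {vec.span {v} | v. v \<noteq> 0}"

definition Q_form :: "'a::field ^ 8 \<Rightarrow> 'a" where
  "Q_form v = v $ 1 * v $ 8 + v $ 2 * v $ 7 + v $ 3 * v $ 6 + v $ 4 * v $ 5"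

definition Q_points :: "('a::field ^ 8) set set" where
  "Q_points = {P \<in> pg_points. \<forall>v\<in>P. Q_form v = 0}"

definition totally_singular :: "('a::field ^ 8) set \<Rightarrow> bool" where
  "totally_singular U \<longleftrightarrow> vec.subspace U \<and> (\<forall>v\<in>U. Q_form v = 0)"

definition Q_generator :: "('a::field ^ 8) set \<Rightarrow> bool" where
  "Q_generator U \<longleftrightarrow>
     totally_singular U \<and> (\<forall>W. totally_singular W \<longrightarrow> U \<subseteq> W \<longrightarrow> W = U)"

definition Q_ovoid :: "('a::field ^ 8) set set \<Rightarrow> bool" where
  "Q_ovoid Ov \<longleftrightarrow> Ov \<subseteq> Q_points \<and> (\<forall>U. Q_generator U \<longrightarrow> (\<exists>!P. P \<in> Ov \<and> P \<subseteq> U))"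

definition O7 ::
  "'a::field mpoly \<Rightarrow> 'a mpoly \<Rightarrow> 'a mpoly \<Rightarrow> ('a ^ 8) set set" where
  "O7 f1 f2 f3 =
     {vec.span {vector [1, x, y, z, eval3 f1 x y z, eval3 f2 x y z, eval3 f3 x y z,
        - z * eval3 f1 x y z - y * eval3 f2 x y z - x * eval3 f3 x y z]} | x y z. True} \<union>
     {vec.span {vector [0, 0, 0, 0, 0, 0, 0, 1]}}"

end

theory Submission
  imports Defs "Jordan_Normal_Form.Char_Poly"
begin

text \<open>
  Two points of \<open>O7\<close> that come from a rational point of the affine hypersurface off the diagonal span
  a totally singular line, which lies in a generator. So it suffices to find a rational point of the
  component \<open>V\<close>, of degree \<open>n \<le> d + 1\<close>, off the hyperplanes \<open>X\<^sub>0 = 0\<close> and \<open>X\<^sub>1 = X\<^sub>4\<close>; this works as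
  soon as \<open>q > 6n\<^sup>4\<close>.

  Choose a rational line on which \<open>V\<close> has degree \<open>n\<close> and a simple root \<open>\<alpha>\<close>. Every rational direction
  \<open>v\<close> extends the line to a plane; the plane section of \<open>V\<close> is a curve \<open>f(x, y) = 0\<close>, and \<open>\<alpha>\<close> lifts
  to a power series branch \<open>Y(x)\<close> of it by Hensel's lemma. For the generic \<open>v\<close>, no polynomial of
  \<open>y\<close>-degree less than \<open>n\<close> vanishes on \<open>(x, Y(x))\<close>, because \<open>V\<close> is prime. This is the nonvanishing
  of a minor of a matrix of power series coefficients, which is a polynomial in \<open>v\<close> of degree less
  than \<open>q\<close>, hence it persists for some rational \<open>v\<close>.

  Stepanov's method then shows that more than \<open>2n\<close> elements of \<open>F\<^sub>q\<close> are abscissae of rational points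
  of \<open>f = 0\<close>. An auxiliary polynomial \<open>\<Psi>\<close> in \<open>x, y, x\<^sup>q, y\<^sup>q\<close> is constructed by linear algebra so that
  \<open>(y - y\<^sup>q)\<^sup>m \<Psi>\<close> is divisible by \<open>(x - x\<^sup>q)\<^sup>m\<close> modulo \<open>f\<close>. If no rational point lies over \<open>x\<^sub>0 \<in> F\<^sub>q\<close>,
  then \<open>y\<^sup>q - y = \<Prod>(y - c)\<close> is invertible over \<open>x\<^sub>0\<close>, so \<open>(x - x\<^sub>0)\<^sup>m\<close> divides \<open>\<Psi>\<close> modulo \<open>f\<close>; with too
  many such \<open>x\<^sub>0\<close> this forces \<open>\<Psi>\<close> to vanish on the curve, which its shape excludes. Each of the two
  hyperplanes meets the curve over at most \<open>n\<close> abscissae.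
\<close>

text \<open>The bound 6n^4 comes from one order estimate used twice: a nonzero polynomial of
  y-degree below n and total degree A vanishes on the branch to order at most n(A + n - 1). In
  Stepanov's method A is about 4n^3, and the order must stay below q so that blocks of series
  belonging to different powers of x^q cannot cancel. For the minor, A = 2n - 1 bounds the rows, and
  the minor has degree at most n(n + 1) * n(3n - 2) in v. The obstacle in Stepanov's method is to
  impose high vanishing order in characteristic p. Derivatives are replaced by a division: f(x, y) -
  f(x^q, y^q) = (y - y^q) Gq + (x - x^q) Xq, where Gq is monic of degree n - 1 in y^q. Hence, modulo
  f, a polynomial of degree T in x, y, x^q, y^q is a remainder in at most (T + 1)n(n - 1) monomials
  plus (x - x^q)/(y - y^q) times a polynomial again of degree T. As T does not grow, m rounds cost
  at most m(T + 1)n(n - 1) linear conditions.\<close>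

hide_const (open) Poly_Mapping.degree Polynomials.degree UnivPoly.coeff UnivPoly.monom Module.smult
  Divisibility.prime Divisibility.irreducible

section \<open>Multivariate polynomials\<close>

text \<open>With a coefficient map \<open>c\<close>, a single operation covers evaluation,
  substitution, extension of scalars to the algebraic closure, and restriction to lines and planes.
  It is a ring homomorphism whenever \<open>c\<close> is one.\<close>

definition meval :: "('a::comm_ring_1 \<Rightarrow> 'b::comm_ring_1) \<Rightarrow> (nat \<Rightarrow> 'b) \<Rightarrow> 'a mpoly \<Rightarrow> 'b" where
  "meval c \<sigma> p = (\<Sum>m\<in>Poly_Mapping.keys p. c (Poly_Mapping.lookup p m) * monom_eval \<sigma> m)"

lemma monom_eval_superset:
  assumes "finite A" "Poly_Mapping.keys m \<subseteq> A"
  shows "monom_eval \<sigma> m = (\<Prod>i\<in>A. \<sigma> i ^ Poly_Mapping.lookup m i)"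
  unfolding monom_eval_def
  by (rule prod.mono_neutral_left) (use assms in \<open>auto simp: in_keys_iff\<close>)

lemma monom_eval_0 [simp]: "monom_eval \<sigma> 0 = 1"
  by (simp add: monom_eval_def)

lemma monom_eval_single [simp]: "monom_eval \<sigma> (Poly_Mapping.single i k) = \<sigma> i ^ k"
  by (cases "k = 0") (auto simp: monom_eval_def)

lemma monom_eval_add: "monom_eval \<sigma> (m + n) = monom_eval \<sigma> m * monom_eval \<sigma> n"
proof -
  let ?A = "Poly_Mapping.keys m \<union> Poly_Mapping.keys n"
  have "Poly_Mapping.keys (m + n) \<subseteq> ?A" by (rule keys_add)
  then show ?thesis
    by (simp add: monom_eval_superset[of ?A] lookup_add power_add prod.distrib)
qed

lemma monom_deg_superset:
  assumes "finite A" "Poly_Mapping.keys m \<subseteq> A"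
  shows "monom_deg m = (\<Sum>i\<in>A. Poly_Mapping.lookup m i)"
  unfolding monom_deg_def
  by (rule sum.mono_neutral_left) (use assms in \<open>auto simp: in_keys_iff\<close>)

lemma monom_deg_0 [simp]: "monom_deg 0 = 0"
  by (simp add: monom_deg_def)

lemma monom_deg_single [simp]: "monom_deg (Poly_Mapping.single i k) = k"
  by (cases "k = 0") (auto simp: monom_deg_def)

lemma monom_deg_add: "monom_deg (m + n) = monom_deg m + monom_deg n"
proof -
  let ?A = "Poly_Mapping.keys m \<union> Poly_Mapping.keys n"
  have "Poly_Mapping.keys (m + n) \<subseteq> ?A" by (rule keys_add)
  then show ?thesis
    by (simp add: monom_deg_superset[of ?A] lookup_add sum.distrib)
qed

lemma monom_deg_eq_0_iff: "monom_deg m = 0 \<longleftrightarrow> m = 0"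
proof
  assume "monom_deg m = 0"
  then show "m = 0"
    by (intro poly_mapping_eqI) (auto simp: monom_deg_def in_keys_iff)
qed simp

lemma meval_superset:
  assumes "finite A" "Poly_Mapping.keys p \<subseteq> A" "c 0 = 0"
  shows "meval c \<sigma> p = (\<Sum>m\<in>A. c (Poly_Mapping.lookup p m) * monom_eval \<sigma> m)"
  unfolding meval_def
  by (rule sum.mono_neutral_left) (use assms in \<open>auto simp: in_keys_iff\<close>)

lemma meval_single [simp]:
  "c 0 = 0 \<Longrightarrow> meval c \<sigma> (Poly_Mapping.single m a) = c a * monom_eval \<sigma> m"
  by (cases "a = 0") (auto simp: meval_def)

lemma mpoly_expand: "p = (\<Sum>m\<in>Poly_Mapping.keys p. Poly_Mapping.single m (Poly_Mapping.lookup p m))"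
proof (rule poly_mapping_eqI)
  fix k
  show "Poly_Mapping.lookup p k = Poly_Mapping.lookup
    (\<Sum>m\<in>Poly_Mapping.keys p. Poly_Mapping.single m (Poly_Mapping.lookup p m)) k"
    by (cases "k \<in> Poly_Mapping.keys p")
       (auto simp: lookup_sum lookup_single when_def in_keys_iff)
qed

lemma mpoly_induct [case_names single add]:
  fixes p :: "'a::comm_ring_1 mpoly"
  assumes "\<And>m a. P (Poly_Mapping.single m a)" and "\<And>p q. P p \<Longrightarrow> P q \<Longrightarrow> P (p + q)"
  shows "P p"
proof -
  have "P (\<Sum>m\<in>A. Poly_Mapping.single m (Poly_Mapping.lookup p m))" if "finite A" for A
    using that
  proof (induction A)
    case empty
    show ?case using assms(1)[of 0 0] by simp
  qed (auto intro: assms)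
  then show ?thesis by (subst mpoly_expand) simp
qed

context comm_ring_hom
begin

lemma meval_add: "meval hom \<sigma> (p + q) = meval hom \<sigma> p + meval hom \<sigma> q"
proof -
  let ?A = "Poly_Mapping.keys p \<union> Poly_Mapping.keys q"
  have "Poly_Mapping.keys (p + q) \<subseteq> ?A" by (rule keys_add)
  then show ?thesis
    by (simp add: meval_superset[of ?A] lookup_add hom_add sum.distrib algebra_simps)
qed

lemma meval_mult: "meval hom \<sigma> (p * q) = meval hom \<sigma> p * meval hom \<sigma> q"
proof (induction p rule: mpoly_induct)
  case (single m a)
  show ?case
    by (induction q rule: mpoly_induct)
       (simp_all add: mult_single hom_mult monom_eval_add algebra_simps meval_add)
qed (simp add: meval_add algebra_simps)

lemma meval_hom: "comm_ring_hom (meval hom \<sigma>)"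
proof
  show "meval hom \<sigma> 1 = 1" using meval_single[of hom \<sigma> 0 1] by simp
  show "meval hom \<sigma> 0 = 0" by (simp add: meval_def)
qed (simp_all add: meval_add meval_mult)

lemma hom_monom_eval: "hom (monom_eval \<sigma> m) = monom_eval (hom \<circ> \<sigma>) m"
  by (simp add: monom_eval_def hom_prod hom_power)

lemma hom_meval: "hom (meval c \<sigma> p) = meval (hom \<circ> c) (hom \<circ> \<sigma>) p"
  by (simp add: meval_def hom_sum hom_mult hom_monom_eval)

end

lemma id_hom: "comm_ring_hom (\<lambda>x. x)"
  by unfold_locales auto

lemma comp_hom:
  assumes "comm_ring_hom f" "comm_ring_hom g"
  shows "comm_ring_hom (f \<circ> g)"
proof -
  interpret f: comm_ring_hom f by fact
  interpret g: comm_ring_hom g by fact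
  show ?thesis by unfold_locales (simp_all add: f.hom_add g.hom_add f.hom_mult g.hom_mult)
qed

lemma mconst_hom: "comm_ring_hom (mconst :: 'a::comm_ring_1 \<Rightarrow> 'a mpoly)"
  by unfold_locales (auto simp: mconst_def single_add mult_single)

lemma meval_cong:
  assumes "\<And>i. i \<in> mvars p \<Longrightarrow> \<sigma> i = \<tau> i"
  shows "meval c \<sigma> p = meval c \<tau> p"
  unfolding meval_def
proof (rule sum.cong[OF refl])
  fix m assume "m \<in> Poly_Mapping.keys p"
  then have "monom_eval \<sigma> m = monom_eval \<tau> m"
    unfolding monom_eval_def by (intro prod.cong refl arg_cong2[of _ _ _ _ power] assms) (auto simp: mvars_def)
  then show "c (Poly_Mapping.lookup p m) * monom_eval \<sigma> m = c (Poly_Mapping.lookup p m) * monom_eval \<tau> m"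
    by simp
qed

lemma mpoly_eval_conv_meval: "mpoly_eval \<sigma> p = meval (\<lambda>x. x) \<sigma> p"
  by (simp add: mpoly_eval_def meval_def)

lemma mpoly_subst_conv_meval: "mpoly_subst \<sigma> p = meval mconst \<sigma> p"
  by (simp add: mpoly_subst_def meval_def)

lemma meval_mconst [simp]: "c 0 = 0 \<Longrightarrow> meval c \<sigma> (mconst a) = c a"
  by (simp add: mconst_def)

lemma meval_mvar [simp]: "c 0 = 0 \<Longrightarrow> c 1 = 1 \<Longrightarrow> meval c \<sigma> (mvar i) = \<sigma> i"
  by (simp add: mvar_def)

lemma mvar_power: "mvar i ^ k = Poly_Mapping.single (Poly_Mapping.single i k) 1"
  by (induction k) (simp_all add: mvar_def mult_single single_add[symmetric])

lemma monom_eval_mvar: "monom_eval mvar m = Poly_Mapping.single m (1::'a::comm_ring_1)"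
proof -
  have *: "(\<Prod>i\<in>A. mvar i ^ Poly_Mapping.lookup m i) =
      Poly_Mapping.single (\<Sum>i\<in>A. Poly_Mapping.single i (Poly_Mapping.lookup m i)) (1::'a)"
    if "finite A" for A
    using that by (induction A) (simp_all add: mvar_power mult_single)
  show ?thesis
    unfolding monom_eval_def by (subst *) (simp_all flip: mpoly_expand)
qed

lemma meval_mconst_mvar [simp]: "meval mconst mvar p = p"
  by (simp add: meval_def monom_eval_mvar mconst_def mult_single flip: mpoly_expand)

lemma meval_map:
  assumes "h 0 = 0" "c 0 = 0"
  shows "meval c \<sigma> (Poly_Mapping.map h p) = meval (c \<circ> h) \<sigma> p"
proof -
  have "Poly_Mapping.keys (Poly_Mapping.map h p) \<subseteq> Poly_Mapping.keys p"
    by (auto simp: in_keys_iff map.rep_eq when_def)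
  then have "meval c \<sigma> (Poly_Mapping.map h p) = (\<Sum>m\<in>Poly_Mapping.keys p.
      c (Poly_Mapping.lookup (Poly_Mapping.map h p) m) * monom_eval \<sigma> m)"
    by (intro meval_superset) (use assms in auto)
  also have "\<dots> = meval (c \<circ> h) \<sigma> p"
    unfolding meval_def by (intro sum.cong) (auto simp: map.rep_eq in_keys_iff)
  finally show ?thesis .
qed

subsection \<open>Total degree\<close>

lemma total_deg_le_iff: "total_deg p \<le> n \<longleftrightarrow> (\<forall>m\<in>Poly_Mapping.keys p. monom_deg m \<le> n)"
  by (auto simp: total_deg_def)

lemma monom_deg_le_total_deg: "m \<in> Poly_Mapping.keys p \<Longrightarrow> monom_deg m \<le> total_deg p"
  using total_deg_le_iff[of p "total_deg p"] by auto

lemma total_deg_0 [simp]: "total_deg 0 = 0"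
  by (simp add: total_deg_def)

lemma total_deg_single_le: "total_deg (Poly_Mapping.single m c) \<le> monom_deg m"
  by (auto simp: total_deg_le_iff)

lemma total_deg_mconst [simp]: "total_deg (mconst c) = 0"
  using total_deg_single_le[of 0 c] by (simp add: mconst_def)

lemma total_deg_1 [simp]: "total_deg (1 :: 'a::comm_ring_1 mpoly) = 0"
  using total_deg_single_le[of 0 "1 :: 'a"] by simp

lemma total_deg_mvar_le: "total_deg (mvar i :: 'a::comm_ring_1 mpoly) \<le> 1"
  using total_deg_single_le[of "Poly_Mapping.single i 1" "1 :: 'a"] by (simp add: mvar_def)

lemma total_deg_add_le: "total_deg p \<le> n \<Longrightarrow> total_deg q \<le> n \<Longrightarrow> total_deg (p + q) \<le> n"
  using keys_add[of p q] unfolding total_deg_le_iff by (auto dest: subsetD)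

lemma total_deg_uminus [simp]: "total_deg (- p) = total_deg (p :: 'a::ab_group_add mpoly)"
proof -
  have "Poly_Mapping.keys (- p) = Poly_Mapping.keys p" by (auto simp: in_keys_iff)
  then show ?thesis by (simp add: total_deg_def)
qed

lemma total_deg_diff_le:
  "total_deg p \<le> n \<Longrightarrow> total_deg q \<le> n \<Longrightarrow> total_deg (p - q :: 'a::ab_group_add mpoly) \<le> n"
  using total_deg_add_le[of p n "- q"] by simp

lemma total_deg_sum_le: "(\<And>i. i \<in> A \<Longrightarrow> total_deg (f i) \<le> n) \<Longrightarrow> total_deg (sum f A) \<le> n"
  by (induction A rule: infinite_finite_induct) (auto intro: total_deg_add_le)

lemma total_deg_mult_le:
  fixes p q :: "'a::comm_ring_1 mpoly"
  assumes "total_deg p \<le> a" "total_deg q \<le> b"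
  shows "total_deg (p * q) \<le> a + b"
  unfolding total_deg_le_iff
proof
  fix m assume "m \<in> Poly_Mapping.keys (p * q)"
  then obtain u v where "u \<in> Poly_Mapping.keys p" "v \<in> Poly_Mapping.keys q" "m = u + v"
    using keys_mult by blast
  then show "monom_deg m \<le> a + b"
    using assms by (auto simp: total_deg_le_iff monom_deg_add intro!: add_mono)
qed

text \<open>The substitution X_i := X_i t. The coefficient of t^n is the homogeneous part of degree
  n, so total degree becomes a degree in t and is additive on products over a domain.\<close>

definition grade_poly :: "'a::comm_ring_1 mpoly \<Rightarrow> 'a mpoly poly" where
  "grade_poly = meval (\<lambda>a. [:mconst a:]) (\<lambda>i. [:0, mvar i:])"

lemma const_poly_hom: "comm_ring_hom (\<lambda>a. [:a:])"
  by unfold_locales auto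

lemma const_mconst_hom: "comm_ring_hom (\<lambda>a. [:mconst a:])"
  using comp_hom[OF const_poly_hom mconst_hom] by (simp add: o_def)

lemma grade_poly_hom: "comm_ring_hom grade_poly"
  unfolding grade_poly_def by (intro comm_ring_hom.meval_hom const_mconst_hom)

lemma monom_eval_grade:
  "monom_eval (\<lambda>i. [:0, mvar i:]) m =
     Polynomial.monom (Poly_Mapping.single m (1::'a::comm_ring_1)) (monom_deg m)"
proof -
  have eq: "[:0, mvar i :: 'a mpoly:] = Polynomial.monom (mvar i) 1" for i
    by (simp add: Polynomial.monom_altdef)
  have "(\<Prod>i\<in>A. [:0, mvar i :: 'a mpoly:] ^ Poly_Mapping.lookup m i) =
      Polynomial.monom (\<Prod>i\<in>A. mvar i ^ Poly_Mapping.lookup m i) (\<Sum>i\<in>A. Poly_Mapping.lookup m i)"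
    if "finite A" for A
    using that by (induction A) (simp_all add: eq monom_power mult_monom)
  from this[of "Poly_Mapping.keys m"] show ?thesis
    by (simp add: monom_eval_def monom_deg_def flip: monom_eval_mvar)
qed

lemma coeff_grade_poly:
  "coeff (grade_poly p) n =
     (\<Sum>m\<in>{m\<in>Poly_Mapping.keys p. monom_deg m = n}. Poly_Mapping.single m (Poly_Mapping.lookup p m))"
proof -
  have "coeff (grade_poly p) n = (\<Sum>m\<in>Poly_Mapping.keys p.
     if monom_deg m = n then Poly_Mapping.single m (Poly_Mapping.lookup p m) else 0)"
    unfolding grade_poly_def meval_def monom_eval_grade
    by (auto simp: coeff_sum smult_monom mconst_def mult_single intro!: sum.cong)
  then show ?thesis by (simp add: sum.inter_filter)
qed

lemma lookup_coeff_grade_poly: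
  "Poly_Mapping.lookup (coeff (grade_poly p) n) m = (if monom_deg m = n then Poly_Mapping.lookup p m else 0)"
  by (auto simp: coeff_grade_poly lookup_sum lookup_single when_def in_keys_iff sum.delta)

lemma degree_grade_poly: "degree (grade_poly p) = total_deg p"
proof (rule antisym)
  show "degree (grade_poly p) \<le> total_deg p"
  proof (rule degree_le, intro allI impI poly_mapping_eqI)
    fix i m assume "total_deg p < i"
    then show "Poly_Mapping.lookup (coeff (grade_poly p) i) m = Poly_Mapping.lookup 0 m"
      using monom_deg_le_total_deg[of m p] by (fastforce simp: lookup_coeff_grade_poly in_keys_iff)
  qed
  show "total_deg p \<le> degree (grade_poly p)"
    unfolding total_deg_le_iff
  proof
    fix m assume "m \<in> Poly_Mapping.keys p"
    then have "coeff (grade_poly p) (monom_deg m) \<noteq> 0"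
      using lookup_coeff_grade_poly[of p "monom_deg m" m] by (auto simp: in_keys_iff)
    then show "monom_deg m \<le> degree (grade_poly p)" by (rule le_degree)
  qed
qed

lemma grade_poly_eq_0_iff [simp]: "grade_poly p = 0 \<longleftrightarrow> p = 0"
proof
  assume *: "grade_poly p = 0"
  show "p = 0"
  proof (rule poly_mapping_eqI)
    fix m show "Poly_Mapping.lookup p m = Poly_Mapping.lookup 0 m"
      using lookup_coeff_grade_poly[of p "monom_deg m" m] * by simp
  qed
qed (simp add: grade_poly_def meval_def)

lemma total_deg_mult_eq:
  fixes p q :: "'a::idom mpoly"
  assumes "p \<noteq> 0" "q \<noteq> 0"
  shows "total_deg (p * q) = total_deg p + total_deg q"
proof -
  interpret g: comm_ring_hom "grade_poly :: 'a mpoly \<Rightarrow> _" by (rule grade_poly_hom)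
  show ?thesis
    using assms degree_mult_eq[of "grade_poly p" "grade_poly q"]
    by (simp add: degree_grade_poly flip: g.hom_mult)
qed

lemma total_deg_eq_0_imp_const:
  assumes "total_deg p = 0"
  shows "p = mconst (Poly_Mapping.lookup p 0)"
proof (rule poly_mapping_eqI)
  fix m
  show "Poly_Mapping.lookup p m = Poly_Mapping.lookup (mconst (Poly_Mapping.lookup p 0)) m"
    using monom_deg_le_total_deg[of m p] assms
    by (cases "m = 0") (auto simp: mconst_def lookup_single when_def in_keys_iff monom_deg_eq_0_iff)
qed

lemma mpoly_unit_iff_const:
  fixes p :: "'a::idom mpoly"
  assumes "p * q = 1"
  shows "total_deg p = 0" "total_deg q = 0"
proof -
  have "p \<noteq> 0" "q \<noteq> 0" using assms by auto
  then have "total_deg p + total_deg q = 0"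
    using total_deg_mult_eq[of p q] assms by simp
  then show "total_deg p = 0" "total_deg q = 0" by auto
qed

subsection \<open>Splitting off one variable\<close>

text \<open>The coefficients of the powers of X_i stay in the same type and are free of X_i, so an
  induction over a finite set of variables needs no change of ring.\<close>

definition var_poly :: "nat \<Rightarrow> 'a::comm_ring_1 mpoly \<Rightarrow> 'a mpoly poly" where
  "var_poly i = meval (\<lambda>a. [:mconst a:]) (\<lambda>j. if j = i then [:0, 1:] else [:mvar j:])"

lemma var_poly_hom: "comm_ring_hom (var_poly i)"
  unfolding var_poly_def by (intro comm_ring_hom.meval_hom const_mconst_hom)

lemma var_poly_mvar: "var_poly i (mvar j) = (if j = i then [:0, 1:] else [:mvar j:])"
proof -
  have "mconst (0::'a) = 0" "mconst (1::'a) = 1" by (simp_all add: mconst_def)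
  then show ?thesis by (simp add: var_poly_def)
qed

lemma poly_var_poly: "poly (var_poly i p) (mvar i) = p"
proof -
  have h: "comm_ring_hom (\<lambda>q. poly q (mvar i :: 'a mpoly))"
    by unfold_locales auto
  have "poly (var_poly i p) (mvar i) = meval mconst mvar p"
    unfolding var_poly_def comm_ring_hom.hom_meval[OF h] by (intro arg_cong2[of _ _ _ _ "\<lambda>c \<sigma>. meval c \<sigma> p"]) auto
  then show ?thesis by simp
qed

lemma var_poly_free:
  assumes "i \<notin> mvars p"
  shows "var_poly i p = [:p:]"
proof -
  interpret h: comm_ring_hom "\<lambda>a :: 'a mpoly. [:a:]" by (rule const_poly_hom)
  have "var_poly i p = meval (\<lambda>a. [:mconst a:]) (\<lambda>j. [:mvar j:]) p"
    unfolding var_poly_def by (rule meval_cong) (use assms in auto)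
  also have "\<dots> = [:meval mconst mvar p:]"
    unfolding h.hom_meval by (simp add: o_def)
  finally show ?thesis by simp
qed

lemma monom_eval_var_poly:
  "monom_eval (\<lambda>j. if j = i then [:0, 1:] else [:mvar j:]) m =
     Polynomial.monom (Poly_Mapping.single (m - Poly_Mapping.single i (Poly_Mapping.lookup m i)) (1::'a::comm_ring_1))
       (Poly_Mapping.lookup m i)"
proof -
  let ?r = "m - Poly_Mapping.single i (Poly_Mapping.lookup m i)"
  have m: "m = ?r + Poly_Mapping.single i (Poly_Mapping.lookup m i)"
    by (rule poly_mapping_eqI) (simp add: lookup_add lookup_minus lookup_single when_def)
  have r: "i \<notin> Poly_Mapping.keys ?r"
    by (simp add: in_keys_iff lookup_minus)
  interpret h: comm_ring_hom "\<lambda>a :: 'a mpoly. [:a:]" by (rule const_poly_hom)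
  have "monom_eval (\<lambda>j. if j = i then [:0, 1:] else [:mvar j:]) ?r = monom_eval (\<lambda>j. [:mvar j :: 'a mpoly:]) ?r"
    unfolding monom_eval_def by (intro prod.cong) (use r in auto)
  also have "\<dots> = [:monom_eval mvar ?r:]"
    unfolding h.hom_monom_eval by (simp add: o_def)
  finally have "monom_eval (\<lambda>j. if j = i then [:0, 1:] else [:mvar j:]) ?r = [:Poly_Mapping.single ?r (1::'a):]"
    by (simp add: monom_eval_mvar)
  then show ?thesis
    by (subst m, subst monom_eval_add) (simp add: Polynomial.monom_altdef)
qed

lemma coeff_var_poly:
  "coeff (var_poly i p) k =
     (\<Sum>m\<in>{m\<in>Poly_Mapping.keys p. Poly_Mapping.lookup m i = k}.
        Poly_Mapping.single (m - Poly_Mapping.single i k) (Poly_Mapping.lookup p m))"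
proof -
  have "coeff (var_poly i p) k = (\<Sum>m\<in>Poly_Mapping.keys p. if Poly_Mapping.lookup m i = k
     then Poly_Mapping.single (m - Poly_Mapping.single i k) (Poly_Mapping.lookup p m) else 0)"
    unfolding var_poly_def meval_def monom_eval_var_poly
    by (auto simp: coeff_sum smult_monom mconst_def mult_single intro!: sum.cong)
  then show ?thesis by (simp add: sum.inter_filter)
qed

lemma keys_coeff_var_poly:
  assumes "n \<in> Poly_Mapping.keys (coeff (var_poly i p) k)"
  obtains m where "m \<in> Poly_Mapping.keys p" "m = n + Poly_Mapping.single i k" "Poly_Mapping.lookup n i = 0"
proof -
  have "n \<in> (\<Union>m\<in>{m\<in>Poly_Mapping.keys p. Poly_Mapping.lookup m i = k}.
      Poly_Mapping.keys (Poly_Mapping.single (m - Poly_Mapping.single i k) (Poly_Mapping.lookup p m)))"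
    using assms unfolding coeff_var_poly by (rule subsetD[OF keys_sum])
  then obtain m where m: "m \<in> Poly_Mapping.keys p" "Poly_Mapping.lookup m i = k" "n = m - Poly_Mapping.single i k"
    by (auto split: if_splits)
  moreover have "m = n + Poly_Mapping.single i k"
    by (rule poly_mapping_eqI) (use m in \<open>auto simp: lookup_add lookup_minus lookup_single when_def\<close>)
  moreover have "Poly_Mapping.lookup n i = 0" using m by (simp add: lookup_minus)
  ultimately show ?thesis using that by blast
qed

lemma mvars_coeff_var_poly: "mvars (coeff (var_poly i p) k) \<subseteq> mvars p - {i}"
proof
  fix j assume "j \<in> mvars (coeff (var_poly i p) k)"
  then obtain n where n: "n \<in> Poly_Mapping.keys (coeff (var_poly i p) k)" "j \<in> Poly_Mapping.keys n"
    by (auto simp: mvars_def)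
  from n(1) obtain m where m: "m \<in> Poly_Mapping.keys p" "m = n + Poly_Mapping.single i k" "Poly_Mapping.lookup n i = 0"
    by (rule keys_coeff_var_poly)
  have "j \<noteq> i" using n(2) m(3) by (auto simp: in_keys_iff)
  moreover have "j \<in> Poly_Mapping.keys m" using n(2) m(2) by (auto simp: in_keys_iff lookup_add)
  ultimately show "j \<in> mvars p - {i}" using m(1) by (auto simp: mvars_def)
qed

lemma total_deg_coeff_var_poly: "total_deg (coeff (var_poly i p) k) \<le> total_deg p"
  unfolding total_deg_le_iff
proof
  fix n assume "n \<in> Poly_Mapping.keys (coeff (var_poly i p) k)"
  then obtain m where "m \<in> Poly_Mapping.keys p" "m = n + Poly_Mapping.single i k"
    by (rule keys_coeff_var_poly)
  then show "monom_deg n \<le> total_deg p"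
    using monom_deg_le_total_deg[of m p] by (simp add: monom_deg_add)
qed

lemma degree_var_poly: "degree (var_poly i p) \<le> total_deg p"
proof (rule degree_le, intro allI impI)
  fix k assume k: "total_deg p < k"
  show "coeff (var_poly i p) k = 0"
  proof (rule ccontr)
    assume "coeff (var_poly i p) k \<noteq> 0"
    then obtain n where "n \<in> Poly_Mapping.keys (coeff (var_poly i p) k)" by fastforce
    then obtain m where "m \<in> Poly_Mapping.keys p" "m = n + Poly_Mapping.single i k"
      by (rule keys_coeff_var_poly)
    then show False
      using monom_deg_le_total_deg[of m p] k by (simp add: monom_deg_add)
  qed
qed

lemma finite_mvars [simp]: "finite (mvars p)"
  by (simp add: mvars_def)

section \<open>Homomorphisms from univariate polynomials\<close>

definition lift_hom :: "('r::comm_ring_1 \<Rightarrow> 's::comm_ring_1) \<Rightarrow> 's \<Rightarrow> 'r poly \<Rightarrow> 's" where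
  "lift_hom h x p = poly (map_poly h p) x"

lemma lift_hom_hom:
  assumes "comm_ring_hom h"
  shows "comm_ring_hom (lift_hom h x)"
proof -
  interpret h: comm_ring_hom h by fact
  interpret m: map_poly_comm_ring_hom h ..
  show ?thesis by unfold_locales (simp_all add: lift_hom_def m.hom_add m.hom_mult)
qed

lemma lift_hom_const [simp]: "h 0 = 0 \<Longrightarrow> lift_hom h x [:a:] = h a"
  by (simp add: lift_hom_def map_poly_simps)

lemma lift_hom_X [simp]: "h 0 = 0 \<Longrightarrow> h 1 = 1 \<Longrightarrow> lift_hom h x [:0, 1:] = x"
  by (simp add: lift_hom_def map_poly_simps)

text \<open>Expand in one variable, make some nonzero coefficient nonzero by induction, then pick a
  non-root in \<open>S\<close>. Total degree serves as the bound because it does not increase on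
  passing to coefficients. All rational choices below (direction, base point, plane) are made with
  this lemma.\<close>

lemma mpoly_nonzero_point:
  fixes p :: "'a::idom mpoly"
  assumes "p \<noteq> 0" "total_deg p < card S"
  shows "\<exists>\<sigma>. (\<forall>i. \<sigma> i \<in> S) \<and> meval (\<lambda>x. x) \<sigma> p \<noteq> 0"
proof -
  obtain s0 where s0: "s0 \<in> S" using assms(2) by fastforce
  have "\<exists>\<sigma>. (\<forall>i. \<sigma> i \<in> S) \<and> meval (\<lambda>x. x) \<sigma> p \<noteq> 0"
    if "finite V" "mvars p \<subseteq> V" "p \<noteq> 0" "total_deg p < card S" for V and p :: "'a mpoly"
    using that
  proof (induction V arbitrary: p)
    case empty
    then have "Poly_Mapping.keys p \<subseteq> {0}"
      by (auto simp: mvars_def)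
    then have "total_deg p = 0"
      using total_deg_le_iff[of p 0] by auto
    then have p: "p = mconst (Poly_Mapping.lookup p 0)" by (rule total_deg_eq_0_imp_const)
    then have "Poly_Mapping.lookup p 0 \<noteq> 0" using empty by (auto simp: mconst_def)
    then have "meval (\<lambda>x. x) (\<lambda>_. s0) p \<noteq> 0" by (subst p) simp
    then show ?case using s0 by auto
  next
    case (insert i V)
    have "var_poly i p \<noteq> 0" using insert.prems(2) poly_var_poly[of i p] by auto
    then obtain k where k: "coeff (var_poly i p) k \<noteq> 0" by (auto simp: poly_eq_iff)
    have "mvars (coeff (var_poly i p) k) \<subseteq> V"
      using mvars_coeff_var_poly[of i p k] insert.prems(1) by auto
    moreover have "total_deg (coeff (var_poly i p) k) < card S"
      using total_deg_coeff_var_poly[of i p k] insert.prems(3) by simp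
    ultimately obtain \<sigma> where \<sigma>: "\<forall>i. \<sigma> i \<in> S" "meval (\<lambda>x. x) \<sigma> (coeff (var_poly i p) k) \<noteq> 0"
      using insert.IH k by blast
    define e where "e = meval (\<lambda>x::'a. x) \<sigma>"
    interpret e: comm_ring_hom e
      unfolding e_def by (intro comm_ring_hom.meval_hom id_hom)
    define u where "u = map_poly e (var_poly i p)"
    have "coeff u k \<noteq> 0" using \<sigma>(2) by (simp add: u_def e_def[symmetric])
    then have "u \<noteq> 0" by auto
    have "degree u \<le> total_deg p"
      unfolding u_def using degree_map_poly_le degree_var_poly order_trans by blast
    then have "card {x. poly u x = 0} < card S"
      using card_poly_roots_bound[OF \<open>u \<noteq> 0\<close>] insert.prems(3) by simp
    then have "\<not> S \<subseteq> {x. poly u x = 0}"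
      using poly_roots_finite[OF \<open>u \<noteq> 0\<close>] card_mono[of "{x. poly u x = 0}" S] by auto
    then obtain s where s: "s \<in> S" "poly u s \<noteq> 0" by auto
    have l: "comm_ring_hom (lift_hom e s)" by (intro lift_hom_hom e.comm_ring_hom_axioms)
    have "lift_hom e s (var_poly i p) = meval (\<lambda>x. x) (\<sigma>(i := s)) p"
      unfolding var_poly_def comm_ring_hom.hom_meval[OF l]
      by (intro arg_cong2[of _ _ _ _ "\<lambda>c \<sigma>. meval c \<sigma> p"] ext)
         (auto simp: e_def e.hom_zero[unfolded e_def] e.hom_one[unfolded e_def])
    then have "poly u s = meval (\<lambda>x. x) (\<sigma>(i := s)) p" by (simp add: u_def lift_hom_def)
    then show ?case using s \<sigma>(1) by (intro exI[of _ "\<sigma>(i := s)"]) (simp add: fun_upd_def)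
  qed
  from this[OF finite_mvars order_refl assms] show ?thesis .
qed

section \<open>Iterated univariate polynomials\<close>

lemma mvars_add: "mvars (p + q) \<subseteq> mvars p \<union> mvars q"
proof -
  have "Poly_Mapping.keys (p + q) \<subseteq> Poly_Mapping.keys p \<union> Poly_Mapping.keys q" by (rule keys_add)
  then show ?thesis unfolding mvars_def by auto
qed

lemma mvars_mult: "mvars (p * q :: 'a::comm_ring_1 mpoly) \<subseteq> mvars p \<union> mvars q"
proof
  fix i assume "i \<in> mvars (p * q)"
  then obtain m where m: "m \<in> Poly_Mapping.keys (p * q)" "i \<in> Poly_Mapping.keys m"
    by (auto simp: mvars_def)
  from m(1) have "m \<in> {a + b |a b. a \<in> Poly_Mapping.keys p \<and> b \<in> Poly_Mapping.keys q}"
    by (rule subsetD[OF keys_mult])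
  then obtain a b where ab: "a \<in> Poly_Mapping.keys p" "b \<in> Poly_Mapping.keys q" "m = a + b" by blast
  have "i \<in> Poly_Mapping.keys a \<or> i \<in> Poly_Mapping.keys b"
    using m(2) ab(3) by (auto simp: in_keys_iff lookup_add)
  then show "i \<in> mvars p \<union> mvars q" using ab by (auto simp: mvars_def)
qed

lemma mvars_mconst [simp]: "mvars (mconst c) = {}"
  by (auto simp: mvars_def mconst_def)

lemma mvars_mvar: "mvars (mvar i :: 'a::comm_ring_1 mpoly) \<subseteq> {i}"
  by (auto simp: mvars_def mvar_def)

lemma mvars_empty_imp_const:
  assumes "mvars p = {}"
  shows "p = mconst (Poly_Mapping.lookup p 0)"
proof (rule total_deg_eq_0_imp_const)
  have "m = 0" if "m \<in> Poly_Mapping.keys p" for m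
  proof -
    have "Poly_Mapping.keys m = {}" using that assms by (auto simp: mvars_def)
    then show ?thesis by simp
  qed
  then have "total_deg p \<le> 0" unfolding total_deg_le_iff by fastforce
  then show "total_deg p = 0" by simp
qed

text \<open>\<open>h\<close> identifies an n-fold iterated \<open>poly\<close> ring with the
  polynomials in X_0, ..., X_(n-1). In the iterated ring over a field irreducible elements are
  prime, and this is where primality of the component is obtained.\<close>

definition nested :: "('r::comm_ring_1 \<Rightarrow> 'a::comm_ring_1 mpoly) \<Rightarrow> nat \<Rightarrow> bool" where
  "nested h n \<longleftrightarrow> comm_ring_hom h \<and> inj h \<and> range h = {p. mvars p \<subseteq> {..<n}}"

lemma nested_0: "nested (mconst :: 'a::comm_ring_1 \<Rightarrow> 'a mpoly) 0"
proof -
  have "inj (mconst :: 'a \<Rightarrow> 'a mpoly)"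
    by (rule injI) (metis lookup_single_eq mconst_def)
  moreover have "range mconst = {p :: 'a mpoly. mvars p \<subseteq> {..<0}}"
    using mvars_empty_imp_const by auto
  ultimately show ?thesis by (simp add: nested_def mconst_hom)
qed

lemma nested_Suc:
  assumes "nested h n"
  shows "nested (lift_hom h (mvar n)) (Suc n)"
proof -
  from assms have hom: "comm_ring_hom h" and inj: "inj h" and ran: "range h = {p. mvars p \<subseteq> {..<n}}"
    by (auto simp: nested_def)
  interpret h: comm_ring_hom h by fact
  interpret v: comm_ring_hom "var_poly n :: 'b mpoly \<Rightarrow> _" by (rule var_poly_hom)
  have vars_h: "mvars (h a) \<subseteq> {..<n}" for a using ran by auto
  have vh: "var_poly n (h a) = [:h a:]" for a
    by (rule var_poly_free) (use vars_h in blast)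
  have split: "var_poly n (lift_hom h (mvar n) p) = map_poly h p" for p
    unfolding lift_hom_def
    by (induction p)
       (simp_all add: h.map_poly_pCons_hom v.hom_add v.hom_mult vh var_poly_mvar)
  have "inj (lift_hom h (mvar n))"
  proof (rule injI)
    fix p q assume "lift_hom h (mvar n) p = lift_hom h (mvar n) q"
    then have "map_poly h p = map_poly h q" by (simp flip: split)
    then have "h (coeff p i) = h (coeff q i)" for i
      by (metis h.coeff_map_poly_hom)
    then show "p = q" using inj by (auto simp: poly_eq_iff inj_def)
  qed
  moreover have "mvars (lift_hom h (mvar n) p) \<subseteq> {..<Suc n}" for p
  proof (induction p)
    case 0
    show ?case by (simp add: lift_hom_def mvars_def)
  next
    case (pCons a p)
    let ?q = "lift_hom h (mvar n) p"
    have "mvars (h a + mvar n * ?q) \<subseteq> mvars (h a) \<union> (mvars (mvar n :: 'b mpoly) \<union> mvars ?q)"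
      using mvars_add[of "h a" "mvar n * ?q"] mvars_mult[of "mvar n" ?q] by blast
    also have "\<dots> \<subseteq> {..<Suc n}" using vars_h[of a] mvars_mvar[of n] pCons.IH by fastforce
    finally show ?case by (simp add: lift_hom_def h.map_poly_pCons_hom)
  qed
  moreover have "p \<in> range (lift_hom h (mvar n))" if "mvars p \<subseteq> {..<Suc n}" for p
  proof -
    have "coeff (var_poly n p) k \<in> range h" for k
      using mvars_coeff_var_poly[of n p k] that unfolding ran by fastforce
    then have *: "h (inv_into UNIV h (coeff (var_poly n p) k)) = coeff (var_poly n p) k" for k
      by (rule f_inv_into_f)
    have "inv_into UNIV h 0 = 0" using inv_into_f_f[OF inj, of 0] by simp
    then have "map_poly h (map_poly (inv_into UNIV h) (var_poly n p)) = var_poly n p"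
      by (intro poly_eqI) (simp add: coeff_map_poly *)
    then have "lift_hom h (mvar n) (map_poly (inv_into UNIV h) (var_poly n p)) = p"
      by (simp add: lift_hom_def poly_var_poly)
    then show ?thesis by (metis rangeI)
  qed
  ultimately show ?thesis
    unfolding nested_def using lift_hom_hom[OF hom] by blast
qed

text \<open>Units of \<open>mpoly\<close> over a domain are constants, so the inverse of a unit
  \<open>h a\<close> lies in the range of \<open>h\<close> and \<open>a\<close> is already a
  unit.\<close>

lemma nested_irreducible:
  fixes h :: "'r::idom \<Rightarrow> 'a::idom mpoly"
  assumes "nested h n" "irreducible (h r)"
  shows "irreducible r"
proof -
  from assms have hom: "comm_ring_hom h" and inj: "inj h" and ran: "range h = {p. mvars p \<subseteq> {..<n}}"
    by (auto simp: nested_def)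
  interpret h: comm_ring_hom h by fact
  have unit: "a dvd 1" if "h a dvd 1" for a
  proof -
    from that obtain b where b: "h a * b = 1" by (auto simp: dvd_def)
    have "b = mconst (Poly_Mapping.lookup b 0)"
      using mpoly_unit_iff_const(2)[OF b] by (rule total_deg_eq_0_imp_const)
    then have "mvars b = {}" by (metis mvars_mconst)
    then have "b \<in> range h" unfolding ran by auto
    then obtain b' where "b = h b'" by auto
    then have "h (a * b') = h 1" using b by (simp add: h.hom_mult)
    then have "a * b' = 1" by (rule injD[OF inj])
    then show ?thesis by (metis dvd_triv_left)
  qed
  show ?thesis
  proof (rule irreducibleI)
    show "r \<noteq> 0" using assms(2) by (auto simp: irreducible_def)
    show "\<not> r dvd 1" using assms(2) h.hom_dvd_1 by (auto simp: irreducible_def)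
    fix a b assume "r = a * b"
    then have "h r = h a * h b" by (simp add: h.hom_mult)
    then have "h a dvd 1 \<or> h b dvd 1" using assms(2) by (auto simp: irreducible_def)
    then show "a dvd 1 \<or> b dvd 1" using unit by auto
  qed
qed

lemma nested_7:
  "\<exists>h :: 'a::comm_ring_1 poly poly poly poly poly poly poly \<Rightarrow> 'a mpoly. nested h 7"
proof -
  have "nested (lift_hom (lift_hom (lift_hom (lift_hom (lift_hom (lift_hom (lift_hom mconst (mvar 0))
      (mvar 1)) (mvar 2)) (mvar 3)) (mvar 4)) (mvar 5)) (mvar 6) ::
      'a poly poly poly poly poly poly poly \<Rightarrow> 'a mpoly) (Suc (Suc (Suc (Suc (Suc (Suc (Suc 0)))))))"
    using nested_Suc[OF nested_Suc[OF nested_Suc[OF nested_Suc[OF nested_Suc[OF nested_Suc[OF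
      nested_Suc[OF nested_0]]]]]]] by (simp add: eval_nat_numeral)
  then show ?thesis by (auto simp: eval_nat_numeral)
qed

lemma nested_prime:
  fixes G :: "'a::field alg_closure mpoly"
  assumes "irreducible G" "mvars G \<subseteq> {..<7}"
  shows "\<exists>(\<psi> :: 'a alg_closure poly poly poly poly poly poly poly \<Rightarrow> 'a alg_closure mpoly) g.
           nested \<psi> 7 \<and> \<psi> g = G \<and> prime_elem g"
proof -
  obtain \<psi> :: "'a alg_closure poly poly poly poly poly poly poly \<Rightarrow> 'a alg_closure mpoly"
    where \<psi>: "nested \<psi> 7" using nested_7 by blast
  then have "G \<in> range \<psi>" using assms(2) by (simp add: nested_def)
  then obtain g where g: "\<psi> g = G" by auto
  then have "irreducible g" using nested_irreducible[OF \<psi>, of g] assms(1) by simp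
  then have "prime_elem g" by (rule irreducible_imp_prime_elem)
  then show ?thesis using \<psi> g by blast
qed

section \<open>Linear algebra\<close>

lemma linear_system_nontrivial:
  fixes a :: "'e \<Rightarrow> 'i \<Rightarrow> 'r::idom"
  assumes "finite E" "finite I" "card E < card I"
  shows "\<exists>c. (\<exists>k\<in>I. c k \<noteq> 0) \<and> (\<forall>e\<in>E. (\<Sum>k\<in>I. a e k * c k) = 0)"
  using assms
proof (induction E arbitrary: I a rule: finite_induct)
  case empty
  then have "I \<noteq> {}" by auto
  then show ?case by (intro exI[of _ "\<lambda>_. 1"]) auto
next
  case (insert e E)
  show ?case
  proof (cases "\<forall>k\<in>I. a e k = 0")
    case True
    moreover obtain c where "\<exists>k\<in>I. c k \<noteq> 0" "\<forall>e\<in>E. (\<Sum>k\<in>I. a e k * c k) = 0"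
      using insert.IH[of I a] insert.prems insert.hyps by auto
    ultimately show ?thesis by (intro exI[of _ c]) auto
  next
    case False
    then obtain k0 where k0: "k0 \<in> I" "a e k0 \<noteq> 0" by auto
    define J where "J = I - {k0}"
    have J: "finite J" "k0 \<notin> J" "I = insert k0 J" using insert.prems k0 by (auto simp: J_def)
    \<comment> \<open>Cross-multiplied elimination of the unknown \<open>k0\<close> by equation
      \<open>e\<close>. Nothing is divided, so a domain of coefficients is enough.\<close>
    define b where "b = (\<lambda>e' k. a e k0 * a e' k - a e' k0 * a e k)"
    have "card E < card J" using insert.prems insert.hyps J by simp
    from insert.IH[OF J(1) this, of b] obtain d where
      d: "\<exists>k\<in>J. d k \<noteq> 0" "\<forall>e\<in>E. (\<Sum>k\<in>J. b e k * d k) = 0" by auto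
    define c where "c = (\<lambda>k. if k = k0 then - (\<Sum>k\<in>J. a e k * d k) else a e k0 * d k)"
    have cJ: "c k = a e k0 * d k" if "k \<in> J" for k using that J(2) by (auto simp: c_def)
    have sum_c: "(\<Sum>k\<in>I. a e' k * c k) = (\<Sum>k\<in>J. b e' k * d k)" for e'
    proof -
      have "(\<Sum>k\<in>I. a e' k * c k) = a e' k0 * c k0 + (\<Sum>k\<in>J. a e' k * (a e k0 * d k))"
        using J cJ by simp
      also have "\<dots> = (\<Sum>k\<in>J. b e' k * d k)"
        by (simp add: c_def b_def sum_distrib_left algebra_simps sum_subtractf)
      finally show ?thesis .
    qed
    have "(\<Sum>k\<in>I. a e k * c k) = 0"
      unfolding sum_c by (simp add: b_def)
    moreover have "(\<Sum>k\<in>I. a e' k * c k) = 0" if "e' \<in> E" for e'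
      unfolding sum_c using d that by simp
    moreover have "\<exists>k\<in>I. c k \<noteq> 0" using d(1) cJ k0 J by auto
    ultimately show ?thesis by (intro exI[of _ c]) auto
  qed
qed

text \<open>Rows are found one at a time. The cofactors along the last row of a bordered matrix form
  a nonzero vector, since the last of them is the minor already found; a row \<open>r\<close> not
  annihilated by this vector extends the minor, by Laplace expansion.\<close>

lemma nonzero_minor_exists:
  fixes M :: "nat \<Rightarrow> nat \<Rightarrow> 'r::idom"
  assumes "\<And>c. \<exists>b<u. c b \<noteq> 0 \<Longrightarrow> \<exists>r<N. (\<Sum>b<u. M r b * c b) \<noteq> 0"
  shows "\<exists>rs. length rs = u \<and> set rs \<subseteq> {..<N} \<and> det (mat u u (\<lambda>(a, b). M (rs ! a) b)) \<noteq> 0"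
  using assms
proof (induction u)
  case 0
  show ?case by (intro exI[of _ "[]"]) (simp add: det_dim_zero)
next
  case (Suc u)
  have "\<exists>r<N. (\<Sum>b<u. M r b * c b) \<noteq> 0" if "\<exists>b<u. c b \<noteq> 0" for c
  proof -
    have "\<exists>b<Suc u. (c(u := 0)) b \<noteq> 0" using that by (auto intro: less_SucI)
    from Suc.prems[OF this] show ?thesis by simp
  qed
  then obtain rs where rs: "length rs = u" "set rs \<subseteq> {..<N}"
      "det (mat u u (\<lambda>(a, b). M (rs ! a) b)) \<noteq> 0"
    using Suc.IH by blast
  define A where "A = (\<lambda>r. mat (Suc u) (Suc u) (\<lambda>(a, b). M ((rs @ [r]) ! a) b))"
  have A: "A r \<in> carrier_mat (Suc u) (Suc u)" for r by (simp add: A_def)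
  have del: "mat_delete (A r) u b = mat_delete (A 0) u b" if "b < Suc u" for r b
    by (rule eq_matI) (use rs(1) in \<open>auto simp: A_def mat_delete_def nth_append\<close>)
  have "mat_delete (A 0) u u = mat u u (\<lambda>(a, b). M (rs ! a) b)"
    by (rule eq_matI) (use rs(1) in \<open>auto simp: A_def mat_delete_def nth_append\<close>)
  then have "cofactor (A 0) u u \<noteq> 0" using rs(3) by (simp add: cofactor_def)
  then have "\<exists>b<Suc u. cofactor (A 0) u b \<noteq> 0" by blast
  from Suc.prems[OF this] obtain r where r: "r < N" "(\<Sum>b<Suc u. M r b * cofactor (A 0) u b) \<noteq> 0"
    by blast
  have "det (A r) = (\<Sum>b<Suc u. A r $$ (u, b) * cofactor (A r) u b)"
    by (rule laplace_expansion_row[OF A]) simp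
  also have "\<dots> = (\<Sum>b<Suc u. M r b * cofactor (A 0) u b)"
  proof (rule sum.cong[OF refl])
    fix b assume "b \<in> {..<Suc u}"
    then show "A r $$ (u, b) * cofactor (A r) u b = M r b * cofactor (A 0) u b"
      using rs(1) del[of b r] by (simp add: cofactor_def) (simp add: A_def nth_append)
  qed
  finally have "det (A r) \<noteq> 0" using r(2) by simp
  then show ?case
    using rs r(1) by (intro exI[of _ "rs @ [r]"]) (simp add: A_def)
qed

lemma trivial_kernel_of_det:
  fixes M :: "nat \<Rightarrow> nat \<Rightarrow> 'r::idom"
  assumes "det (mat u u (\<lambda>(a, b). M a b)) \<noteq> 0"
    and "\<And>a. a < u \<Longrightarrow> (\<Sum>b<u. M a b * c b) = 0" and "b < u"
  shows "c b = 0"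
proof (rule ccontr)
  assume "c b \<noteq> 0"
  let ?A = "mat u u (\<lambda>(a, b). M a b)" and ?v = "Matrix.vec u c"
  have "?v \<noteq> 0\<^sub>v u"
    using \<open>c b \<noteq> 0\<close> \<open>b < u\<close> by (metis index_vec index_zero_vec(1))
  moreover have "?A *\<^sub>v ?v = 0\<^sub>v u"
    by (rule eq_vecI)
       (use assms(2) in \<open>auto simp: scalar_prod_def atLeast0LessThan\<close>)
  ultimately have "det ?A = 0"
    by (subst det_0_iff_vec_prod_zero[of _ u]) (auto intro!: exI[of _ ?v])
  then show False using assms(1) by simp
qed

section \<open>Polynomials over filtered rings\<close>

text \<open>\<open>D n\<close> stands for the elements of degree at most n. Among the instances are
  the degree in x, the total degree in the coordinates of the generic direction, and the constant
  family \<open>UNIV\<close>, which gives plain division with remainder.\<close>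

locale ring_filtration =
  fixes D :: "nat \<Rightarrow> 'r::comm_ring_1 set"
  assumes zero_in: "0 \<in> D n" and one_in: "1 \<in> D n"
    and add_in: "a \<in> D n \<Longrightarrow> b \<in> D n \<Longrightarrow> a + b \<in> D n"
    and uminus_in: "a \<in> D n \<Longrightarrow> - a \<in> D n"
    and mult_in: "a \<in> D m \<Longrightarrow> b \<in> D n \<Longrightarrow> a * b \<in> D (m + n)"
    and mono: "m \<le> n \<Longrightarrow> D m \<subseteq> D n"
begin

text \<open>For the degree filtration of the polynomials in x this is total degree in x and y. The
  clause \<open>i \<le> n\<close> is stated separately because \<open>n - i\<close> is
  truncated.\<close>

definition wdeg :: "nat \<Rightarrow> 'r poly \<Rightarrow> bool" where
  "wdeg n p \<longleftrightarrow> (\<forall>i. coeff p i \<noteq> 0 \<longrightarrow> i \<le> n \<and> coeff p i \<in> D (n - i))"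

lemma wdegI: "(\<And>i. coeff p i \<noteq> 0 \<Longrightarrow> i \<le> n \<and> coeff p i \<in> D (n - i)) \<Longrightarrow> wdeg n p"
  by (auto simp: wdeg_def)

lemma wdeg_coeff: "wdeg n p \<Longrightarrow> coeff p i \<in> D (n - i)"
  by (cases "coeff p i = 0") (auto simp: wdeg_def zero_in)

lemma wdeg_coeff_eq_0: "wdeg n p \<Longrightarrow> n < i \<Longrightarrow> coeff p i = 0"
  by (auto simp: wdeg_def)

lemma wdeg_degree: "wdeg n p \<Longrightarrow> degree p \<le> n"
  by (rule degree_le) (auto simp: wdeg_coeff_eq_0)

lemma sum_in: "(\<And>i. i \<in> A \<Longrightarrow> f i \<in> D n) \<Longrightarrow> sum f A \<in> D n"
  by (induction A rule: infinite_finite_induct) (auto simp: zero_in intro: add_in)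

lemma wdeg_0 [simp]: "wdeg n 0"
  by (simp add: wdeg_def)

lemma wdeg_add: "wdeg n p \<Longrightarrow> wdeg n q \<Longrightarrow> wdeg n (p + q)"
  by (rule wdegI) (auto simp: wdeg_coeff add_in wdeg_coeff_eq_0 not_less[symmetric])

lemma wdeg_uminus: "wdeg n p \<Longrightarrow> wdeg n (- p)"
  by (auto simp: wdeg_def uminus_in)

lemma wdeg_diff: "wdeg n p \<Longrightarrow> wdeg n q \<Longrightarrow> wdeg n (p - q)"
  using wdeg_add[of n p "- q"] wdeg_uminus[of n q] by simp

lemma wdeg_sum: "(\<And>i. i \<in> A \<Longrightarrow> wdeg n (f i)) \<Longrightarrow> wdeg n (sum f A)"
  by (induction A rule: infinite_finite_induct) (auto intro: wdeg_add)

lemma wdeg_mono: "wdeg m p \<Longrightarrow> m \<le> n \<Longrightarrow> wdeg n p"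
  unfolding wdeg_def using mono by (meson diff_le_mono order_trans subsetD)

lemma wdeg_mult:
  assumes "wdeg m p" "wdeg n q"
  shows "wdeg (m + n) (p * q)"
proof (rule wdegI)
  fix i assume "coeff (p * q) i \<noteq> 0"
  have *: "coeff p j * coeff q (i - j) = 0 \<or> (i \<le> m + n \<and> coeff p j * coeff q (i - j) \<in> D (m + n - i))"
    if "j \<le> i" for j
  proof (cases "coeff p j = 0 \<or> coeff q (i - j) = 0")
    case False
    then have "j \<le> m" "i - j \<le> n" "coeff p j \<in> D (m - j)" "coeff q (i - j) \<in> D (n - (i - j))"
      using assms by (auto simp: wdeg_def)
    moreover from this have "m - j + (n - (i - j)) = m + n - i" using that by linarith
    ultimately show ?thesis using mult_in[of "coeff p j" "m - j" "coeff q (i - j)" "n - (i - j)"] that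
      by auto
  qed auto
  have "i \<le> m + n"
  proof (rule ccontr)
    assume "\<not> i \<le> m + n"
    then have "coeff (p * q) i = 0"
      unfolding coeff_mult by (intro sum.neutral) (use * in auto)
    then show False using \<open>coeff (p * q) i \<noteq> 0\<close> by simp
  qed
  moreover have "coeff (p * q) i \<in> D (m + n - i)"
    unfolding coeff_mult by (intro sum_in) (use * zero_in in fastforce)
  ultimately show "i \<le> m + n \<and> coeff (p * q) i \<in> D (m + n - i)" ..
qed

lemma wdeg_monom: "a \<in> D k \<Longrightarrow> wdeg (k + i) (Polynomial.monom a i)"
  by (auto simp: wdeg_def)

lemma wdeg_const: "a \<in> D k \<Longrightarrow> wdeg k [:a:]"
  using wdeg_monom[of a k 0] by (simp add: monom_0)

lemma wdeg_1: "wdeg 0 1"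
  using wdeg_const[OF one_in, of 0] by (simp add: one_pCons)

lemma wdeg_power: "wdeg m p \<Longrightarrow> wdeg (k * m) (p ^ k)"
  by (induction k) (auto simp: wdeg_1 intro: wdeg_mult)

text \<open>Every division step subtracts a multiple of \<open>f\<close> whose weight does not
  exceed that allowed for the leading term of \<open>p\<close>, so the weight bound survives in the
  remainder.\<close>

lemma wdeg_reduce:
  assumes f: "degree f = d" "lead_coeff f = 1" "0 < d" "wdeg d f"
    and p: "wdeg n p"
  shows "\<exists>q r. p = f * q + r \<and> degree r < d \<and> wdeg n r"
  using p
proof (induction "degree p" arbitrary: p rule: less_induct)
  case less
  show ?case
  proof (cases "degree p < d")
    case True
    then show ?thesis using less.prems by (intro exI[of _ 0] exI[of _ p]) simp
  next
    case False
    define k where "k = degree p - d"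
    define a where "a = lead_coeff p"
    define p' where "p' = p - Polynomial.monom a k * f"
    have deg: "degree p = k + d" using False by (simp add: k_def)
    have "p \<noteq> 0" using False f(3) by auto
    then have n: "degree p \<le> n" "a \<in> D (n - degree p)"
      using less.prems by (auto simp: wdeg_def a_def)
    have "wdeg (n - degree p + k) (Polynomial.monom a k)" using n by (intro wdeg_monom)
    then have "wdeg (n - degree p + k + d) (Polynomial.monom a k * f)"
      by (intro wdeg_mult f)
    then have w: "wdeg n p'"
      using less.prems n(1) deg unfolding p'_def by (intro wdeg_diff) (simp_all add: add.assoc)
    have "coeff p' i = 0" if "i \<ge> degree p" for i
    proof (cases "i = degree p")
      case True
      then show ?thesis
        using deg f(1,2) by (simp add: p'_def coeff_monom_mult a_def)
    next
      case False
      then have "i > degree p" using that by simp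
      then show ?thesis
        using deg f(1) by (simp add: p'_def coeff_monom_mult coeff_eq_0)
    qed
    then have "degree p' < degree p"
      using deg f(3) by (metis add_gr_0 degree_0 leading_coeff_0_iff not_less)
    from less.hyps[OF this w] obtain q r where "p' = f * q + r" "degree r < d" "wdeg n r" by blast
    then show ?thesis
      by (intro exI[of _ "q + Polynomial.monom a k"] exI[of _ r]) (simp add: p'_def algebra_simps)
  qed
qed

end

lemma monic_dvd_degree_less:
  fixes f r :: "'r::idom poly"
  assumes "lead_coeff f = 1" "f dvd r" "degree r < degree f"
  shows "r = 0"
  using assms by (metis dvd_imp_degree_le not_less)

global_interpretation deg: ring_filtration "\<lambda>n. {p :: 'k::idom poly. degree p \<le> n}"
  defines tdeg = deg.wdeg
  by unfold_locales (auto intro: degree_add_le order_trans[OF degree_mult_le] add_mono)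

section \<open>Plane curves and power series\<close>

text \<open>Restriction to a branch: the outer variable y becomes the series \<open>Y\<close>, and
  the inner variable x remains the parameter.\<close>

abbreviation curve_eval :: "'k::idom fps \<Rightarrow> 'k poly poly \<Rightarrow> 'k fps" where
  "curve_eval Y \<equiv> lift_hom fps_of_poly Y"

lemma fps_of_poly_hom: "comm_ring_hom (fps_of_poly :: 'k::idom poly \<Rightarrow> _)"
  by unfold_locales (simp_all add: fps_of_poly_add fps_of_poly_mult)

lemma curve_eval_hom: "comm_ring_hom (curve_eval Y)"
  by (intro lift_hom_hom fps_of_poly_hom)

lemma curve_eval_const [simp]: "curve_eval Y [:p:] = fps_of_poly p"
  by simp

definition xy :: "nat \<Rightarrow> nat \<Rightarrow> 'k::comm_ring_1 poly poly" where
  "xy i j = Polynomial.monom (Polynomial.monom 1 i) j"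

lemma coeff_xy: "coeff (coeff (xy i j) b) a = (if a = i \<and> b = j then 1 else 0)"
  by (auto simp: xy_def)

lemma tdeg_xy: "tdeg (i + j) (xy i j :: 'k::idom poly poly)"
  unfolding xy_def by (rule deg.wdeg_monom) (simp add: degree_monom_le)

lemma smult_smult_coeff: "coeff (coeff (Polynomial.smult [:c:] p) b) a = c * coeff (coeff p b) a"
  by simp

text \<open>A weak Bezout bound, by counting. If \<open>h\<close> vanished to order s on the branch,
  the products h x^i y^j (i < s, j < d) reduced modulo \<open>f\<close>, together with the powers
  x^l (l < s), would be linearly dependent: h W + R(x) is a multiple of \<open>f\<close> with deg R
  < s. On the branch R vanishes to order s, so R = 0, and then \<open>dom\<close> gives W = 0. As
  only a domain is required, the bound also serves the generic section.\<close>

lemma curve_order_bound: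
  fixes f h :: "'k::idom poly poly"
  assumes f: "degree f = d" "lead_coeff f = 1" "0 < d" "tdeg d f"
    and dom: "\<And>w h. degree w < d \<Longrightarrow> degree h < d \<Longrightarrow> f dvd w * h \<Longrightarrow> w = 0 \<or> h = 0"
    and Y: "curve_eval Y f = 0"
    and h: "h \<noteq> 0" "degree h < d" "tdeg A h"
  shows "\<exists>k\<le>d * (A + d - 1). fps_nth (curve_eval Y h) k \<noteq> 0"
proof (rule ccontr)
  assume "\<not> ?thesis"
  then have ord: "fps_nth (curve_eval Y h) k = 0" if "k \<le> d * (A + d - 1)" for k using that by auto
  \<comment> \<open>With this s, the number n d of equations is s d + s - 1, exactly one less than
    the number s d + s of unknowns.\<close>
  define s where "s = d * (A + d - 1) + 1"
  define n where "n = s + A + d - 1"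
  interpret e: comm_ring_hom "curve_eval Y" by (rule curve_eval_hom)
  have "\<exists>q r. h * xy (fst ij) (snd ij) = f * q + r \<and> degree r < d \<and> tdeg (A + (fst ij + snd ij)) r"
    for ij :: "nat \<times> nat"
    by (intro deg.wdeg_reduce f deg.wdeg_mult h tdeg_xy)
  then obtain q r where qr: "\<And>ij. h * xy (fst ij) (snd ij) = f * q ij + r ij"
      "\<And>ij. degree (r ij) < d" "\<And>ij. tdeg (A + (fst ij + snd ij)) (r ij)"
    by metis
  define I where "I = ({..<s} \<times> {..<d}) <+> {..<s}"
  define E where "E = {..<n} \<times> {..<d}"
  define v where "v = (\<lambda>k. case k of Inl ij \<Rightarrow> r ij | Inr l \<Rightarrow> xy l 0)"
  have "card E < card I"
    using f(3) by (simp add: E_def I_def card_cartesian_product card_Plus n_def s_def algebra_simps)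
  then obtain c where c: "\<exists>k\<in>I. c k \<noteq> 0"
      "\<forall>e\<in>E. (\<Sum>k\<in>I. coeff (coeff (v k) (snd e)) (fst e) * c k) = 0"
    using linear_system_nontrivial[of E I "\<lambda>e k. coeff (coeff (v k) (snd e)) (fst e)"]
    by (auto simp: E_def I_def)
  define W where "W = (\<Sum>ij\<in>{..<s} \<times> {..<d}. Polynomial.smult [:c (Inl ij):] (xy (fst ij) (snd ij)))"
  define R where "R = (\<Sum>l<s. Polynomial.smult (c (Inr l)) (Polynomial.monom 1 l))"
  have sumI: "(\<Sum>k\<in>I. F k) = (\<Sum>ij\<in>{..<s} \<times> {..<d}. F (Inl ij)) + (\<Sum>l<s. F (Inr l))"
    for F :: "_ \<Rightarrow> 'k poly poly"
    unfolding I_def by (simp add: sum.Plus)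
  have v_zero: "coeff (coeff (v k) b) a = 0" if "k \<in> I" "\<not> (a < n \<and> b < d)" for k a b
  proof (cases k)
    case (Inl ij)
    have "coeff (coeff (r ij) b) a = 0"
    proof (cases "b < d")
      case False
      then show ?thesis using qr(2)[of ij] by (simp add: coeff_eq_0)
    next
      case True
      have "degree (coeff (r ij) b) \<le> A + (fst ij + snd ij)"
        using deg.wdeg_coeff[OF qr(3)[of ij], of b] by simp
      also have "\<dots> < n" using that(1) Inl by (auto simp: I_def n_def)
      finally show ?thesis using True that(2) by (intro coeff_eq_0) auto
    qed
    then show ?thesis by (simp add: v_def Inl)
  next
    case (Inr l)
    then show ?thesis using that f(3) by (auto simp: v_def coeff_xy I_def n_def)
  qed
  have "(\<Sum>k\<in>I. Polynomial.smult [:c k:] (v k)) = 0"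
  proof (intro poly_eqI)
    fix b a
    have "coeff (coeff (\<Sum>k\<in>I. Polynomial.smult [:c k:] (v k)) b) a = (\<Sum>k\<in>I. coeff (coeff (v k) b) a * c k)"
      by (simp add: coeff_sum mult.commute)
    also have "\<dots> = 0"
    proof (cases "a < n \<and> b < d")
      case True
      then show ?thesis using c(2) by (auto simp: E_def)
    next
      case False
      then show ?thesis using v_zero by (intro sum.neutral) auto
    qed
    finally show "coeff (coeff (\<Sum>k\<in>I. Polynomial.smult [:c k:] (v k)) b) a = coeff (coeff 0 b) a" by simp
  qed
  then have rel: "(\<Sum>ij\<in>{..<s} \<times> {..<d}. Polynomial.smult [:c (Inl ij):] (r ij)) + [:R:] = 0"
    unfolding sumI by (simp add: v_def R_def xy_def monom_0 smult_monom flip: sum_to_poly)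
  have "h * W = (\<Sum>ij\<in>{..<s} \<times> {..<d}. Polynomial.smult [:c (Inl ij):] (f * q ij + r ij))"
    unfolding W_def sum_distrib_left by (simp flip: qr(1))
  also have "\<dots> = f * (\<Sum>ij\<in>{..<s} \<times> {..<d}. Polynomial.smult [:c (Inl ij):] (q ij))
      + (\<Sum>ij\<in>{..<s} \<times> {..<d}. Polynomial.smult [:c (Inl ij):] (r ij))"
    by (simp add: smult_add_right sum.distrib sum_distrib_left)
  finally have hW: "h * W + [:R:] = f * (\<Sum>ij\<in>{..<s} \<times> {..<d}. Polynomial.smult [:c (Inl ij):] (q ij))"
    using rel by (simp add: algebra_simps)
  have "curve_eval Y (h * W + [:R:]) = 0"
    unfolding hW e.hom_mult Y by simp
  then have ev: "curve_eval Y h * curve_eval Y W + fps_of_poly R = 0"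
    by (simp add: e.hom_add e.hom_mult)
  have coeffR: "coeff R k = (if k < s then c (Inr k) else 0)" for k
  proof -
    have "coeff R k = (\<Sum>l<s. if l = k then c (Inr l) else 0)"
      unfolding R_def coeff_sum by (intro sum.cong) auto
    then show ?thesis by simp
  qed
  have "coeff R k = 0" if "k < s" for k
  proof -
    have "fps_nth (curve_eval Y h * curve_eval Y W) k = 0"
      unfolding fps_mult_nth by (intro sum.neutral) (use that ord in \<open>auto simp: s_def\<close>)
    then show ?thesis
      using arg_cong[OF ev, of "\<lambda>x. fps_nth x k"] by simp
  qed
  then have cr: "c (Inr k) = 0" if "k < s" for k using coeffR[of k] that by simp
  then have "R = 0" by (simp add: R_def)
  then have "W * h = f * (\<Sum>ij\<in>{..<s} \<times> {..<d}. Polynomial.smult [:c (Inl ij):] (q ij))"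
    using hW by (simp add: mult.commute)
  then have "f dvd W * h" by (rule dvdI)
  moreover have coeffW: "coeff (coeff W b) a = (if a < s \<and> b < d then c (Inl (a, b)) else 0)" for a b
  proof -
    have "coeff (coeff W b) a = (\<Sum>ij\<in>{..<s} \<times> {..<d}. if ij = (a, b) then c (Inl ij) else 0)"
      unfolding W_def coeff_sum smult_smult_coeff coeff_xy by (intro sum.cong) auto
    then show ?thesis by (simp add: sum.delta)
  qed
  moreover have "degree W < d"
    using f(3) by (intro degree_lessI) (auto simp: coeffW intro!: poly_eqI)
  ultimately have "W = 0" using dom[of W h] h by auto
  then have "c (Inl (a, b)) = 0" if "a < s" "b < d" for a b
    using coeffW[of b a] that by simp
  with cr have "c k = 0" if "k \<in> I" for k using that by (auto simp: I_def)
  with c(1) show False by auto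
qed

section \<open>Spans of monomials\<close>

text \<open>A value has degree at most n here if it has some expression of degree n in
  \<open>V\<close>. A predicate is used instead of a degree function because \<open>V\<close> will
  contain both x and x^q, so expressions are not unique.\<close>

inductive span_deg :: "'r::comm_ring_1 set \<Rightarrow> 'r set \<Rightarrow> nat \<Rightarrow> 'r \<Rightarrow> bool" for C V where
  const: "c \<in> C \<Longrightarrow> span_deg C V n c"
| add: "span_deg C V n a \<Longrightarrow> span_deg C V n b \<Longrightarrow> span_deg C V n (a + b)"
| var: "v \<in> V \<Longrightarrow> span_deg C V n a \<Longrightarrow> span_deg C V (Suc n) (v * a)"

lemma span_deg_mono:
  assumes "span_deg C V m a" "m \<le> n"
  shows "span_deg C V n a"
  using assms
proof (induction arbitrary: n rule: span_deg.induct)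
  case (var v m a)
  then obtain k where "n = Suc k" "m \<le> k" by (cases n) auto
  then show ?case using var by (auto intro: span_deg.var)
qed (auto intro: span_deg.intros)

locale subring =
  fixes C :: "'r::comm_ring_1 set"
  assumes zero: "0 \<in> C" and one: "1 \<in> C" and mult: "a \<in> C \<Longrightarrow> b \<in> C \<Longrightarrow> a * b \<in> C"
    and uminus: "a \<in> C \<Longrightarrow> - a \<in> C"
begin

lemma span_deg_scale: "span_deg C V n a \<Longrightarrow> c \<in> C \<Longrightarrow> span_deg C V n (c * a)"
proof (induction rule: span_deg.induct)
  case (var v n a)
  then have "span_deg C V (Suc n) (v * (c * a))" by (intro span_deg.var) auto
  then show ?case by (simp add: ac_simps)
qed (auto intro: span_deg.intros mult simp: distrib_left)

lemma span_deg_mult: "span_deg C V m a \<Longrightarrow> span_deg C V n b \<Longrightarrow> span_deg C V (m + n) (a * b)"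
proof (induction rule: span_deg.induct)
  case (const c m)
  then show ?case by (auto intro: span_deg_mono span_deg_scale)
next
  case (var v m a)
  then have "span_deg C V (Suc (m + n)) (v * (a * b))" by (intro span_deg.var) auto
  then show ?case by (simp add: ac_simps)
qed (auto intro: span_deg.add simp: distrib_right)

lemma span_deg_uminus: "span_deg C V n a \<Longrightarrow> span_deg C V n (- a)"
  using span_deg_scale[of V n a "- 1"] uminus[OF one] by simp

lemma span_deg_diff: "span_deg C V n a \<Longrightarrow> span_deg C V n b \<Longrightarrow> span_deg C V n (a - b)"
  using span_deg.add[of C V n a "- b"] span_deg_uminus[of V n b] by simp

lemma span_deg_0: "span_deg C V n 0"
  by (intro span_deg.const zero)

lemma span_deg_sum: "(\<And>i. i \<in> A \<Longrightarrow> span_deg C V n (g i)) \<Longrightarrow> span_deg C V n (sum g A)"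
  by (induction A rule: infinite_finite_induct) (auto intro: span_deg_0 span_deg.add)

lemma span_deg_var1: "v \<in> V \<Longrightarrow> span_deg C V 1 v"
  using span_deg.var[OF _ span_deg.const[OF one], of v V 0] by simp

lemma span_deg_power: "v \<in> V \<Longrightarrow> span_deg C V k (v ^ k)"
  by (induction k) (auto intro: span_deg.intros one)

end

section \<open>Stepanov's method on a plane curve\<close>

definition kconst :: "'k::comm_ring_1 \<Rightarrow> 'k poly poly" where "kconst c = [:[:c:]:]"

lemma kconst_hom: "comm_ring_hom (kconst :: 'k::comm_ring_1 \<Rightarrow> _)"
  by unfold_locales (auto simp: one_pCons kconst_def)

lemma kconst_0 [simp]: "kconst 0 = 0" and kconst_1 [simp]: "kconst 1 = 1"
  and kconst_add: "kconst (a + b) = kconst a + kconst b"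
  and kconst_mult: "kconst (a * b) = kconst a * kconst b"
  and kconst_uminus: "kconst (- a) = - kconst a"
  by (simp_all add: kconst_def one_pCons)

lemma kconst_sum: "kconst (sum g A) = (\<Sum>i\<in>A. kconst (g i))"
proof -
  interpret c: comm_ring_hom "kconst :: 'a \<Rightarrow> _" by (rule kconst_hom)
  show ?thesis by (rule c.hom_sum)
qed

text \<open>\<open>frob\<close> expresses that (x, y) -> (x^q, y^q) maps the curve to itself, as it
  does when \<open>f\<close> has coefficients in F_q. With \<open>2 \<le> d\<close> the range
  \<open>s < d - 1\<close> of exponents of y^q in a remainder is not empty.\<close>

locale frobenius_curve =
  fixes f :: "'k::field poly poly" and d q :: nat
  assumes deg_f: "degree f = d" and monic_f: "lead_coeff f = 1" and tdeg_f: "tdeg d f"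
    and d2: "2 \<le> d"
    and frob: "f dvd lift_hom (lift_hom kconst (xy q 0)) (xy 0 q) f"
begin

definition "x = (xy 1 0 :: 'k poly poly)"
definition "y = (xy 0 1 :: 'k poly poly)"
definition "xq = (xy q 0 :: 'k poly poly)"
definition "yq = (xy 0 q :: 'k poly poly)"

lemma x_power: "x ^ i = xy i 0" and y_power: "y ^ j = xy 0 j"
  and xq_power: "xq ^ i = xy (q * i) 0" and yq_power: "yq ^ j = xy 0 (q * j)"
  by (simp_all add: x_def y_def xq_def yq_def xy_def monom_power)

lemma xy_mult: "xy i j * xy k l = (xy (i + k) (j + l) :: 'k poly poly)"
  by (simp add: xy_def mult_monom)

abbreviation sp :: "nat \<Rightarrow> 'k poly poly \<Rightarrow> bool" where
  "sp \<equiv> span_deg (range kconst) {x, y, xq, yq}"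

sublocale C: subring "range (kconst :: 'k \<Rightarrow> _)"
proof
  fix a b :: "'k poly poly"
  show "0 \<in> range (kconst :: 'k \<Rightarrow> _)" by (rule range_eqI[of _ _ 0]) simp
  show "1 \<in> range (kconst :: 'k \<Rightarrow> _)" by (rule range_eqI[of _ _ 1]) simp
  assume a: "a \<in> range (kconst :: 'k \<Rightarrow> _)"
  then show "- a \<in> range (kconst :: 'k \<Rightarrow> _)" by (auto simp flip: kconst_uminus)
  assume "b \<in> range (kconst :: 'k \<Rightarrow> _)"
  with a show "a * b \<in> range (kconst :: 'k \<Rightarrow> _)" by (auto simp flip: kconst_mult)
qed

lemma sp_smult: "sp n a \<Longrightarrow> sp n (kconst c * a)"
  by (rule C.span_deg_scale) auto

lemma sp_mono4: "sp (i + j + r + s) (x ^ i * y ^ j * xq ^ r * yq ^ s)"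
  by (intro C.span_deg_mult C.span_deg_power) auto

abbreviation fx :: "nat \<Rightarrow> nat \<Rightarrow> 'k" where
  "fx j a \<equiv> coeff (coeff f j) a"

lemma fx_zero: "fx j a = 0" if "a + j > d"
proof (cases "j \<le> d")
  case True
  have "degree (coeff f j) \<le> d - j" using deg.wdeg_coeff[OF tdeg_f, of j] by simp
  then show ?thesis using that True by (intro coeff_eq_0) auto
next
  case False
  then show ?thesis using deg.wdeg_coeff_eq_0[OF tdeg_f, of j] by simp
qed

definition fe :: "'k poly poly \<Rightarrow> 'k poly poly \<Rightarrow> 'k poly poly" where
  "fe u w = (\<Sum>j\<le>d. \<Sum>a\<le>d. kconst (fx j a) * u ^ a * w ^ j)"

lemma lift_hom_sum:
  fixes p :: "'r::comm_ring_1 poly" and h :: "'r \<Rightarrow> 's::comm_ring_1"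
  assumes "degree p \<le> n" "h 0 = 0"
  shows "lift_hom h w p = (\<Sum>i\<le>n. h (coeff p i) * w ^ i)"
proof -
  have "degree (map_poly h p) \<le> n" using assms(1) degree_map_poly_le order_trans by blast
  then have "lift_hom h w p = poly (\<Sum>i\<le>n. Polynomial.monom (coeff (map_poly h p) i) i) w"
    by (simp only: lift_hom_def poly_as_sum_of_monoms')
  then show ?thesis by (simp add: poly_sum poly_monom coeff_map_poly assms(2))
qed

lemma fe_conv: "fe u w = lift_hom (lift_hom kconst u) w f"
proof -
  have "degree (coeff f j) \<le> d" for j
    by (rule degree_le) (auto simp: fx_zero)
  then have "lift_hom kconst u (coeff f j) = (\<Sum>a\<le>d. kconst (fx j a) * u ^ a)" for j
    by (intro lift_hom_sum) auto
  moreover have "lift_hom (lift_hom kconst u) w f = (\<Sum>j\<le>d. lift_hom kconst u (coeff f j) * w ^ j)"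
    by (intro lift_hom_sum) (auto simp: deg_f lift_hom_def)
  ultimately show ?thesis by (simp add: fe_def sum_distrib_right)
qed

lemma fe_XZ: "f dvd fe xq yq"
  using frob by (simp add: fe_conv xq_def yq_def)

lemma xy_expand: "kconst c * xy i j = Polynomial.monom (Polynomial.monom c i) j"
  by (simp add: xy_def kconst_def smult_monom)

lemma fe_xy: "fe x y = f"
proof -
  have "fe x y = (\<Sum>j\<le>d. \<Sum>a\<le>d. Polynomial.monom (Polynomial.monom (fx j a) a) j)"
    unfolding fe_def mult.assoc x_power y_power xy_mult by (simp add: xy_expand)
  also have "\<dots> = (\<Sum>j\<le>d. Polynomial.monom (coeff f j) j)"
  proof (rule sum.cong[OF refl])
    fix j
    have "degree (coeff f j) \<le> d" by (rule degree_le) (auto simp: fx_zero)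
    then have "(\<Sum>a\<le>d. Polynomial.monom (fx j a) a) = coeff f j"
      by (rule poly_as_sum_of_monoms')
    then show "(\<Sum>a\<le>d. Polynomial.monom (Polynomial.monom (fx j a) a) j) = Polynomial.monom (coeff f j) j"
      by (metis (no_types, lifting) monom_sum sum.cong)
  qed
  also have "\<dots> = f" by (rule poly_as_sum_of_monoms') (simp add: deg_f)
  finally show ?thesis .
qed

lemma fx_lead: "fx d a = (if a = 0 then 1 else 0)"
  using monic_f deg_f by (simp add: coeff_1)

text \<open>\<open>Gq\<close> and \<open>Xq\<close> are the difference quotients of \<open>f\<close>
  in y between y and y^q, and in x between x and x^q. Together, (y - y^q) Gq + (x - x^q) Xq = f(x,
  y) - f(x^q, y^q), which is 0 modulo \<open>f\<close>. The equation Gq = 0 describes pairs of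
  points over one abscissa with the diagonal divided out.\<close>

definition "Gq = (\<Sum>j\<le>d. \<Sum>a\<le>d. kconst (fx j a) * x ^ a * (\<Sum>b<j. yq ^ (j - Suc b) * y ^ b))"
definition "Xq = (\<Sum>j\<le>d. \<Sum>a\<le>d. kconst (fx j a) * (\<Sum>b<a. xq ^ (a - Suc b) * x ^ b) * yq ^ j)"

lemma Gq_eq: "(y - yq) * Gq = f - fe x yq"
proof -
  have "(y - yq) * Gq = (\<Sum>j\<le>d. \<Sum>a\<le>d. kconst (fx j a) * x ^ a * ((y - yq) * (\<Sum>b<j. yq ^ (j - Suc b) * y ^ b)))"
    unfolding Gq_def sum_distrib_left by (intro sum.cong refl) (simp only: ac_simps)
  also have "\<dots> = fe x y - fe x yq"
    unfolding power_diff_sumr2[symmetric] fe_def by (simp add: algebra_simps sum_subtractf)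
  finally show ?thesis by (simp add: fe_xy)
qed

lemma Xq_eq: "(x - xq) * Xq = fe x yq - fe xq yq"
proof -
  have "(x - xq) * Xq = (\<Sum>j\<le>d. \<Sum>a\<le>d. kconst (fx j a) * ((x - xq) * (\<Sum>b<a. xq ^ (a - Suc b) * x ^ b)) * yq ^ j)"
    unfolding Xq_def sum_distrib_left sum_distrib_right by (intro sum.cong refl) (simp only: ac_simps)
  also have "\<dots> = fe x yq - fe xq yq"
    unfolding power_diff_sumr2[symmetric] fe_def by (simp add: algebra_simps sum_subtractf)
  finally show ?thesis .
qed

lemma sp_Xq: "sp (d - 1) Xq"
  unfolding Xq_def
proof (intro C.span_deg_sum)
  fix j a
  show "sp (d - 1) (kconst (fx j a) * (\<Sum>b<a. xq ^ (a - Suc b) * x ^ b) * yq ^ j)"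
  proof (cases "a + j > d")
    case True
    then show ?thesis using C.span_deg_0 by (simp add: fx_zero)
  next
    case False
    have "sp (d - 1) (kconst (fx j a) * (xq ^ (a - Suc b) * x ^ b * yq ^ j))" if "b < a" for b
    proof -
      have "sp (a - Suc b + b + j) (xq ^ (a - Suc b) * x ^ b * yq ^ j)"
        by (intro C.span_deg_mult C.span_deg_power) auto
      then show ?thesis using False that by (intro sp_smult) (auto elim!: span_deg_mono)
    qed
    then have "sp (d - 1) (\<Sum>b<a. kconst (fx j a) * (xq ^ (a - Suc b) * x ^ b * yq ^ j))"
      by (intro C.span_deg_sum) auto
    then show ?thesis by (simp add: sum_distrib_left sum_distrib_right mult.assoc)
  qed
qed

subsection \<open>Reduction modulo the curve of conjugate pairs\<close>

text \<open>The exponents of x, y and y^q that remain once y is reduced by \<open>f\<close>, y^q by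
  \<open>Gq\<close>, and x^q is replaced by x.\<close>

definition RB :: "nat \<Rightarrow> (nat \<times> nat \<times> nat) set" where
  "RB T = {(i, j, s). j < d \<and> s < d - 1 \<and> i + j + s \<le> T}"

definition bm :: "nat \<times> nat \<times> nat \<Rightarrow> 'k poly poly" where
  "bm = (\<lambda>(i, j, s). x ^ i * y ^ j * yq ^ s)"

lemma RB_subset: "RB T \<subseteq> {..T} \<times> {..<d} \<times> {..<d - 1}"
  by (auto simp: RB_def)

lemma finite_RB [simp]: "finite (RB T)"
  by (rule finite_subset[OF RB_subset]) simp

lemma card_RB: "card (RB T) \<le> (T + 1) * (d * (d - 1))"
  using card_mono[OF _ RB_subset[of T]] by (simp add: card_cartesian_product)

definition Red :: "nat \<Rightarrow> 'k poly poly \<Rightarrow> bool" where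
  "Red T \<rho> \<longleftrightarrow> (\<exists>c. \<rho> = (\<Sum>b\<in>RB T. kconst (c b) * bm b))"

lemma Red_add:
  assumes "Red T a" "Red T b"
  shows "Red T (a + b)"
proof -
  from assms obtain c c' where "a = (\<Sum>b\<in>RB T. kconst (c b) * bm b)" "b = (\<Sum>b\<in>RB T. kconst (c' b) * bm b)"
    by (auto simp: Red_def)
  then have "a + b = (\<Sum>b\<in>RB T. kconst (c b + c' b) * bm b)"
    by (simp add: sum.distrib kconst_add distrib_right)
  then show ?thesis unfolding Red_def by (intro exI[of _ "\<lambda>b. c b + c' b"])
qed

lemma Red_0: "Red T 0"
  unfolding Red_def by (intro exI[of _ "\<lambda>_. 0"]) simp

lemma Red_smult:
  assumes "Red T a"
  shows "Red T (kconst k * a)"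
proof -
  from assms obtain c where "a = (\<Sum>b\<in>RB T. kconst (c b) * bm b)"
    by (auto simp: Red_def)
  then have "kconst k * a = (\<Sum>b\<in>RB T. kconst (k * c b) * bm b)"
    by (simp add: sum_distrib_left kconst_mult mult.assoc)
  then show ?thesis unfolding Red_def by (intro exI[of _ "\<lambda>b. k * c b"])
qed

lemma Red_bm: "b \<in> RB T \<Longrightarrow> Red T (bm b)"
  unfolding Red_def
proof (intro exI[of _ "\<lambda>b'. if b' = b then 1 else 0"])
  assume b: "b \<in> RB T"
  have "(\<Sum>b'\<in>RB T. kconst (if b' = b then 1 else 0) * bm b') = (\<Sum>b'\<in>RB T. if b' = b then bm b' else 0)"
    by (intro sum.cong) auto
  then show "bm b = (\<Sum>b'\<in>RB T. kconst (if b' = b then 1 else 0) * bm b')"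
    using b by simp
qed

lemma Red_sum: "(\<And>i. i \<in> A \<Longrightarrow> Red T (g i)) \<Longrightarrow> Red T (sum g A)"
  by (induction A rule: infinite_finite_induct) (auto intro: Red_0 Red_add)

lemma Red_mono: "Red T a \<Longrightarrow> T \<le> T' \<Longrightarrow> Red T' a"
  unfolding Red_def[of T]
  by (auto intro!: Red_sum Red_smult Red_bm simp: RB_def)

text \<open>On the curve this reads \<Phi> = \<rho> + (x - x^q)/(y - y^q) \<Phi>' with a remainder
  \<rho>. That \<Phi>' obeys the same bound \<open>T\<close> is essential: the division can then be
  repeated without any growth of the remainders.\<close>

definition DD :: "nat \<Rightarrow> 'k poly poly \<Rightarrow> bool" where
  "DD T \<Phi> \<longleftrightarrow> (\<exists>\<rho> \<Phi>'. Red T \<rho> \<and> sp T \<Phi>' \<and> f dvd (y - yq) * (\<Phi> - \<rho>) - (x - xq) * \<Phi>')"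

lemma DD_Red: "Red T \<rho> \<Longrightarrow> DD T \<rho>"
  unfolding DD_def by (intro exI[of _ \<rho>] exI[of _ 0]) (auto intro: C.span_deg_0)

lemma DD_add:
  assumes "DD T a" "DD T b"
  shows "DD T (a + b)"
proof -
  from assms obtain \<rho> \<rho>' a' b' where *: "Red T \<rho>" "sp T a'" "f dvd (y - yq) * (a - \<rho>) - (x - xq) * a'"
    "Red T \<rho>'" "sp T b'" "f dvd (y - yq) * (b - \<rho>') - (x - xq) * b'" by (auto simp: DD_def)
  have "f dvd ((y - yq) * (a - \<rho>) - (x - xq) * a') + ((y - yq) * (b - \<rho>') - (x - xq) * b')"
    using *(3,6) by (rule dvd_add)
  then have "f dvd (y - yq) * ((a + b) - (\<rho> + \<rho>')) - (x - xq) * (a' + b')"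
    by (simp add: algebra_simps)
  then show ?thesis unfolding DD_def
    using * by (intro exI[of _ "\<rho> + \<rho>'"] exI[of _ "a' + b'"] conjI Red_add span_deg.add)
qed

lemma DD_smult:
  assumes "DD T a"
  shows "DD T (kconst k * a)"
proof -
  from assms obtain \<rho> a' where *: "Red T \<rho>" "sp T a'" "f dvd (y - yq) * (a - \<rho>) - (x - xq) * a'"
    by (auto simp: DD_def)
  have "f dvd kconst k * ((y - yq) * (a - \<rho>) - (x - xq) * a')"
    using *(3) by (rule dvd_mult)
  also have "kconst k * ((y - yq) * (a - \<rho>) - (x - xq) * a') =
      (y - yq) * (kconst k * a - kconst k * \<rho>) - (x - xq) * (kconst k * a')"
    by (simp add: algebra_simps)
  finally show ?thesis unfolding DD_def
    using * by (intro exI[of _ "kconst k * \<rho>"] exI[of _ "kconst k * a'"] conjI Red_smult sp_smult)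
qed

lemma DD_0: "DD T 0"
  by (rule DD_Red[OF Red_0])

lemma DD_sum: "(\<And>i. i \<in> A \<Longrightarrow> DD T (g i)) \<Longrightarrow> DD T (sum g A)"
  by (induction A rule: infinite_finite_induct) (auto intro: DD_0 DD_add)

lemma DD_uminus: "DD T a \<Longrightarrow> DD T (- a)"
  using DD_smult[of T a "- 1"] by (simp add: kconst_uminus)

lemma DD_cong:
  assumes "DD T a" "f dvd b - a"
  shows "DD T b"
proof -
  from assms obtain \<rho> a' where *: "Red T \<rho>" "sp T a'" "f dvd (y - yq) * (a - \<rho>) - (x - xq) * a'"
    by (auto simp: DD_def)
  have "f dvd (y - yq) * (b - a) + ((y - yq) * (a - \<rho>) - (x - xq) * a')"
    using *(3) assms(2) by (intro dvd_add dvd_mult)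
  also have "(y - yq) * (b - a) + ((y - yq) * (a - \<rho>) - (x - xq) * a') = (y - yq) * (b - \<rho>) - (x - xq) * a'"
    by (simp add: algebra_simps)
  finally show ?thesis unfolding DD_def using * by auto
qed

lemma DD_mono: "DD T a \<Longrightarrow> T \<le> T' \<Longrightarrow> DD T' a"
  unfolding DD_def by (meson Red_mono span_deg_mono)

text \<open>A factor \<open>v\<close> may be absorbed by the quotient part, which is allowed one
  more degree, so only the reduced monomials have to be multiplied by \<open>v\<close>.\<close>

lemma DD_mult_aux:
  assumes "DD n a" "v \<in> {x, y, xq, yq}" and "\<And>b. b \<in> RB n \<Longrightarrow> DD (Suc n) (v * bm b)"
  shows "DD (Suc n) (v * a)"
proof -
  from assms(1) obtain \<rho> a' where *: "Red n \<rho>" "sp n a'" "f dvd (y - yq) * (a - \<rho>) - (x - xq) * a'"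
    by (auto simp: DD_def)
  from *(1) obtain c where c: "\<rho> = (\<Sum>b\<in>RB n. kconst (c b) * bm b)" by (auto simp: Red_def)
  have "DD (Suc n) (\<Sum>b\<in>RB n. kconst (c b) * (v * bm b))"
    by (intro DD_sum DD_smult assms)
  then have 1: "DD (Suc n) (v * \<rho>)" by (simp add: c sum_distrib_left mult.left_commute)
  have "f dvd v * ((y - yq) * (a - \<rho>) - (x - xq) * a')" using *(3) by (rule dvd_mult)
  also have "v * ((y - yq) * (a - \<rho>) - (x - xq) * a') = (y - yq) * ((v * a - v * \<rho>) - 0) - (x - xq) * (v * a')"
    by (simp add: algebra_simps)
  finally have "DD (Suc n) (v * a - v * \<rho>)"
    unfolding DD_def using span_deg.var[OF assms(2) *(2)] Red_0 by blast
  from DD_add[OF this 1] show ?thesis by simp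
qed

lemma DD_x: "DD n a \<Longrightarrow> DD (Suc n) (x * a)"
proof (rule DD_mult_aux)
  fix b assume "b \<in> RB n"
  then obtain i j s where b: "b = (i, j, s)" "(Suc i, j, s) \<in> RB (Suc n)" by (auto simp: RB_def)
  have "x * bm b = bm (Suc i, j, s)" by (simp add: b bm_def mult.assoc)
  then show "DD (Suc n) (x * bm b)" using Red_bm[OF b(2)] by (simp add: DD_Red)
qed auto

lemma sp_bm: "b \<in> RB n \<Longrightarrow> sp n (bm b)"
proof -
  assume "b \<in> RB n"
  then obtain i j s where b: "b = (i, j, s)" "i + j + s \<le> n" by (auto simp: RB_def)
  have "sp (i + j + 0 + s) (x ^ i * y ^ j * xq ^ 0 * yq ^ s)" by (rule sp_mono4)
  then show ?thesis using b by (auto simp: bm_def elim: span_deg_mono)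
qed

text \<open>x^q b = x b - (x - x^q) b, and the last term is a pure quotient part with \<Phi>' = -(y
  - y^q) b.\<close>

lemma DD_X: "DD n a \<Longrightarrow> DD (Suc n) (xq * a)"
proof (rule DD_mult_aux)
  fix b assume b: "b \<in> RB n"
  have "sp (1 + n) ((y - yq) * bm b)"
    by (intro C.span_deg_mult C.span_deg_diff C.span_deg_var1 sp_bm[OF b]) auto
  then have "sp (Suc n) (- ((y - yq) * bm b))" by (simp add: C.span_deg_uminus)
  moreover have "(y - yq) * (xq * bm b - x * bm b - 0) - (x - xq) * (- ((y - yq) * bm b)) = 0"
    by (simp add: algebra_simps)
  ultimately have "DD (Suc n) (xq * bm b - x * bm b)"
    unfolding DD_def using Red_0 by (metis dvd_0_right)
  from DD_add[OF this DD_x[OF DD_Red[OF Red_bm[OF b]]]] show "DD (Suc n) (xq * bm b)" by simp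
qed auto

text \<open>The power y^d is eliminated by \<open>f\<close> itself, in which it has coefficient 1;
  the result is a remainder without quotient part.\<close>

lemma DD_y: "DD n a \<Longrightarrow> DD (Suc n) (y * a)"
proof (rule DD_mult_aux)
  fix b assume "b \<in> RB n"
  then obtain i j s where b: "b = (i, j, s)" "j < d" "s < d - 1" "i + j + s \<le> n" by (auto simp: RB_def)
  show "DD (Suc n) (y * bm b)"
  proof (cases "Suc j < d")
    case True
    then have *: "(i, Suc j, s) \<in> RB (Suc n)" using b by (auto simp: RB_def)
    have "y * bm b = bm (i, Suc j, s)" by (simp add: b bm_def ac_simps)
    then show ?thesis using Red_bm[OF *] by (simp add: DD_Red)
  next
    case False
    then have j: "d = Suc j" using b by simp
    let ?R = "\<Sum>l<d. \<Sum>a\<le>d. kconst (fx l a) * (x ^ (a + i) * y ^ l * yq ^ s)"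
    have "Red (Suc n) (kconst (fx l a) * (x ^ (a + i) * y ^ l * yq ^ s))" if "l < d" for l a
    proof (cases "a + l > d")
      case True
      then show ?thesis using Red_0 by (simp add: fx_zero)
    next
      case False
      then have "(a + i, l, s) \<in> RB (Suc n)" unfolding RB_def using that b j by auto
      from Red_smult[OF Red_bm[OF this]] show ?thesis by (simp add: bm_def)
    qed
    then have "Red (Suc n) ?R" by (intro Red_sum) auto
    then have "DD (Suc n) (- ?R)" by (intro DD_uminus DD_Red)
    moreover have "f dvd y * bm b - (- ?R)"
    proof -
      have "f = (\<Sum>l<d. \<Sum>a\<le>d. kconst (fx l a) * x ^ a * y ^ l) + (\<Sum>a\<le>d. kconst (fx d a) * x ^ a * y ^ d)"
        by (subst fe_xy[symmetric]) (simp add: fe_def lessThan_Suc_atMost[symmetric] add.commute)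
      also have "(\<Sum>a\<le>d. kconst (fx d a) * x ^ a * y ^ d) = (\<Sum>a\<le>d. if a = 0 then y ^ d else 0)"
        by (intro sum.cong) (auto simp: fx_lead)
      also have "\<dots> = y ^ d" by simp
      finally have "f = (\<Sum>l<d. \<Sum>a\<le>d. kconst (fx l a) * x ^ a * y ^ l) + y ^ d" .
      from arg_cong[OF this, of "\<lambda>t. t * (x ^ i * yq ^ s)"]
      have "f * (x ^ i * yq ^ s) = (\<Sum>l<d. \<Sum>a\<le>d. kconst (fx l a) * x ^ a * y ^ l) * (x ^ i * yq ^ s)
          + y ^ d * (x ^ i * yq ^ s)"
        unfolding distrib_right .
      also have "\<dots> = ?R + y * bm b"
      proof (intro arg_cong2[of _ _ _ _ "(+)"])
        show "(\<Sum>l<d. \<Sum>a\<le>d. kconst (fx l a) * x ^ a * y ^ l) * (x ^ i * yq ^ s) = ?R"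
          unfolding sum_distrib_right power_add by (intro sum.cong refl) (simp only: ac_simps)
        show "y ^ d * (x ^ i * yq ^ s) = y * bm b"
          by (simp add: b j bm_def ac_simps)
      qed
      finally have "y * bm b - (- ?R) = f * (x ^ i * yq ^ s)" by simp
      then show ?thesis by (rule dvdI)
    qed
    ultimately show ?thesis by (rule DD_cong)
  qed
qed auto

lemma DD_xyZ: "s < d - 1 \<Longrightarrow> DD (a + b + s) (x ^ a * y ^ b * yq ^ s)"
proof (induction b)
  case 0
  then have "(a, 0, s) \<in> RB (a + 0 + s)" using d2 by (auto simp: RB_def)
  from Red_bm[OF this] show ?case by (simp add: bm_def DD_Red)
next
  case (Suc b)
  from DD_y[OF Suc.IH[OF Suc.prems]] show ?case by (simp add: ac_simps)
qed

text \<open>Sorted by powers of y^q, the exponent d - 1 arises only from the leading term y^d of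
  \<open>f\<close>; thus \<open>Gq\<close> is monic in y^q and can be used for reduction.\<close>

lemma Gq_split:
  "Gq = yq ^ (d - 1) + (\<Sum>s<d - 1. \<Sum>j\<in>{s<..d}. \<Sum>a\<le>d. kconst (fx j a) * (x ^ a * y ^ (j - Suc s) * yq ^ s))"
proof -
  have "Gq = (\<Sum>j\<le>d. \<Sum>s<j. \<Sum>a\<le>d. kconst (fx j a) * (x ^ a * y ^ (j - Suc s) * yq ^ s))"
  proof -
    have "Gq = (\<Sum>j\<le>d. \<Sum>b<j. \<Sum>a\<le>d. kconst (fx j a) * (x ^ a * y ^ b * yq ^ (j - Suc b)))"
      unfolding Gq_def sum_distrib_left by (subst sum.swap[of _ "{..d}" "{..<_}"]) (simp add: ac_simps)
    also have "\<dots> = (\<Sum>j\<le>d. \<Sum>s<j. \<Sum>a\<le>d. kconst (fx j a) * (x ^ a * y ^ (j - Suc s) * yq ^ s))"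
    proof (rule sum.cong[OF refl])
      fix j
      let ?F = "\<lambda>b. \<Sum>a\<le>d. kconst (fx j a) * (x ^ a * y ^ b * yq ^ (j - Suc b))"
      have "sum ?F {..<j} = (\<Sum>s<j. ?F (j - Suc s))" by (rule sum.nat_diff_reindex[symmetric])
      also have "\<dots> = (\<Sum>s<j. \<Sum>a\<le>d. kconst (fx j a) * (x ^ a * y ^ (j - Suc s) * yq ^ s))"
        by (intro sum.cong refl) simp
      finally show "sum ?F {..<j} = (\<Sum>s<j. \<Sum>a\<le>d. kconst (fx j a) * (x ^ a * y ^ (j - Suc s) * yq ^ s))" .
    qed
    finally show ?thesis .
  qed
  also have "\<dots> = (\<Sum>s<d. \<Sum>j\<in>{s<..d}. \<Sum>a\<le>d. kconst (fx j a) * (x ^ a * y ^ (j - Suc s) * yq ^ s))"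
    unfolding sum.Sigma[OF finite_atMost, simplified]
    by (subst (1 2) sum.Sigma, simp_all)
       (intro sum.reindex_bij_witness[of _ "\<lambda>(s, j). (j, s)" "\<lambda>(j, s). (s, j)"]; auto)
  also have "\<dots> = (\<Sum>s<d - 1. \<Sum>j\<in>{s<..d}. \<Sum>a\<le>d. kconst (fx j a) * (x ^ a * y ^ (j - Suc s) * yq ^ s))
      + (\<Sum>a\<le>d. kconst (fx d a) * (x ^ a * yq ^ (d - 1)))"
  proof -
    obtain e where e: "d = Suc e" using d2 by (cases d) auto
    have "{e<..Suc e} = {Suc e}" by auto
    then show ?thesis by (simp add: e)
  qed
  also have "(\<Sum>a\<le>d. kconst (fx d a) * (x ^ a * yq ^ (d - 1))) = (\<Sum>a\<le>d. if a = 0 then yq ^ (d - 1) else 0)"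
    by (intro sum.cong) (auto simp: fx_lead)
  also have "\<dots> = yq ^ (d - 1)" by simp
  finally show ?thesis by simp
qed

text \<open>The power d - 1 of y^q is eliminated by \<open>Gq\<close>. Modulo \<open>f\<close> the
  multiple Gq x^i y^j is a pure quotient part with \<Phi>' = -Xq x^i y^j, and \<open>Xq\<close> has
  degree d - 1, so the degree bound is kept. The lower terms of \<open>Gq\<close> may have large
  powers of y, which \<open>DD_xyZ\<close> has already reduced.\<close>

lemma DD_Z: "DD n a \<Longrightarrow> DD (Suc n) (yq * a)"
proof (rule DD_mult_aux)
  fix b assume "b \<in> RB n"
  then obtain i j s where b: "b = (i, j, s)" "j < d" "s < d - 1" "i + j + s \<le> n" by (auto simp: RB_def)
  show "DD (Suc n) (yq * bm b)"
  proof (cases "Suc s < d - 1")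
    case True
    then have *: "(i, j, Suc s) \<in> RB (Suc n)" using b by (auto simp: RB_def)
    have "yq * bm b = bm (i, j, Suc s)" by (simp add: b bm_def ac_simps)
    then show ?thesis using Red_bm[OF *] by (simp add: DD_Red)
  next
    case False
    then have s: "d - 1 = Suc s" using b by simp
    let ?m = "x ^ i * y ^ j"
    let ?H = "\<Sum>s<d - 1. \<Sum>l\<in>{s<..d}. \<Sum>a\<le>d. kconst (fx l a) * (x ^ (a + i) * y ^ (l - Suc s + j) * yq ^ s)"
    have "DD (Suc n) (kconst (fx l a) * (x ^ (a + i) * y ^ (l - Suc t + j) * yq ^ t))"
      if "t < d - 1" "l \<in> {t<..d}" for t l a
    proof (cases "a + l > d")
      case True
      then show ?thesis using DD_0 by (simp add: fx_zero)
    next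
      case False
      have "DD (a + i + (l - Suc t + j) + t) (x ^ (a + i) * y ^ (l - Suc t + j) * yq ^ t)"
        using that by (intro DD_xyZ) auto
      then show ?thesis
        using False that b s by (intro DD_smult) (auto elim!: DD_mono)
    qed
    then have H: "DD (Suc n) (- ?H)" by (intro DD_uminus DD_sum) auto
    have "sp (d - 1 + (i + j)) (Xq * ?m)"
      by (intro C.span_deg_mult C.span_deg_power sp_Xq) auto
    then have "sp (Suc n) (Xq * ?m)" using b s by (auto elim!: span_deg_mono)
    then have spX: "sp (Suc n) (- (Xq * ?m))" by (rule C.span_deg_uminus)
    have "f dvd f * ?m - fe xq yq * ?m" using fe_XZ by simp
    also have "f * ?m - fe xq yq * ?m = (y - yq) * (Gq * ?m - 0) - (x - xq) * (- (Xq * ?m))"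
    proof -
      have "(y - yq) * (Gq * ?m - 0) - (x - xq) * (- (Xq * ?m)) = ((y - yq) * Gq) * ?m + ((x - xq) * Xq) * ?m"
        by (simp add: algebra_simps)
      then show ?thesis unfolding Gq_eq Xq_eq by (simp add: algebra_simps)
    qed
    finally have "DD (Suc n) (Gq * ?m)" unfolding DD_def using Red_0 spX by blast
    moreover have "yq * bm b = Gq * ?m + (- ?H)"
    proof -
      have "Gq * ?m = yq ^ (d - 1) * ?m + ?H"
        unfolding Gq_split distrib_right sum_distrib_right power_add
        by (intro arg_cong2[of _ _ _ _ "(+)"] sum.cong refl) (simp_all only: ac_simps)
      moreover have "yq * bm b = yq ^ (d - 1) * ?m"
        unfolding b(1) bm_def s by (simp add: ac_simps)
      ultimately show ?thesis by (simp only: add_diff_cancel_right' diff_conv_add_uminus[symmetric])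
    qed
    ultimately show ?thesis using DD_add[OF _ H] by simp
  qed
qed auto

lemma DD_sp: "sp n a \<Longrightarrow> DD n a"
proof (induction rule: span_deg.induct)
  case (const c n)
  then obtain k where k: "c = kconst k" by auto
  have "DD n (x ^ 0 * y ^ 0 * yq ^ 0)"
    by (rule DD_mono[OF DD_xyZ]) (use d2 in auto)
  from DD_smult[OF this, of k] show ?case by (simp add: k)
next
  case (var v n a)
  then show ?case using DD_x DD_y DD_X DD_Z by auto
qed (rule DD_add)

text \<open>The division is applied m times to each \<Phi> separately, with a fixed choice of
  remainder and quotient. Demanding that the combined remainder vanish in each of the m rounds gives
  linear equations in the coefficients \<open>c\<close>, one per round and reduced monomial, hence
  fewer equations than unknowns.\<close>

lemma stepanov_vanishing:
  assumes "finite I" "\<And>\<kappa>. \<kappa> \<in> I \<Longrightarrow> sp T (\<Phi> \<kappa>)" "m * ((T + 1) * (d * (d - 1))) < card I"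
  shows "\<exists>c \<Theta>. (\<exists>\<kappa>\<in>I. c \<kappa> \<noteq> 0) \<and> f dvd (y - yq) ^ m * (\<Sum>\<kappa>\<in>I. kconst (c \<kappa>) * \<Phi> \<kappa>) - (x - xq) ^ m * \<Theta>"
proof -
  let ?P = "\<lambda>\<Psi> c \<Phi>'. sp T \<Psi> \<longrightarrow>
      sp T \<Phi>' \<and> f dvd (y - yq) * (\<Psi> - (\<Sum>b\<in>RB T. kconst (c b) * bm b)) - (x - xq) * \<Phi>'"
  have "\<forall>\<Psi>. \<exists>z. ?P \<Psi> (fst z) (snd z)"
    using DD_sp[of T] unfolding DD_def Red_def by fastforce
  from choice[OF this] obtain z where z: "\<And>\<Psi>. ?P \<Psi> (fst (z \<Psi>)) (snd (z \<Psi>))" by blast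
  define \<rho> where "\<rho> = (\<lambda>\<Psi>. fst (z \<Psi>))"
  define \<D> where "\<D> = (\<lambda>\<Psi>. snd (z \<Psi>))"
  have step: "sp T (\<D> \<Psi>)"
      "f dvd (y - yq) * (\<Psi> - (\<Sum>b\<in>RB T. kconst (\<rho> \<Psi> b) * bm b)) - (x - xq) * \<D> \<Psi>"
    if "sp T \<Psi>" for \<Psi>
    using z[of \<Psi>] that by (simp_all add: \<rho>_def \<D>_def)
  have it: "sp T ((\<D> ^^ l) (\<Phi> \<kappa>))" if "\<kappa> \<in> I" for l \<kappa>
    using assms(2)[OF that] by (induction l) (auto intro: step)
  define E where "E = {..<m} \<times> RB T"
  have "card E \<le> m * ((T + 1) * (d * (d - 1)))"
    unfolding E_def card_cartesian_product card_lessThan by (intro mult_left_mono card_RB) auto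
  then have "card E < card I" using assms(3) by simp
  then obtain c where c: "\<exists>\<kappa>\<in>I. c \<kappa> \<noteq> 0"
      "\<forall>e\<in>E. (\<Sum>\<kappa>\<in>I. \<rho> ((\<D> ^^ fst e) (\<Phi> \<kappa>)) (snd e) * c \<kappa>) = 0"
    using linear_system_nontrivial[of E I "\<lambda>e \<kappa>. \<rho> ((\<D> ^^ fst e) (\<Phi> \<kappa>)) (snd e)"] assms(1)
    by (auto simp: E_def)
  define \<Psi> where "\<Psi> = (\<lambda>l. \<Sum>\<kappa>\<in>I. kconst (c \<kappa>) * (\<D> ^^ l) (\<Phi> \<kappa>))"
  have next_step: "f dvd (y - yq) * \<Psi> l - (x - xq) * \<Psi> (Suc l)" if "l < m" for l
  proof -
    let ?B = "\<lambda>\<kappa>. \<Sum>b\<in>RB T. kconst (\<rho> ((\<D> ^^ l) (\<Phi> \<kappa>)) b) * bm b"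
    have "f dvd (\<Sum>\<kappa>\<in>I. kconst (c \<kappa>) * ((y - yq) * ((\<D> ^^ l) (\<Phi> \<kappa>) - ?B \<kappa>) - (x - xq) * \<D> ((\<D> ^^ l) (\<Phi> \<kappa>))))"
      by (intro dvd_sum dvd_mult step it)
    also have "\<dots> = (y - yq) * \<Psi> l - (x - xq) * \<Psi> (Suc l) - (y - yq) * (\<Sum>\<kappa>\<in>I. kconst (c \<kappa>) * ?B \<kappa>)"
    proof -
      have "kconst (c \<kappa>) * ((y - yq) * ((\<D> ^^ l) (\<Phi> \<kappa>) - ?B \<kappa>) - (x - xq) * \<D> ((\<D> ^^ l) (\<Phi> \<kappa>))) =
        (y - yq) * (kconst (c \<kappa>) * (\<D> ^^ l) (\<Phi> \<kappa>)) - (x - xq) * (kconst (c \<kappa>) * (\<D> ^^ Suc l) (\<Phi> \<kappa>))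
          - (y - yq) * (kconst (c \<kappa>) * ?B \<kappa>)" for \<kappa>
        unfolding funpow.simps o_apply by (simp add: algebra_simps)
      then show ?thesis unfolding \<Psi>_def sum_distrib_left[of "y - yq"] sum_distrib_left[of "x - xq"]
        by (simp only: sum_subtractf)
    qed
    also have "(\<Sum>\<kappa>\<in>I. kconst (c \<kappa>) * ?B \<kappa>) = 0"
    proof -
      have "(\<Sum>\<kappa>\<in>I. kconst (c \<kappa>) * ?B \<kappa>) =
          (\<Sum>b\<in>RB T. (\<Sum>\<kappa>\<in>I. kconst (c \<kappa>) * kconst (\<rho> ((\<D> ^^ l) (\<Phi> \<kappa>)) b)) * bm b)"
        unfolding sum_distrib_left sum_distrib_right by (subst sum.swap) (simp only: mult.assoc)
      also have "\<dots> = (\<Sum>b\<in>RB T. kconst (\<Sum>\<kappa>\<in>I. \<rho> ((\<D> ^^ l) (\<Phi> \<kappa>)) b * c \<kappa>) * bm b)"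
        by (intro sum.cong refl arg_cong2[of _ _ _ _ times])
           (simp add: kconst_sum kconst_mult mult.commute)
      also have "\<dots> = 0"
        using c(2) that by (intro sum.neutral) (auto simp: E_def)
      finally show ?thesis .
    qed
    finally show ?thesis by simp
  qed
  have "f dvd (y - yq) ^ l * \<Psi> 0 - (x - xq) ^ l * \<Psi> l" if "l \<le> m" for l
    using that
  proof (induction l)
    case (Suc l)
    have "f dvd (y - yq) * ((y - yq) ^ l * \<Psi> 0 - (x - xq) ^ l * \<Psi> l)
        + (x - xq) ^ l * ((y - yq) * \<Psi> l - (x - xq) * \<Psi> (Suc l))"
      using Suc next_step[of l] by (intro dvd_add dvd_mult) auto
    also have "\<dots> = (y - yq) ^ Suc l * \<Psi> 0 - (x - xq) ^ Suc l * \<Psi> (Suc l)"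
      unfolding power_Suc by (simp add: algebra_simps)
    finally show ?case .
  qed simp
  from this[of m] c(1) show ?thesis
    by (intro exI[of _ c] exI[of _ "\<Psi> m"]) (simp add: \<Psi>_def)
qed

end

section \<open>Root multiplicities and q-th powers of power series\<close>

global_interpretation triv: ring_filtration "\<lambda>_. UNIV :: 'r::comm_ring_1 set"
  by unfold_locales auto

lemma monic_division:
  fixes f p :: "'r::comm_ring_1 poly"
  assumes "degree f = d" "lead_coeff f = 1" "0 < d"
  shows "\<exists>q r. p = f * q + r \<and> degree r < d"
proof -
  have "triv.wdeg d f" "triv.wdeg (degree p) p"
    using assms(1) by (auto simp: triv.wdeg_def le_degree)
  from triv.wdeg_reduce[OF assms this] show ?thesis by blast
qed

lemma sum_multiplicity_le_degree:
  fixes p :: "'k::field poly"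
  assumes "p \<noteq> 0" "finite B" "\<And>b. b \<in> B \<Longrightarrow> [:- b, 1:] ^ m dvd p" "0 < m"
  shows "m * card B \<le> degree p"
proof -
  have root: "poly p b = 0" if "b \<in> B" for b
    using dvd_trans[OF dvd_power[of m "[:- b, 1:]"] assms(3)[OF that]] assms(4)
    by (simp add: poly_eq_0_iff_dvd)
  have "m * card B = (\<Sum>b\<in>B. m)" by simp
  also have "\<dots> \<le> (\<Sum>b\<in>B. order b p)"
    by (intro sum_mono) (use assms(1,3) in \<open>simp add: order_divides\<close>)
  also have "\<dots> \<le> (\<Sum>b | poly p b = 0. order b p)"
    by (intro sum_mono2) (use root assms(1) poly_roots_finite in auto)
  also have "\<dots> \<le> degree p" by (rule sum_order_le_degree[OF assms(1)])
  finally show ?thesis .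
qed

text \<open>The freshman's dream applies to finite sums, so the series is truncated after order n;
  the tail is a multiple of x^(n + 1) and its q-th power contributes nothing to coefficient
  n.\<close>

lemma fps_power_char:
  fixes \<beta> :: "'k::comm_ring_1 fps"
  assumes "prime CHAR('k)" "q = CHAR('k) ^ e"
  shows "fps_nth (\<beta> ^ q) n = (if q dvd n then fps_nth \<beta> (n div q) ^ q else 0)"
proof -
  have q: "0 < q" using assms by (simp add: prime_gt_0_nat)
  define \<gamma> where "\<gamma> = (\<Sum>i\<le>n. fps_const (fps_nth \<beta> i) * fps_X ^ i)"
  have "fps_nth \<gamma> i = fps_nth \<beta> i" if "i \<le> n" for i
  proof -
    have "fps_nth \<gamma> i = (\<Sum>j\<le>n. if j = i then fps_nth \<beta> j else 0)"
      unfolding \<gamma>_def fps_sum_nth by (intro sum.cong) (auto simp: fps_X_power_nth)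
    then show ?thesis using that by simp
  qed
  then have low: "fps_nth (\<beta> - \<gamma>) i = 0" if "i < Suc n" for i using that by simp
  define \<delta> where "\<delta> = fps_shift (Suc n) (\<beta> - \<gamma>)"
  have "\<beta> - \<gamma> = \<delta> * fps_X ^ Suc n"
    by (rule fps_ext) (use low in \<open>simp add: \<delta>_def fps_X_power_mult_right_nth del: power_Suc\<close>)
  then have "\<beta> = \<gamma> + \<delta> * fps_X ^ Suc n" by (simp add: algebra_simps)
  then have "\<beta> ^ q = \<gamma> ^ q + (\<delta> * fps_X ^ Suc n) ^ q"
    using freshmans_dream'[of q e \<gamma> "\<delta> * fps_X ^ Suc n"] assms by simp
  moreover have "fps_nth ((\<delta> * fps_X ^ Suc n) ^ q) n = 0"
  proof -
    have "Suc n * 1 \<le> Suc n * q" using q by (intro mult_le_mono2) simp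
    then have lt: "n < Suc n * q" by (simp only: mult_1_right Suc_le_eq)
    have "(\<delta> * fps_X ^ Suc n) ^ q = \<delta> ^ q * fps_X ^ (Suc n * q)"
      by (simp only: power_mult_distrib power_mult)
    then show ?thesis by (simp only: fps_X_power_mult_right_nth lt if_True)
  qed
  moreover have "fps_nth (\<gamma> ^ q) n = (if q dvd n then fps_nth \<beta> (n div q) ^ q else 0)"
  proof -
    have "\<gamma> ^ q = (\<Sum>i\<le>n. (fps_const (fps_nth \<beta> i) * fps_X ^ i) ^ q)"
      unfolding \<gamma>_def using assms by (intro freshmans_dream_sum'[of q e]) simp_all
    then have "fps_nth (\<gamma> ^ q) n = (\<Sum>i\<le>n. if i * q = n then fps_nth \<beta> i ^ q else 0)"
      by (simp add: fps_sum_nth power_mult_distrib fps_X_power_nth fps_const_power if_distrib eq_commute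
          flip: power_mult cong: if_cong)
    also have "\<dots> = (\<Sum>i\<le>n. if i = n div q then (if q dvd n then fps_nth \<beta> i ^ q else 0) else 0)"
      by (intro sum.cong refl) (use q in auto)
    also have "\<dots> = (if q dvd n then fps_nth \<beta> (n div q) ^ q else 0)" by simp
    finally show ?thesis .
  qed
  ultimately show ?thesis by simp
qed

text \<open>Multiplying by a series in x^q does not mix residues of exponents modulo q, so the
  product can be studied in blocks of length q.\<close>

lemma fps_nth_mult_sparse:
  fixes a b :: "'k::comm_ring_1 fps"
  assumes "0 < q" "k < q" and sparse: "\<And>i. \<not> q dvd i \<Longrightarrow> fps_nth b i = 0"
  shows "fps_nth (b * a) (q * n + k) = (\<Sum>l\<le>n. fps_nth b (q * l) * fps_nth a (q * (n - l) + k))"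
proof -
  have "fps_nth (b * a) (q * n + k) = (\<Sum>i=0..q * n + k. fps_nth b i * fps_nth a (q * n + k - i))"
    by (rule fps_mult_nth)
  also have "\<dots> = (\<Sum>i\<in>(\<lambda>l. q * l) ` {..n}. fps_nth b i * fps_nth a (q * n + k - i))"
  proof (rule sum.mono_neutral_right)
    show "(\<lambda>l. q * l) ` {..n} \<subseteq> {0..q * n + k}" by (auto intro!: trans_le_add1 mult_le_mono2)
    show "\<forall>i\<in>{0..q * n + k} - (\<lambda>l. q * l) ` {..n}. fps_nth b i * fps_nth a (q * n + k - i) = 0"
    proof
      fix i assume i: "i \<in> {0..q * n + k} - (\<lambda>l. q * l) ` {..n}"
      have "\<not> q dvd i"
      proof
        assume "q dvd i"
        then obtain l where l: "i = q * l" by auto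
        then have "q * l < q * Suc n" using i assms(2) by simp
        then have "l < Suc n" unfolding mult_less_cancel1 by blast
        then have "l \<le> n" by simp
        then show False using i l by auto
      qed
      then show "fps_nth b i * fps_nth a (q * n + k - i) = 0" by (simp add: sparse)
    qed
  qed simp
  also have "\<dots> = (\<Sum>l\<le>n. fps_nth b (q * l) * fps_nth a (q * n + k - q * l))"
    using assms(1) by (subst sum.reindex) (auto simp: inj_on_def)
  also have "\<dots> = (\<Sum>l\<le>n. fps_nth b (q * l) * fps_nth a (q * (n - l) + k))"
  proof (rule sum.cong[OF refl])
    fix l assume "l \<in> {..n}"
    then have "q * n = q * (n - l) + q * l" by (simp flip: distrib_left)
    then show "fps_nth b (q * l) * fps_nth a (q * n + k - q * l) = fps_nth b (q * l) * fps_nth a (q * (n - l) + k)"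
      by simp
  qed
  finally show ?thesis .
qed

lemma curve_eval_dvd:
  assumes "f dvd p" "curve_eval Y f = 0"
  shows "curve_eval Y p = 0"
proof -
  interpret ev: comm_ring_hom "curve_eval Y" by (rule curve_eval_hom)
  obtain u where "p = f * u" using assms(1) by (rule dvdE)
  then show ?thesis using assms(2) by (simp only: ev.hom_mult mult_zero_left)
qed

section \<open>Invertibility of y - y^q over abscissae without rational points\<close>

context frobenius_curve
begin

lemma tdeg_reduce: "tdeg n p \<Longrightarrow> \<exists>u r. p = f * u + r \<and> degree r < d \<and> tdeg n r"
  using deg.wdeg_reduce[OF deg_f monic_f _ tdeg_f] d2 by auto

lemma f_division: "\<exists>u r. p = f * u + r \<and> degree r < d"
  using monic_division[OF deg_f monic_f] d2 by auto

lemma f_dvd_imp_0: "f dvd r \<Longrightarrow> degree r < d \<Longrightarrow> r = 0"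
  using monic_dvd_degree_less[OF monic_f, of r] deg_f by simp

lemma x_minus: "x - kconst c = [:[:- c, 1:]:]"
  by (simp add: x_def xy_def kconst_def monom_0 monom_Suc)

lemma y_minus: "y - kconst c = [:- [:c:], 1:]"
  by (simp add: y_def xy_def kconst_def monom_0 monom_Suc)

text \<open>Since \<open>f\<close> is monic in y, multiplying a remainder by a polynomial in x
  leaves it a remainder. Hence x - c is not a zero divisor modulo \<open>f\<close>.\<close>

lemma f_dvd_cancel_x:
  assumes "f dvd (x - kconst c) * U"
  shows "f dvd U"
proof -
  obtain u r where r: "U = f * u + r" "degree r < d" using f_division by blast
  have "f dvd (x - kconst c) * U - f * ((x - kconst c) * u)" using assms by (intro dvd_diff) auto
  then have "f dvd (x - kconst c) * r" by (simp add: r algebra_simps)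
  then have "f dvd Polynomial.smult [:- c, 1:] r" by (simp add: x_minus)
  then have "Polynomial.smult [:- c, 1:] r = 0"
    by (rule f_dvd_imp_0) (use r(2) in simp)
  then have "r = 0" by simp
  then show ?thesis using r by simp
qed

text \<open>Over x0 the factor y - c is invertible modulo \<open>f\<close>: f = (y - c) s + f(x, c)
  and f(x, c) = u + (x - x0) r, where the constant u = f(x0, c) is nonzero.\<close>

lemma vanish_step:
  assumes "poly (poly f [:c:]) x0 \<noteq> 0" "f dvd (y - kconst c) * W - (x - kconst x0) * V"
  shows "\<exists>W1. f dvd W - (x - kconst x0) * W1"
proof -
  let ?u = "poly (poly f [:c:]) x0"
  have "poly (f - [:poly f [:c:]:]) [:c:] = 0" by simp
  then have "[:- [:c:], 1:] dvd f - [:poly f [:c:]:]" by (simp only: poly_eq_0_iff_dvd)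
  then obtain s where s: "f - [:poly f [:c:]:] = (y - kconst c) * s" unfolding y_minus by (auto simp: dvd_def)
  have "poly (poly f [:c:] - [:?u:]) x0 = 0" by simp
  then have "[:- x0, 1:] dvd poly f [:c:] - [:?u:]" by (simp only: poly_eq_0_iff_dvd)
  then obtain r where r0: "poly f [:c:] - [:?u:] = [:- x0, 1:] * r" by (auto simp: dvd_def)
  have "[:poly f [:c:]:] - kconst ?u = [:poly f [:c:] - [:?u:]:]" by (simp add: kconst_def)
  also have "\<dots> = (x - kconst x0) * [:r:]" unfolding r0 x_minus by simp
  finally have r: "[:poly f [:c:]:] = kconst ?u + (x - kconst x0) * [:r:]"
    by (simp only: diff_eq_eq add.commute)
  obtain w where w: "(y - kconst c) * W - (x - kconst x0) * V = f * w" using assms(2) by (auto simp: dvd_def)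
  have "kconst ?u * W = f * W - s * ((y - kconst c) * W) - (x - kconst x0) * [:r:] * W"
  proof -
    have "f = (y - kconst c) * s + (kconst ?u + (x - kconst x0) * [:r:])"
      using s r by (simp add: algebra_simps)
    from arg_cong[OF this, of "\<lambda>t. t * W"] show ?thesis by (simp add: algebra_simps)
  qed
  also have "(y - kconst c) * W = f * w + (x - kconst x0) * V" using w by (simp add: algebra_simps)
  finally have eq: "kconst ?u * W = f * (W - s * w) - (x - kconst x0) * (s * V + [:r:] * W)"
    by (simp add: algebra_simps)
  define P Q k where "P = W - s * w" and "Q = s * V + [:r:] * W" and "k = kconst (inverse ?u)"
  have "W = k * (kconst ?u * W)"
    using assms(1) by (simp add: k_def flip: mult.assoc kconst_mult)
  also have "\<dots> = k * (f * P - (x - kconst x0) * Q)" by (simp only: eq P_def Q_def)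
  finally have "W - (x - kconst x0) * (- (k * Q)) = k * (f * P - (x - kconst x0) * Q) - (x - kconst x0) * (- (k * Q))"
    by (rule arg_cong2[of _ _ _ _ minus]) (rule refl)
  also have "\<dots> = f * (k * P)" by (simp add: algebra_simps)
  finally show ?thesis by (metis dvd_triv_left)
qed

lemma vanish_prod:
  assumes "finite A" "\<And>c. c \<in> A \<Longrightarrow> poly (poly f [:c:]) x0 \<noteq> 0"
    and "f dvd (\<Prod>c\<in>A. y - kconst c) * W - (x - kconst x0) * V"
  shows "\<exists>W1. f dvd W - (x - kconst x0) * W1"
  using assms
proof (induction A arbitrary: V rule: finite_induct)
  case empty
  then show ?case by auto
next
  case (insert c A)
  have "f dvd (y - kconst c) * ((\<Prod>c\<in>A. y - kconst c) * W) - (x - kconst x0) * V"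
    using insert.prems(2) insert.hyps by (simp add: mult.assoc)
  moreover have "poly (poly f [:c:]) x0 \<noteq> 0" by (rule insert.prems(1)) simp
  ultimately obtain V1 where V1: "f dvd (\<Prod>c\<in>A. y - kconst c) * W - (x - kconst x0) * V1"
    using vanish_step by blast
  show ?case
  proof (rule insert.IH[OF _ V1])
    fix c' assume "c' \<in> A"
    then show "poly (poly f [:c':]) x0 \<noteq> 0" by (intro insert.prems(1)) simp
  qed
qed

end

text \<open>\<open>S\<close> is the copy of F_q in the field \<open>'k\<close>, described by the
  factorisation of t^q - t.\<close>

locale stepanov_curve = frobenius_curve f d q for f :: "'k::field poly poly" and d q +
  fixes S :: "'k set"
  assumes S_fin: "finite S" and S_prod: "(\<Prod>c\<in>S. [:- c, 1:]) = Polynomial.monom 1 q - [:0, 1:]"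
begin

lemma yq_prod: "(\<Prod>c\<in>S. y - kconst c) = yq - y"
proof -
  interpret h: comm_ring_hom "lift_hom kconst y" by (intro lift_hom_hom kconst_hom)
  have lin: "lift_hom kconst y [:- c, 1:] = y - kconst c" for c
  proof -
    have "[:- c, 1:] = [:0, 1:] - [:c:]" by simp
    then show ?thesis by (simp only: h.hom_minus) simp
  qed
  have "(\<Prod>c\<in>S. y - kconst c) = lift_hom kconst y (\<Prod>c\<in>S. [:- c, 1:])"
    unfolding h.hom_prod lin ..
  also have "\<dots> = lift_hom kconst y ([:0, 1:] ^ q - [:0, 1:])"
    unfolding S_prod by (simp add: Polynomial.monom_altdef)
  also have "\<dots> = yq - y"
    unfolding h.hom_minus h.hom_power by (simp add: y_power yq_def)
  finally show ?thesis .
qed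

lemma xq_dvd: "x0 \<in> S \<Longrightarrow> x - kconst x0 dvd xq - x"
proof -
  assume "x0 \<in> S"
  then have "[:- x0, 1:] dvd (\<Prod>c\<in>S. [:- c, 1:])" using S_fin by (rule dvd_prodI[rotated])
  then obtain r where "Polynomial.monom 1 q - [:0, 1:] = [:- x0, 1:] * r" unfolding S_prod by (auto simp: dvd_def)
  then have "[:Polynomial.monom 1 q - [:0, 1:]:] = (x - kconst x0) * [:r:]" by (simp add: x_minus)
  moreover have "xq - x = [:Polynomial.monom 1 q - [:0, 1:]:]"
    by (simp add: xq_def x_def xy_def monom_0 monom_Suc)
  ultimately have "xq - x = (x - kconst x0) * [:r:]" by (simp only:)
  then show ?thesis by (rule dvdI)
qed

lemma vanish_power:
  assumes "\<And>c. c \<in> S \<Longrightarrow> poly (poly f [:c:]) x0 \<noteq> 0"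
    and "f dvd (yq - y) ^ m * W - (x - kconst x0) * V"
  shows "\<exists>W1. f dvd W - (x - kconst x0) * W1"
  using assms(2)
proof (induction m arbitrary: V)
  case 0
  then show ?case by auto
next
  case (Suc m)
  have "f dvd (\<Prod>c\<in>S. y - kconst c) * ((yq - y) ^ m * W) - (x - kconst x0) * V"
    using Suc.prems by (simp add: yq_prod mult.assoc)
  from vanish_prod[OF S_fin assms(1) this] Suc.IH show ?case by blast
qed

text \<open>One factor x - x0 at a time: \<open>vanish_power\<close> extracts it from
  \<open>W\<close>, and \<open>f_dvd_cancel_x\<close> removes it from the whole relation.\<close>

lemma vanish_order:
  assumes "\<And>c. c \<in> S \<Longrightarrow> poly (poly f [:c:]) x0 \<noteq> 0"
    and "f dvd (yq - y) ^ m * W - (x - kconst x0) ^ k * V"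
  shows "\<exists>W1. f dvd W - (x - kconst x0) ^ k * W1"
  using assms(2)
proof (induction k arbitrary: W)
  case 0
  show ?case by (intro exI[of _ W]) simp
next
  case (Suc k)
  let ?t = "x - kconst x0"
  have "f dvd (yq - y) ^ m * W - ?t * (?t ^ k * V)" using Suc.prems by (simp add: mult.assoc)
  from vanish_power[OF assms(1) this] obtain W1 where W1: "f dvd W - ?t * W1" by blast
  have "f dvd ((yq - y) ^ m * W - ?t ^ Suc k * V) - (yq - y) ^ m * (W - ?t * W1)"
    by (rule dvd_diff[OF Suc.prems dvd_mult[OF W1]])
  also have "\<dots> = ?t * ((yq - y) ^ m * W1 - ?t ^ k * V)" by (simp add: algebra_simps)
  finally have "f dvd (yq - y) ^ m * W1 - ?t ^ k * V" by (rule f_dvd_cancel_x)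
  from Suc.IH[OF this] obtain W2 where W2: "f dvd W1 - ?t ^ k * W2" by blast
  have "f dvd (W - ?t * W1) + ?t * (W1 - ?t ^ k * W2)"
    by (rule dvd_add[OF W1 dvd_mult[OF W2]])
  also have "\<dots> = W - ?t ^ Suc k * W2" by (simp add: algebra_simps)
  finally show ?case by blast
qed

text \<open>The remainder of \<Psi> modulo \<open>f\<close> has coefficients in x of degree at most
  \<open>N\<close>, and each of them is divisible by (x - x0)^m for every x0 in \<open>B\<close>.
  Since x^q - x is divisible by x - x0, the power of x - x^q supplies these factors.\<close>

lemma stepanov_divides:
  assumes B: "B \<subseteq> S" "\<And>x0 c. x0 \<in> B \<Longrightarrow> c \<in> S \<Longrightarrow> poly (poly f [:c:]) x0 \<noteq> 0"
    and \<Psi>: "tdeg N \<Psi>" "N < m * card B" "0 < m"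
    and van: "f dvd (y - yq) ^ m * \<Psi> - (x - xq) ^ m * \<Theta>"
  shows "f dvd \<Psi>"
proof -
  obtain u r where r: "\<Psi> = f * u + r" "degree r < d" "tdeg N r" using tdeg_reduce[OF \<Psi>(1)] by blast
  have "[:- x0, 1:] ^ m dvd coeff r j" if x0: "x0 \<in> B" for x0 j
  proof -
    let ?t = "x - kconst x0"
    obtain e where e: "xq - x = ?t * e" using xq_dvd B(1) x0 by (auto simp: dvd_def)
    have "(y - yq) ^ m * \<Psi> - (x - xq) ^ m * \<Theta> = (- 1) ^ m * ((yq - y) ^ m * \<Psi> - ?t ^ m * (e ^ m * \<Theta>))"
    proof -
      have "(y - yq) ^ m = (- 1) ^ m * (yq - y) ^ m" "(x - xq) ^ m = (- 1) ^ m * (xq - x) ^ m"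
        by (simp_all flip: power_mult_distrib)
      moreover have "(xq - x) ^ m = ?t ^ m * e ^ m" by (simp only: e power_mult_distrib)
      ultimately show ?thesis by (simp only: right_diff_distrib mult.assoc)
    qed
    then have "f dvd (- 1) ^ m * ((yq - y) ^ m * \<Psi> - ?t ^ m * (e ^ m * \<Theta>))" using van by simp
    from dvd_mult[OF this, of "(- 1) ^ m"]
    have "f dvd (yq - y) ^ m * \<Psi> - ?t ^ m * (e ^ m * \<Theta>)"
      by (simp flip: mult.assoc power_mult_distrib)
    from vanish_order[OF B(2)[OF x0] this] obtain W1 where W1: "f dvd \<Psi> - ?t ^ m * W1" by blast
    obtain u1 r1 where r1: "W1 = f * u1 + r1" "degree r1 < d" using f_division by blast
    have tm: "?t ^ m = [:[:- x0, 1:] ^ m:]" by (simp add: x_minus poly_const_pow)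
    have "f dvd (\<Psi> - ?t ^ m * W1) - f * (u - ?t ^ m * u1)" by (rule dvd_diff[OF W1 dvd_triv_left])
    then have "f dvd r - ?t ^ m * r1" by (simp add: r(1) r1(1) algebra_simps)
    moreover have "degree (r - ?t ^ m * r1) < d"
      using r(2) r1(2) unfolding tm by (intro degree_diff_less) auto
    ultimately have "r = ?t ^ m * r1" using f_dvd_imp_0 by fastforce
    then have "coeff r j = [:- x0, 1:] ^ m * coeff r1 j" by (simp add: tm)
    then show ?thesis by simp
  qed
  moreover have "finite B" using B(1) S_fin finite_subset by blast
  moreover have "degree (coeff r j) \<le> N" for j
    using deg.wdeg_coeff[OF r(3), of j] by simp
  ultimately have "coeff r j = 0" for j
    using sum_multiplicity_le_degree[of "coeff r j" B m] \<Psi>(2,3) by (meson leD order_trans)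
  then have "r = 0" by (intro poly_eqI) simp
  then show ?thesis using r(1) by simp
qed

end

text \<open>On the branch put \<beta> = x^r Y^s for each v = (r, s); then \<beta>^q is a series in
  x^q with coefficients \<beta>_n^q. Collecting powers of x^q turns the relation into a sum of x^(q
  n) \<alpha>_n(x, Y). By \<open>ord\<close> a nonzero \<alpha>_n has order below q on the branch,
  so the first nonzero one could not be cancelled, and all vanish. Extracting q-th roots of the
  coefficients then gives a polynomial vanishing on the branch, which \<open>ker\<close> excludes
  unless it is 0.\<close>

lemma (in frobenius_curve) independence:
  fixes Y :: "'k fps"
  assumes char: "prime CHAR('k)" "q = CHAR('k) ^ e"
    and roots: "\<And>a :: 'k. \<exists>b. b ^ q = a"
    and Y: "curve_eval Y f = 0"
    and ker: "\<And>h. degree h < d \<Longrightarrow> curve_eval Y h = 0 \<Longrightarrow> h = 0"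
    and ord: "\<And>h. h \<noteq> 0 \<Longrightarrow> degree h < d \<Longrightarrow> tdeg A h \<Longrightarrow> \<exists>k<q. fps_nth (curve_eval Y h) k \<noteq> 0"
    and A: "a0 + d \<le> A + 2"
    and dvd: "f dvd (\<Sum>(u, v)\<in>({..<a0} \<times> {..<d}) \<times> ({..<b0} \<times> {..<d}).
        kconst (c (u, v)) * (x ^ fst u * y ^ snd u * xq ^ fst v * yq ^ snd v))"
    and uv: "u \<in> {..<a0} \<times> {..<d}" "v \<in> {..<b0} \<times> {..<d}"
  shows "c (u, v) = 0"
proof -
  define I where "I = {..<a0} \<times> {..<d}"
  define J where "J = {..<b0} \<times> {..<d}"
  have q: "0 < q" using char by (simp add: prime_gt_0_nat)
  interpret ev: comm_ring_hom "curve_eval Y" by (rule curve_eval_hom)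
  define a where "a = (\<lambda>v. \<Sum>u\<in>I. kconst (c (u, v)) * xy (fst u) (snd u))"
  define \<beta> where "\<beta> = (\<lambda>v. curve_eval Y (xy (fst v) (snd v)))"
  have xyv: "x ^ i * y ^ j = xy i j" "xq ^ i * yq ^ j = xy i j ^ q" for i j
    by (simp_all add: x_power y_power xq_power yq_power xy_mult)
       (simp add: xy_def monom_power mult.commute)
  have "f dvd (\<Sum>v\<in>J. a v * xy (fst v) (snd v) ^ q)"
  proof -
    have "(\<Sum>(u, v)\<in>I \<times> J. kconst (c (u, v)) * (x ^ fst u * y ^ snd u * xq ^ fst v * yq ^ snd v)) =
        (\<Sum>u\<in>I. \<Sum>v\<in>J. kconst (c (u, v)) * (x ^ fst u * y ^ snd u * xq ^ fst v * yq ^ snd v))"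
      by (rule sum.cartesian_product[symmetric])
    also have "\<dots> = (\<Sum>v\<in>J. \<Sum>u\<in>I. kconst (c (u, v)) * xy (fst u) (snd u) * xy (fst v) (snd v) ^ q)"
      by (subst sum.swap) (simp only: mult.assoc xyv(2), simp only: xyv(1) flip: mult.assoc)
    finally show ?thesis using dvd by (simp add: I_def J_def a_def sum_distrib_right)
  qed
  then have "curve_eval Y (\<Sum>v\<in>J. a v * xy (fst v) (snd v) ^ q) = 0"
    using Y by (auto simp: dvd_def ev.hom_mult)
  then have zero: "(\<Sum>v\<in>J. \<beta> v ^ q * curve_eval Y (a v)) = 0"
    by (simp add: \<beta>_def ev.hom_sum ev.hom_mult ev.hom_power mult.commute)
  have coeff_a: "coeff (coeff (a v) j) i = (if (i, j) \<in> I then c ((i, j), v) else 0)" for v i j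
  proof -
    have "coeff (coeff (a v) j) i = (\<Sum>u\<in>I. if u = (i, j) then c (u, v) else 0)"
      unfolding a_def coeff_sum by (intro sum.cong) (auto simp: kconst_def coeff_xy)
    then show ?thesis by (simp add: I_def)
  qed
  define \<alpha> where "\<alpha> = (\<lambda>n. \<Sum>v\<in>J. kconst (fps_nth (\<beta> v) n ^ q) * a v)"
  have coeff_\<alpha>: "coeff (coeff (\<alpha> n) j) i = (if (i, j) \<in> I then \<Sum>v\<in>J. fps_nth (\<beta> v) n ^ q * c ((i, j), v) else 0)" for n i j
    by (simp add: \<alpha>_def coeff_sum kconst_def coeff_a)
  have deg_\<alpha>: "degree (\<alpha> n) < d" for n
    using d2 by (intro degree_lessI) (auto simp: coeff_\<alpha> I_def intro!: poly_eqI)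
  have tdeg_\<alpha>: "tdeg A (\<alpha> n)" for n
  proof (rule deg.wdegI)
    fix j assume "coeff (\<alpha> n) j \<noteq> 0"
    then have "j < d" using deg_\<alpha>[of n] le_degree by fastforce
    moreover have "degree (coeff (\<alpha> n) j) \<le> A - j"
      by (rule degree_le) (use A \<open>j < d\<close> in \<open>auto simp: coeff_\<alpha> I_def\<close>)
    moreover have "0 < a0"
    proof (rule ccontr)
      assume "\<not> 0 < a0"
      then have "coeff (\<alpha> n) j = 0" by (intro poly_eqI) (simp add: coeff_\<alpha> I_def)
      then show False using \<open>coeff (\<alpha> n) j \<noteq> 0\<close> by simp
    qed
    ultimately show "j \<le> A \<and> coeff (\<alpha> n) j \<in> {p. degree p \<le> A - j}" using A by auto
  qed
  have ev_kconst: "curve_eval Y (kconst k * p) = fps_const k * curve_eval Y p" for k p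
    unfolding ev.hom_mult by (simp add: kconst_def fps_of_poly_const)
  have \<alpha>0: "\<alpha> n = 0" for n
  proof (induction n rule: less_induct)
    case (less n)
    have "fps_nth (curve_eval Y (\<alpha> n)) k = 0" if k: "k < q" for k
    proof -
      have "0 = (\<Sum>v\<in>J. fps_nth (\<beta> v ^ q * curve_eval Y (a v)) (q * n + k))"
        using arg_cong[OF zero, of "\<lambda>t. fps_nth t (q * n + k)"] by (simp add: fps_sum_nth)
      also have "\<dots> = (\<Sum>v\<in>J. \<Sum>l\<le>n. fps_nth (\<beta> v ^ q) (q * l) * fps_nth (curve_eval Y (a v)) (q * (n - l) + k))"
        by (intro sum.cong refl fps_nth_mult_sparse q k) (simp add: fps_power_char[OF char])
      also have "\<dots> = (\<Sum>l\<le>n. \<Sum>v\<in>J. fps_nth (\<beta> v) l ^ q * fps_nth (curve_eval Y (a v)) (q * (n - l) + k))"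
        using q by (subst sum.swap) (simp add: fps_power_char[OF char])
      also have "\<dots> = (\<Sum>l\<le>n. fps_nth (curve_eval Y (\<alpha> l)) (q * (n - l) + k))"
        by (simp add: \<alpha>_def ev.hom_sum ev_kconst fps_sum_nth)
      also have "\<dots> = (\<Sum>l\<in>{n}. fps_nth (curve_eval Y (\<alpha> l)) (q * (n - l) + k))"
        by (rule sum.mono_neutral_right) (use less.IH in auto)
      finally show ?thesis by simp
    qed
    with ord[OF _ deg_\<alpha> tdeg_\<alpha>, of n] show ?case by auto
  qed
  obtain i j where ij: "u = (i, j)" by (cases u)
  have "\<forall>v. \<exists>b. b ^ q = c (u, v)" using roots by blast
  from choice[OF this] obtain \<xi> where \<xi>: "\<And>v. \<xi> v ^ q = c (u, v)" by blast
  define h where "h = (\<Sum>v\<in>J. kconst (\<xi> v) * xy (fst v) (snd v))"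
  have "fps_nth (curve_eval Y h) n = 0" for n
  proof -
    have "fps_nth (curve_eval Y h) n = (\<Sum>v\<in>J. \<xi> v * fps_nth (\<beta> v) n)"
      by (simp add: h_def ev.hom_sum ev_kconst fps_sum_nth \<beta>_def)
    moreover have "(\<Sum>v\<in>J. \<xi> v * fps_nth (\<beta> v) n) ^ q = 0"
    proof -
      have "(\<Sum>v\<in>J. \<xi> v * fps_nth (\<beta> v) n) ^ q = (\<Sum>v\<in>J. (\<xi> v * fps_nth (\<beta> v) n) ^ q)"
        by (rule freshmans_dream_sum'[OF char])
      also have "\<dots> = coeff (coeff (\<alpha> n) j) i"
        using uv(1) by (simp add: coeff_\<alpha> power_mult_distrib \<xi> ij I_def mult.commute)
      finally show ?thesis by (simp add: \<alpha>0)
    qed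
    ultimately show ?thesis using q by simp
  qed
  then have "curve_eval Y h = 0" by (intro fps_ext) simp
  moreover have coeff_h: "coeff (coeff h s) r = (if (r, s) \<in> J then \<xi> (r, s) else 0)" for r s
  proof -
    have "coeff (coeff h s) r = (\<Sum>v\<in>J. if v = (r, s) then \<xi> v else 0)"
      unfolding h_def coeff_sum by (intro sum.cong) (auto simp: kconst_def coeff_xy)
    then show ?thesis by (simp add: J_def)
  qed
  moreover have "degree h < d"
    using d2 by (intro degree_lessI) (auto simp: coeff_h J_def intro!: poly_eqI)
  ultimately have "h = 0" using ker by blast
  then have "\<xi> v = 0" using coeff_h[of "snd v" "fst v"] uv(2) by (simp add: J_def)
  then have "\<xi> v ^ q = 0" using q by simp
  then show ?thesis using \<xi>[of v] by simp
qed

text \<open>Divided by 2d^3 the claim is (4d^3 + 2d^2 + d - 2)(d - 1) < 2d^2 (2d^2 - d + 1); the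
  terms 4d^4 and -2d^3 agree on both sides, and the remaining ones decide. Writing d = k + 2 avoids
  truncated subtraction.\<close>

lemma stepanov_parameters:
  fixes d k b0 :: nat
  assumes d: "d = k + 2" and b0: "b0 = 2 * k ^ 2 + 7 * k + 7"
  shows "2 * d ^ 2 * ((4 * d ^ 3 + k + 2 * d ^ 2) * (d * (d - 1))) < 4 * d ^ 3 * d * (b0 * d)"
proof -
  have key: "(4 * d ^ 3 + k + 2 * d ^ 2) * (k + 1) < 2 * d ^ 2 * b0"
    unfolding b0 d by (simp add: power2_eq_square power3_eq_cube algebra_simps)
  have "2 * d ^ 2 * (u * (d * (k + 1))) = 2 * d ^ 3 * (u * (k + 1))" for u
    by (simp only: power2_eq_square power3_eq_cube ac_simps)
  moreover have "d - 1 = k + 1" using d by simp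
  moreover have "2 * d ^ 3 * ((4 * d ^ 3 + k + 2 * d ^ 2) * (k + 1)) < 2 * d ^ 3 * (2 * d ^ 2 * b0)"
    by (rule mult_strict_left_mono[OF key]) (use d in simp)
  moreover have "4 * d ^ 3 * d * (b0 * d) = 2 * d ^ 3 * (2 * d ^ 2 * b0)"
    by (simp add: power2_eq_square power3_eq_cube)
  ultimately show ?thesis by (simp only:)
qed

text \<open>The first bound makes the number m(q - 2d) of forced zeros exceed the degree A + q(m -
  1) of the auxiliary polynomial. The second keeps the order bound for polynomials of total degree A
  below q; it has size 4d^4.\<close>

lemma stepanov_size:
  fixes d q :: nat
  assumes "2 \<le> d" "6 * d ^ 4 < q"
  shows "4 * d ^ 3 + d - 2 + 2 * d * (2 * d ^ 2) < q" "d * (4 * d ^ 3 + d - 2 + d - 1) < q"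
proof -
  have d4: "d ^ 4 = d * d ^ 3" by (simp add: eval_nat_numeral)
  have "2 * d ^ 3 \<le> d ^ 4" unfolding d4 using assms(1) by (rule mult_le_mono1)
  moreover have "d \<le> d ^ 3" using assms(1) by (intro self_le_power) auto
  moreover have "2 * d * (2 * d ^ 2) = 4 * d ^ 3" by (simp add: power2_eq_square power3_eq_cube)
  ultimately show "4 * d ^ 3 + d - 2 + 2 * d * (2 * d ^ 2) < q" using assms(2) by linarith
  have "d * (4 * d ^ 3 + d - 2 + d - 1) \<le> d * (4 * d ^ 3 + 2 * d)" by (intro mult_le_mono2) simp
  also have "\<dots> = 4 * d ^ 4 + 2 * d ^ 2" unfolding d4 by (simp add: power2_eq_square distrib_left)
  also have "\<dots> \<le> 6 * d ^ 4" using assms(1) power_increasing[of 2 4 d] by simp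
  finally show "d * (4 * d ^ 3 + d - 2 + d - 1) < q" using assms(2) by linarith
qed

context stepanov_curve
begin

theorem many_rational_abscissae:
  fixes Y :: "'k fps"
  assumes char: "prime CHAR('k)" "q = CHAR('k) ^ e"
    and roots: "\<And>a :: 'k. \<exists>b. b ^ q = a"
    and S: "card S = q"
    and Y: "curve_eval Y f = 0"
    and ker: "\<And>h. degree h < d \<Longrightarrow> curve_eval Y h = 0 \<Longrightarrow> h = 0"
    and large: "6 * d ^ 4 < q"
  shows "2 * d < card {x0 \<in> S. \<exists>c\<in>S. poly (poly f [:c:]) x0 = 0}"
proof (rule ccontr)
  assume few: "\<not> ?thesis"
  define B where "B = {x0 \<in> S. \<forall>c\<in>S. poly (poly f [:c:]) x0 \<noteq> 0}"
  \<comment> \<open>\<open>a0\<close> and \<open>b0\<close> limit the exponents of x and x^q, and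
    \<open>A\<close> is the resulting degree in x and y. The choice of \<open>b0\<close> makes the
    degree in x^q and y^q at most m - 1, so that order m at nearly q abscissae exceeds the total
    degree. \<open>T\<close> adds both degrees.\<close>
  define a0 m b0 A T where "a0 = 4 * d ^ 3" and "m = 2 * d ^ 2" and "b0 = m - d + 1"
    and "A = a0 + d - 2" and "T = A + (m - 1)"
  have d2': "2 \<le> d" by (rule d2)
  have dm: "d \<le> m" "2 \<le> m" using d2' by (auto simp: m_def power2_eq_square)
  have "card S = card B + card {x0 \<in> S. \<exists>c\<in>S. poly (poly f [:c:]) x0 = 0}"
  proof -
    let ?C = "{x0 \<in> S. \<exists>c\<in>S. poly (poly f [:c:]) x0 = 0}"
    have "S = B \<union> ?C" by (auto simp: B_def)
    moreover have "card (B \<union> ?C) = card B + card ?C"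
      by (rule card_Un_disjoint) (use S_fin in \<open>auto simp: B_def\<close>)
    ultimately show ?thesis by simp
  qed
  then have cardB: "q \<le> card B + 2 * d" using few S by simp
  define I where "I = ({..<a0} \<times> {..<d}) \<times> ({..<b0} \<times> {..<d})"
  define \<Phi> where "\<Phi> = (\<lambda>(u, v). x ^ fst u * y ^ snd u * xq ^ fst v * yq ^ snd v)"
  have finI: "finite I" by (simp add: I_def)
  have spI: "sp T (\<Phi> \<kappa>)" if "\<kappa> \<in> I" for \<kappa>
  proof -
    obtain i j r s where \<kappa>: "\<kappa> = ((i, j), (r, s))" by (metis surj_pair)
    have "i + j + r + s \<le> T"
      using that dm by (auto simp: I_def \<kappa> T_def A_def b0_def)
    then show ?thesis using sp_mono4[of i j r s] by (auto simp: \<Phi>_def \<kappa> elim: span_deg_mono)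
  qed
  have cardI: "m * ((T + 1) * (d * (d - 1))) < card I"
  proof -
    obtain k where k: "d = k + 2" using d2' by (metis add.commute le_Suc_ex)
    have b0: "b0 = 2 * k ^ 2 + 7 * k + 7"
      unfolding b0_def m_def k by (simp add: power2_eq_square algebra_simps)
    have "T + 1 = a0 + k + m" using dm by (simp add: T_def A_def k)
    then have "m * ((T + 1) * (d * (d - 1))) = 2 * d ^ 2 * ((4 * d ^ 3 + k + 2 * d ^ 2) * (d * (d - 1)))"
      by (simp only: a0_def m_def)
    also have "\<dots> < 4 * d ^ 3 * d * (b0 * d)" by (rule stepanov_parameters[OF k b0])
    also have "\<dots> = card I" by (simp only: I_def a0_def card_cartesian_product card_lessThan)
    finally show ?thesis .
  qed
  have "\<exists>c \<Theta>. (\<exists>\<kappa>\<in>I. c \<kappa> \<noteq> 0) \<and>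
      f dvd (y - yq) ^ m * (\<Sum>\<kappa>\<in>I. kconst (c \<kappa>) * \<Phi> \<kappa>) - (x - xq) ^ m * \<Theta>"
    by (rule stepanov_vanishing[OF finI spI cardI])
  then obtain c \<Theta> where c: "\<exists>\<kappa>\<in>I. c \<kappa> \<noteq> 0"
      "f dvd (y - yq) ^ m * (\<Sum>\<kappa>\<in>I. kconst (c \<kappa>) * \<Phi> \<kappa>) - (x - xq) ^ m * \<Theta>"
    by (elim exE conjE) (rule that)
  define \<Psi> where "\<Psi> = (\<Sum>\<kappa>\<in>I. kconst (c \<kappa>) * \<Phi> \<kappa>)"
  have tdeg\<Psi>: "tdeg (A + q * (m - 1)) \<Psi>"
    unfolding \<Psi>_def
  proof (intro deg.wdeg_sum)
    fix \<kappa> assume "\<kappa> \<in> I"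
    then obtain i j r s where \<kappa>: "\<kappa> = ((i, j), (r, s))" "i < a0" "j < d" "r < b0" "s < d"
      by (auto simp: I_def)
    have eq: "kconst (c \<kappa>) * \<Phi> \<kappa> = kconst (c \<kappa>) * xy (i + q * r) (j + q * s)"
      by (simp add: \<Phi>_def \<kappa>(1) x_power y_power xq_power yq_power xy_mult)
    have td: "tdeg (0 + ((i + q * r) + (j + q * s))) (kconst (c \<kappa>) * xy (i + q * r) (j + q * s))"
      by (intro deg.wdeg_mult tdeg_xy) (simp add: kconst_def deg.wdeg_const)
    have "r + s \<le> m - 1" using \<kappa> dm by (simp add: b0_def)
    then have "q * (r + s) \<le> q * (m - 1)" by (rule mult_le_mono2)
    moreover have "i + j \<le> A" using \<kappa> by (simp add: A_def)
    ultimately have "0 + ((i + q * r) + (j + q * s)) \<le> A + q * (m - 1)" by (simp add: distrib_left)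
    from deg.wdeg_mono[OF td this] show "tdeg (A + q * (m - 1)) (kconst (c \<kappa>) * \<Phi> \<kappa>)"
      unfolding eq .
  qed
  have Nlt: "A + q * (m - 1) < m * card B"
  proof -
    have "A + 2 * d * m < q" unfolding A_def a0_def m_def by (rule stepanov_size(1)[OF d2' large])
    moreover have "m * q \<le> m * card B + 2 * d * m"
      using mult_le_mono2[OF cardB, of m] by (simp add: algebra_simps)
    moreover have "q * (m - 1) + q = m * q" using dm by (simp add: diff_mult_distrib2 mult.commute)
    ultimately show ?thesis by linarith
  qed
  have "f dvd \<Psi>"
    by (rule stepanov_divides[OF _ _ tdeg\<Psi> Nlt _ c(2)[folded \<Psi>_def]]) (use dm in \<open>auto simp: B_def\<close>)
  then have dvd: "f dvd (\<Sum>(u, v)\<in>I. kconst (c (u, v)) * (x ^ fst u * y ^ snd u * xq ^ fst v * yq ^ snd v))"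
    by (simp add: \<Psi>_def \<Phi>_def case_prod_unfold)
  \<comment> \<open>If \<open>f\<close> divides w h, then w or h vanishes on the branch, because
    power series form a domain; \<open>ker\<close> then applies to that factor.\<close>
  have dom: "w = 0 \<or> h = 0" if "degree w < d" "degree h < d" "f dvd w * h" for w h
  proof -
    interpret ev: comm_ring_hom "curve_eval Y" by (rule curve_eval_hom)
    have "curve_eval Y w * curve_eval Y h = 0"
      unfolding ev.hom_mult[symmetric] by (rule curve_eval_dvd[OF that(3) Y])
    then have "curve_eval Y w = 0 \<or> curve_eval Y h = 0" by simp
    then show ?thesis by (elim disjE) (simp_all add: ker that)
  qed
  have ord: "\<exists>k<q. fps_nth (curve_eval Y h) k \<noteq> 0" if "h \<noteq> 0" "degree h < d" "tdeg A h" for h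
  proof -
    have lt: "d * (A + d - 1) < q" unfolding A_def a0_def by (rule stepanov_size(2)[OF d2' large])
    have "0 < d" using d2' by simp
    from curve_order_bound[OF deg_f monic_f this tdeg_f dom Y that]
    obtain k where "k \<le> d * (A + d - 1)" "fps_nth (curve_eval Y h) k \<noteq> 0" by blast
    then show ?thesis using lt by (intro exI[of _ k]) simp
  qed
  have "c (u, v) = 0" if "(u, v) \<in> I" for u v
    by (rule independence[OF char roots Y ker ord _ dvd[unfolded I_def]])
       (use that d2' in \<open>auto simp: I_def A_def\<close>)
  then show False using c(1) by auto
qed

end

section \<open>Hensel lifting\<close>

lemma poly_taylor2:
  fixes F :: "'r::idom poly"
  shows "\<exists>R. poly F (u + h) = poly F u + h * poly (pderiv F) u + h * h * R"
proof (induction F)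
  case 0
  show ?case by simp
next
  case (pCons a p)
  then obtain R where R: "poly p (u + h) = poly p u + h * poly (pderiv p) u + h * h * R" by blast
  show ?case
    by (rule exI[of _ "u * R + poly (pderiv p) u + h * R"], unfold poly_pCons R pderiv_pCons poly_add)
       (simp add: algebra_simps)
qed

lemma diff_dvd_poly_diff:
  fixes F :: "'r::comm_ring_1 poly"
  shows "u - v dvd poly F u - poly F v"
proof (induction F)
  case (pCons a p)
  then obtain w where w: "poly p u - poly p v = (u - v) * w" by (auto simp: dvd_def)
  have "poly (pCons a p) u - poly (pCons a p) v = (u - v) * poly p u + v * (poly p u - poly p v)"
    by (simp add: algebra_simps)
  also have "\<dots> = (u - v) * (poly p u + v * w)" unfolding w by (simp add: algebra_simps)
  finally show ?case by (metis dvd_triv_left)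
qed simp

lemma fps_nth_poly_cong:
  fixes F :: "'r::idom fps poly"
  assumes "\<And>k. k \<le> n \<Longrightarrow> fps_nth u k = fps_nth v k" "k \<le> n"
  shows "fps_nth (poly F u) k = fps_nth (poly F v) k"
proof -
  obtain w where w: "poly F u - poly F v = (u - v) * w" using diff_dvd_poly_diff[of u v F] by (auto simp: dvd_def)
  have "fps_nth ((u - v) * w) k = 0"
    unfolding fps_mult_nth by (intro sum.neutral) (use assms in auto)
  then have "fps_nth (poly F u - poly F v) k = 0" by (simp only: w)
  then show ?thesis by simp
qed

text \<open>Newton's method, one coefficient at a time: a multiple of x^(n + 1) cancels coefficient
  n + 1 of F(Y), always with the same inverse \<open>b\<close> of the derivative at the root. As
  \<open>b\<close> lies in \<open>D 0\<close>, no denominators arise and the n-th coefficient of the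
  branch lies in \<open>D n\<close>; for the generic direction this bounds its degree by n.\<close>

lemma fps_hensel:
  fixes F :: "'r::idom fps poly" and D :: "nat \<Rightarrow> 'r set"
  assumes "ring_filtration D"
    and F: "\<And>i n. fps_nth (coeff F i) n \<in> D n" and a: "a \<in> D 0" and b: "b \<in> D 0"
    and root: "fps_nth (poly F (fps_const a)) 0 = 0"
    and simple: "fps_nth (poly (pderiv F) (fps_const a)) 0 * b = 1"
  shows "\<exists>Y. poly F Y = 0 \<and> (\<forall>n. fps_nth Y n \<in> D n)"
proof -
  interpret ring_filtration D by fact
  define graded where "graded = (\<lambda>u. \<forall>n. fps_nth u n \<in> D n)"
  have g_add: "graded (u + v)" if "graded u" "graded v" for u v
    using that by (auto simp: graded_def add_in)
  have g_mult: "graded (u * v)" if "graded u" "graded v" for u v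
    unfolding graded_def
  proof
    fix n
    have "fps_nth u i * fps_nth v (n - i) \<in> D n" if "i \<in> {0..n}" for i
      using mult_in[of "fps_nth u i" i "fps_nth v (n - i)" "n - i"] \<open>graded u\<close> \<open>graded v\<close> that
      by (simp add: graded_def)
    then show "fps_nth (u * v) n \<in> D n" unfolding fps_mult_nth by (rule sum_in)
  qed
  have g_poly: "graded (poly F u)" if "graded u" for u
  proof -
    have "graded (poly p u)" if "\<And>i. graded (coeff p i)" for p
      using that
    proof (induction p)
      case 0
      show ?case by (simp add: graded_def zero_in)
    next
      case (pCons c p)
      have "graded c" using pCons.prems[of 0] by simp
      moreover have "graded (coeff p i)" for i using pCons.prems[of "Suc i"] by simp
      ultimately show ?case using pCons.IH \<open>graded u\<close> by (simp add: g_add g_mult)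
    qed
    then show ?thesis using F by (simp add: graded_def)
  qed
  define step where "step = (\<lambda>n u. u + - fps_const (b * fps_nth (poly F u) (Suc n)) * fps_X ^ Suc n)"
  define Ys where "Ys = rec_nat (fps_const a) step"
  have Ys_0: "Ys 0 = fps_const a" and Ys_Suc: "Ys (Suc n) = step n (Ys n)" for n
    by (simp_all add: Ys_def)
  have step_nth: "fps_nth (step n u) k = fps_nth u k" if "k \<noteq> Suc n" for n u k
    using that by (simp add: step_def fps_X_power_mult_right_nth del: power_Suc)
  have inv: "graded (Ys n) \<and> fps_nth (Ys n) 0 = a \<and> (\<forall>k\<le>n. fps_nth (poly F (Ys n)) k = 0)" for n
  proof (induction n)
    case 0
    show ?case using root a by (auto simp: Ys_0 graded_def zero_in)
  next
    case (Suc n)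
    define u where "u = Ys n"
    define h where "h = - fps_const (b * fps_nth (poly F u) (Suc n)) * fps_X ^ Suc n"
    have u: "graded u" "fps_nth u 0 = a" "\<And>k. k \<le> n \<Longrightarrow> fps_nth (poly F u) k = 0"
      using Suc.IH by (auto simp: u_def)
    have Yh: "Ys (Suc n) = u + h" by (simp only: Ys_Suc step_def u_def h_def)
    have h_nth: "fps_nth h k = (if k = Suc n then - (b * fps_nth (poly F u) (Suc n)) else 0)" for k
      by (auto simp: h_def fps_X_power_mult_right_nth simp del: power_Suc)
    have "b * fps_nth (poly F u) (Suc n) \<in> D (Suc n)"
      using mult_in[OF b, of "fps_nth (poly F u) (Suc n)" "Suc n"] g_poly[OF u(1)] by (simp add: graded_def)
    then have "graded h" by (simp add: graded_def h_nth uminus_in zero_in)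
    then have "graded (Ys (Suc n))" unfolding Yh using u(1) by (rule g_add[rotated])
    moreover have "fps_nth (Ys (Suc n)) 0 = a" unfolding Yh using u(2) by (simp add: h_nth)
    moreover have "fps_nth (poly F (Ys (Suc n))) k = 0" if "k \<le> Suc n" for k
    proof -
      obtain R where R: "poly F (u + h) = poly F u + h * poly (pderiv F) u + h * h * R"
        using poly_taylor2 by blast
      have hz: "fps_nth (h * z) k = (if k = Suc n then fps_nth h k * fps_nth z 0 else 0)" for z
      proof -
        have "fps_nth (h * z) k = (\<Sum>i=0..k. if i = Suc n then fps_nth h (Suc n) * fps_nth z (k - i) else 0)"
          unfolding fps_mult_nth by (intro sum.cong) (auto simp: h_nth)
        then show ?thesis using that by auto
      qed
      have "fps_nth (h * h * R) k = 0"
        using hz[of "h * R"] by (simp add: mult.assoc h_nth)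
      moreover have "fps_nth (poly (pderiv F) u) 0 = fps_nth (poly (pderiv F) (fps_const a)) 0"
        by (rule fps_nth_poly_cong[of 0]) (simp_all add: u(2))
      moreover have "b * x * fps_nth (poly (pderiv F) (fps_const a)) 0 = x" for x
        using simple by (metis mult.commute mult.left_commute mult_1)
      ultimately show ?thesis
        unfolding Yh R using u(3) that by (auto simp: hz h_nth le_Suc_eq)
    qed
    ultimately show ?case by blast
  qed
  define Y where "Y = Abs_fps (\<lambda>n. fps_nth (Ys n) n)"
  have agree: "fps_nth Y k = fps_nth (Ys n) k" if "k \<le> n" for k n
    using that
  proof (induction n)
    case (Suc n)
    then show ?case
      by (cases "k = Suc n") (simp_all add: Y_def Ys_Suc step_nth)
  qed (simp add: Y_def)
  have "fps_nth (poly F Y) n = 0" for n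
    using fps_nth_poly_cong[of n Y "Ys n" n F] agree inv[of n] by auto
  moreover have "fps_nth Y n \<in> D n" for n
    using inv[of n] by (simp add: Y_def graded_def)
  ultimately show ?thesis by (intro exI[of _ Y]) (auto intro: fps_ext)
qed

section \<open>Degree in the inner variable and Gauss' lemma\<close>

lemma map_poly_hom:
  assumes "comm_ring_hom h"
  shows "comm_ring_hom (map_poly h)"
proof -
  interpret h: comm_ring_hom h by fact
  interpret m: map_poly_comm_ring_hom h ..
  show ?thesis by (rule m.comm_ring_hom_axioms)
qed

definition swap_vars :: "'k::idom poly poly \<Rightarrow> 'k poly poly" where
  "swap_vars = lift_hom (map_poly (\<lambda>a. [:a:])) [:[:0, 1:]:]"

lemma swap_vars_hom: "comm_ring_hom swap_vars"
  unfolding swap_vars_def by (intro lift_hom_hom map_poly_hom const_poly_hom)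

lemma coeff_swap_vars: "coeff (coeff (swap_vars p) j) i = coeff (coeff p i) j"
proof (induction p arbitrary: i)
  case 0
  interpret s: comm_ring_hom "swap_vars :: 'a poly poly \<Rightarrow> _" by (rule swap_vars_hom)
  show ?case by simp
next
  case (pCons a p)
  have "swap_vars (pCons a p) = map_poly (\<lambda>a. [:a:]) a + [:[:0, 1:]:] * swap_vars p"
    unfolding swap_vars_def lift_hom_def
    by (subst map_poly_pCons) (use pCons.hyps in \<open>auto simp: map_poly_pCons\<close>)
  then show ?case
    using pCons.IH by (cases i) (simp_all add: coeff_map_poly)
qed

lemma swap_vars_eq_0: "swap_vars p = 0 \<Longrightarrow> p = 0"
  by (intro poly_eqI) (simp flip: coeff_swap_vars)

text \<open>After exchanging the two variables this is additivity of the degree over a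
  domain.\<close>

lemma degree_coeff_factor:
  fixes p s :: "'k::idom poly poly"
  assumes "s \<noteq> 0" "\<And>j. degree (coeff (p * s) j) \<le> n"
  shows "degree (coeff p i) \<le> n"
proof (cases "p = 0")
  case False
  interpret s: comm_ring_hom "swap_vars :: 'k poly poly \<Rightarrow> _" by (rule swap_vars_hom)
  have "degree (swap_vars (p * s)) \<le> n"
  proof (rule degree_le, intro allI impI poly_eqI)
    fix j i assume "n < j"
    then have "coeff (coeff (p * s) i) j = 0"
      using assms(2)[of i] by (intro coeff_eq_0) simp
    then show "coeff (coeff (swap_vars (p * s)) j) i = coeff 0 i" by (simp add: coeff_swap_vars)
  qed
  moreover have "swap_vars p \<noteq> 0" "swap_vars s \<noteq> 0" using swap_vars_eq_0 assms(1) False by blast+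
  ultimately have "degree (swap_vars p) \<le> n" by (simp add: s.hom_mult degree_mult_eq)
  show ?thesis
  proof (rule degree_le, intro allI impI)
    fix j assume "n < j"
    then have "coeff (swap_vars p) j = 0" using \<open>degree (swap_vars p) \<le> n\<close> by (intro coeff_eq_0) simp
    then show "coeff (coeff p i) j = 0" by (simp flip: coeff_swap_vars)
  qed
qed simp

text \<open>In the fraction field \<open>a\<close> is a unit, and Gauss' lemma brings the
  divisibility by a primitive polynomial back.\<close>

lemma primitive_dvd_cancel:
  fixes p f :: "'r::{factorial_ring_gcd,semiring_gcd_mult_normalize} poly"
  assumes "content p = 1" "a \<noteq> 0" "p dvd Polynomial.smult a f"
  shows "p dvd f"
proof (rule fract_poly_dvdD[OF _ assms(1)])
  have "fract_poly p dvd fract_poly (Polynomial.smult a f)" using assms(3) by (rule fract_poly_dvd)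
  then have "fract_poly p dvd Polynomial.smult (to_fract a) (fract_poly f)" by (simp add: fract_poly_smult)
  then show "fract_poly p dvd fract_poly f" using assms(2) by (simp add: dvd_smult_iff)
qed

text \<open>A primitive polynomial of least y-degree vanishing on the branch divides
  \<open>f\<close>, by pseudo-division and Gauss' lemma, so its x-degree is at most d. Therefore it
  suffices to exclude polynomials in a finite box, which a minor of finite size can do.\<close>

lemma curve_kernel_trivial:
  fixes f :: "'k::{field,factorial_ring_gcd,semiring_gcd_mult_normalize} poly poly"
  assumes f: "degree f = d" "lead_coeff f = 1" "tdeg d f" and Y: "curve_eval Y f = 0"
    and box: "\<And>h. degree h < d \<Longrightarrow> (\<And>j. degree (coeff h j) \<le> d) \<Longrightarrow> curve_eval Y h = 0 \<Longrightarrow> h = 0"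
    and h: "degree h < d" "curve_eval Y h = 0"
  shows "h = 0"
proof (rule ccontr)
  assume "h \<noteq> 0"
  interpret ev: comm_ring_hom "curve_eval Y" by (rule curve_eval_hom)
  let ?P = "\<lambda>p. p \<noteq> 0 \<and> curve_eval Y p = 0"
  have "?P h" using \<open>h \<noteq> 0\<close> h by simp
  from ex_has_least_nat[of ?P, OF this, of degree] obtain p0 where
    p0: "p0 \<noteq> 0" "curve_eval Y p0 = 0" and least: "\<And>r. ?P r \<Longrightarrow> degree p0 \<le> degree r" by blast
  define p where "p = primitive_part p0"
  have split: "p0 = [:content p0:] * p" by (simp add: p_def content_times_primitive_part)
  have "content p0 \<noteq> 0" using p0(1) by simp
  have "curve_eval Y p0 = fps_of_poly (content p0) * curve_eval Y p"
    by (subst split) (simp only: ev.hom_mult curve_eval_const)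
  then have evp: "curve_eval Y p = 0"
    using p0(2) \<open>content p0 \<noteq> 0\<close> by simp
  have "p \<noteq> 0" using p0(1) by (simp add: p_def)
  have degp: "degree p = degree p0" by (simp add: p_def)
  obtain u r where ur: "pseudo_divmod f p = (u, r)" by (metis surj_pair)
  define a where "a = lead_coeff p ^ (Suc (degree f) - degree p)"
  have pd: "Polynomial.smult a f = p * u + r" "r = 0 \<or> degree r < degree p"
    using pseudo_divmod[OF \<open>p \<noteq> 0\<close> ur] by (simp_all add: a_def)
  have "curve_eval Y r = 0"
  proof -
    have "curve_eval Y ([:a:] * f) = curve_eval Y (p * u + r)" using pd(1) by simp
    then show ?thesis by (simp only: ev.hom_mult ev.hom_add evp Y mult_zero_left mult_zero_right add_0)
  qed
  have "r = 0"
  proof (rule ccontr)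
    assume "r \<noteq> 0"
    then have "degree p0 \<le> degree r" using least[of r] \<open>curve_eval Y r = 0\<close> by simp
    then show False using pd(2) \<open>r \<noteq> 0\<close> degp by simp
  qed
  then have pdvd: "p dvd Polynomial.smult a f" using pd(1) by simp
  have a_nz: "a \<noteq> 0" using \<open>p \<noteq> 0\<close> by (simp add: a_def)
  have cont: "content p = 1" using p0(1) by (simp add: p_def)
  have "p dvd f" by (rule primitive_dvd_cancel[OF cont a_nz pdvd])
  then obtain s where s: "f = p * s" by (rule dvdE)
  have "s \<noteq> 0"
  proof
    assume "s = 0"
    then have "f = 0" by (simp only: s mult_zero_right)
    then show False using f(2) by simp
  qed
  have "degree (coeff f j) \<le> d" for j
    using deg.wdeg_coeff[OF f(3), of j] by simp
  then have "degree (coeff p j) \<le> d" for j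
    by (intro degree_coeff_factor[OF \<open>s \<noteq> 0\<close>, of p d j]) (simp only: flip: s)
  moreover have "degree p < d" using least[of h] \<open>?P h\<close> h(1) degp by simp
  ultimately have "p = 0" using evp by (intro box)
  then show False using \<open>p \<noteq> 0\<close> by simp
qed

section \<open>Planes in the generic direction\<close>

text \<open>The value of \<open>G\<close> at P + x v + y e. Only the direction \<open>v\<close> may
  live in a larger ring, where it will be generic.\<close>

definition plane_poly ::
  "('k::comm_ring_1 \<Rightarrow> 'r::comm_ring_1) \<Rightarrow> (nat \<Rightarrow> 'k) \<Rightarrow> (nat \<Rightarrow> 'r) \<Rightarrow> (nat \<Rightarrow> 'k) \<Rightarrow> 'k mpoly \<Rightarrow> 'r poly poly" where
  "plane_poly c P v e G =
     meval (kconst \<circ> c) (\<lambda>i. [:[:c (P i), v i:], [:c (e i):]:]) G"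

lemma map_plane_poly:
  assumes "comm_ring_hom h"
  shows "map_poly (map_poly h) (plane_poly c P v e G) = plane_poly (h \<circ> c) P (h \<circ> v) e G"
proof -
  interpret h: comm_ring_hom h by fact
  have hh: "comm_ring_hom (map_poly (map_poly h))" by (intro map_poly_hom assms)
  have "map_poly (map_poly h) (kconst a) = kconst (h a)" for a
    by (intro poly_eqI) (simp add: kconst_def coeff_map_poly coeff_pCons split: nat.splits)
  moreover have "map_poly (map_poly h) [:[:a, b:], [:a':]:] = [:[:h a, h b:], [:h a':]:]" for a b a'
    by (intro poly_eqI) (simp add: coeff_map_poly coeff_pCons split: nat.splits)
  ultimately show ?thesis
    unfolding plane_poly_def comm_ring_hom.hom_meval[OF hh] by (simp add: o_def)
qed

lemma coeff_mult_top:
  fixes p q :: "'r::comm_ring_1 poly"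
  assumes "degree p \<le> a" "degree q \<le> b"
  shows "coeff (p * q) (a + b) = coeff p a * coeff q b"
proof -
  have "coeff (p * q) (a + b) = (\<Sum>i\<le>a + b. if i = a then coeff p a * coeff q b else 0)"
    unfolding coeff_mult
  proof (rule sum.cong[OF refl])
    fix i assume "i \<in> {..a + b}"
    show "coeff p i * coeff q (a + b - i) = (if i = a then coeff p a * coeff q b else 0)"
    proof (cases "i = a")
      case False
      then have "degree p < i \<or> degree q < a + b - i" using assms by linarith
      then show ?thesis using False by (auto simp: coeff_eq_0)
    qed simp
  qed
  then show ?thesis by simp
qed

text \<open>Because \<open>G\<close> is homogeneous, y^n can only come from the direction
  \<open>e\<close>. Once G(e) = 1, every plane section containing this direction is monic in
  y.\<close>

lemma plane_poly_top:
  fixes c :: "'k::comm_ring_1 \<Rightarrow> 'r::idom"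
  assumes "comm_ring_hom c" and hom: "\<And>m. m \<in> Poly_Mapping.keys G \<Longrightarrow> monom_deg m = n"
  shows "tdeg n (plane_poly c P v e G)"
    and "coeff (plane_poly c P v e G) n = [:c (meval (\<lambda>x. x) e G):]"
proof -
  interpret c: comm_ring_hom c by fact
  let ?s = "\<lambda>i. [:[:c (P i), v i:], [:c (e i):]:]" and ?t = "\<lambda>i. [:c (e i):]"
  \<comment> \<open>The weight bound and the top coefficient are carried together: the coefficient
    is multiplicative only in view of the bound.\<close>
  define top where "top = (\<lambda>n (p :: 'r poly poly) u. tdeg n p \<and> coeff p n = u)"
  have top_mult: "top (a + b) (p * q) (u * w)" if "top a p u" "top b q w" for a b p q u w
    using that by (auto simp: top_def deg.wdeg_mult deg.wdeg_degree intro!: coeff_mult_top)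
  have top_1: "top 0 1 1" by (simp add: top_def deg.wdeg_1)
  have top_s: "top 1 (?s i) (?t i)" for i
    unfolding top_def by (auto intro!: deg.wdegI simp: coeff_pCons split: nat.splits)
  have top_pow: "top k (?s i ^ k) (?t i ^ k)" for i k
    using top_mult[OF top_s] by (induction k) (simp_all add: top_1)
  have top_prod: "top (\<Sum>i\<in>A. f i) (\<Prod>i\<in>A. ?s i ^ f i) (\<Prod>i\<in>A. ?t i ^ f i)" if "finite A" for A f
    using that by induction (simp_all add: top_1 top_mult top_pow)
  have top_monom: "top (monom_deg m) (monom_eval ?s m) (monom_eval ?t m)" for m
    unfolding monom_deg_def monom_eval_def by (rule top_prod) simp
  have top_term: "top n (kconst (c a) * monom_eval ?s m) ([:c a:] * monom_eval ?t m)" if "m \<in> Poly_Mapping.keys G" for a m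
  proof -
    have "top 0 (kconst (c a)) [:c a:]" by (simp add: top_def kconst_def deg.wdeg_const)
    from top_mult[OF this top_monom[of m]] show ?thesis by (simp only: add_0 hom[OF that])
  qed
  have *: "tdeg n (kconst (c a) * monom_eval ?s m)"
      "coeff (kconst (c a) * monom_eval ?s m) n = [:c a:] * monom_eval ?t m" if "m \<in> Poly_Mapping.keys G" for a m
    using top_term[OF that, of a] by (simp_all only: top_def)
  show "tdeg n (plane_poly c P v e G)"
    unfolding plane_poly_def meval_def o_def by (intro deg.wdeg_sum *)
  have "coeff (plane_poly c P v e G) n = (\<Sum>m\<in>Poly_Mapping.keys G. [:c (Poly_Mapping.lookup G m):] * monom_eval ?t m)"
    unfolding plane_poly_def meval_def o_def coeff_sum by (intro sum.cong refl *)
  also have "\<dots> = meval (\<lambda>a. [:c a:]) (\<lambda>i. [:c (e i):]) G" by (simp only: meval_def)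
  also have "\<dots> = [:c (meval (\<lambda>x. x) e G):]"
  proof -
    have "comm_ring_hom (\<lambda>a. [:c a:])" using comp_hom[OF const_poly_hom assms(1)] by (simp add: o_def)
    from comm_ring_hom.hom_meval[OF this, of "\<lambda>x. x" e G] show ?thesis by (simp add: o_def)
  qed
  finally show "coeff (plane_poly c P v e G) n = [:c (meval (\<lambda>x. x) e G):]" .
qed

section \<open>Irreducible plane sections\<close>

lemma poly_hom_eqI:
  assumes "comm_ring_hom h1" "comm_ring_hom h2" "\<And>a. h1 [:a:] = h2 [:a:]" "h1 [:0, 1:] = h2 [:0, 1:]"
  shows "h1 p = h2 p"
proof -
  interpret h1: comm_ring_hom h1 by fact
  interpret h2: comm_ring_hom h2 by fact
  show ?thesis
  proof (induction p)
    case (pCons a p)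
    have "pCons a p = [:a:] + [:0, 1:] * p" by simp
    then show ?case by (simp only: h1.hom_add h2.hom_add h1.hom_mult h2.hom_mult assms(3,4) pCons.IH)
  qed simp
qed

lemma hom_apply_poly:
  assumes "comm_ring_hom h"
  shows "h (poly p a) = poly (map_poly h p) (h a)"
proof -
  interpret h: comm_ring_hom h by fact
  show ?thesis by simp
qed

lemma poly_eval_hom: "comm_ring_hom (\<lambda>p. poly p a)"
  by unfold_locales simp_all

section \<open>Power series whose n-th coefficient has degree at most n\<close>

context ring_filtration
begin

definition graded :: "'r fps \<Rightarrow> bool" where
  "graded u \<longleftrightarrow> (\<forall>n. fps_nth u n \<in> D n)"

lemma graded_mult:
  assumes "graded u" "graded v"
  shows "graded (u * v)"
  unfolding graded_def
proof
  fix n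
  have "fps_nth u i * fps_nth v (n - i) \<in> D n" if "i \<in> {0..n}" for i
    using mult_in[of "fps_nth u i" i "fps_nth v (n - i)" "n - i"] assms that by (simp add: graded_def)
  then show "fps_nth (u * v) n \<in> D n" unfolding fps_mult_nth by (rule sum_in)
qed

lemma graded_1: "graded 1"
  by (simp add: graded_def zero_in one_in)

lemma graded_power: "graded u \<Longrightarrow> graded (u ^ k)"
  by (induction k) (simp_all add: graded_mult graded_1)

lemma graded_X: "graded fps_X"
  by (auto simp: graded_def fps_X_def zero_in one_in)

lemma prod_in: "(\<And>i. i \<in> A \<Longrightarrow> g i \<in> D n) \<Longrightarrow> prod g A \<in> D (card A * n)"
  by (induction A rule: infinite_finite_induct) (auto simp: one_in intro!: mult_in)

end

text \<open>The index b enumerates the monomials x^(b div d) y^(b mod d) of a box, so that the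
  columns of a matrix can be numbered by naturals.\<close>

lemma box_coeff:
  fixes c :: "nat \<Rightarrow> 'r::comm_ring_1"
  assumes "0 < d"
  shows "coeff (coeff (\<Sum>b<d * n. kconst (c b) * xy (b div d) (b mod d)) i) j =
    (if i < d \<and> j < n then c (j * d + i) else 0)"
proof -
  have "coeff (coeff (\<Sum>b<d * n. kconst (c b) * xy (b div d) (b mod d)) i) j =
      (\<Sum>b<d * n. if b = j * d + i \<and> i < d then c b else 0)"
    unfolding coeff_sum
  proof (rule sum.cong[OF refl])
    fix b
    have "(j = b div d \<and> i = b mod d) \<longleftrightarrow> (b = j * d + i \<and> i < d)" using assms by auto
    then show "coeff (coeff (kconst (c b) * xy (b div d) (b mod d)) i) j = (if b = j * d + i \<and> i < d then c b else 0)"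
      by (simp add: kconst_def coeff_xy)
  qed
  also have "\<dots> = (if i < d \<and> j < n then c (j * d + i) else 0)"
  proof (cases "i < d")
    case True
    have "j * d + i < d * n \<longleftrightarrow> j < n"
    proof
      assume "j < n"
      then have "Suc j * d \<le> n * d" by (intro mult_le_mono1) simp
      then show "j * d + i < d * n" using True by (simp add: mult.commute)
    next
      assume "j * d + i < d * n"
      then have "j * d < n * d" unfolding mult.commute[of d n] by (rule le_less_trans[OF le_add1])
      then show "j < n" unfolding mult_less_cancel2 by blast
    qed
    then show ?thesis using True by simp
  qed simp
  finally show ?thesis .
qed

definition line_poly :: "(nat \<Rightarrow> 'k::comm_ring_1) \<Rightarrow> (nat \<Rightarrow> 'k) \<Rightarrow> 'k mpoly \<Rightarrow> 'k poly" where
  "line_poly P e G = meval (\<lambda>a. [:a:]) (\<lambda>i. [:P i, e i:]) G"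

text \<open>\<open>'e\<close> will be an iterated \<open>poly\<close> ring whose variables are the
  coordinates of the generic direction. Through \<psi> its elements are read as
  \<open>mpoly\<close>, where degrees and rational values are available.\<close>

locale generic_ring =
  fixes \<psi> :: "'e::idom \<Rightarrow> 'k::{field,factorial_ring_gcd,semiring_gcd_mult_normalize} mpoly" and N :: nat
  assumes nested: "nested \<psi> N"
begin

lemma psi_hom: "comm_ring_hom \<psi>" and psi_inj: "inj \<psi>" and psi_range: "range \<psi> = {p. mvars p \<subseteq> {..<N}}"
  using nested by (auto simp: nested_def)

sublocale psi: comm_ring_hom \<psi> by (rule psi_hom)

definition cE :: "'k \<Rightarrow> 'e" where "cE a = inv_into UNIV \<psi> (mconst a)"
text \<open>The default 0 from \<open>N\<close> on makes \<open>xE_in\<close> true for every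
  index.\<close>

definition xE :: "nat \<Rightarrow> 'e" where "xE i = (if i < N then inv_into UNIV \<psi> (mvar i) else 0)"

lemma psi_cE: "\<psi> (cE a) = mconst a"
  unfolding cE_def by (rule f_inv_into_f) (simp add: psi_range)

lemma psi_xE: "i < N \<Longrightarrow> \<psi> (xE i) = mvar i"
  unfolding xE_def using mvars_mvar[of i] by (auto intro!: f_inv_into_f simp: psi_range)

lemma cE_hom: "comm_ring_hom cE"
proof -
  interpret m: comm_ring_hom "mconst :: 'k \<Rightarrow> _" by (rule mconst_hom)
  show ?thesis
    by unfold_locales
       (auto intro!: injD[OF psi_inj] simp: psi_cE psi.hom_add psi.hom_mult m.hom_add m.hom_mult)
qed

sublocale cE: comm_ring_hom cE by (rule cE_hom)

lemma cE_eq_0: "cE a = 0 \<Longrightarrow> a = 0"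
proof -
  assume "cE a = 0"
  then have "mconst a = (0 :: 'k mpoly)" by (simp flip: psi_cE)
  then have "Poly_Mapping.lookup (mconst a) 0 = 0" by simp
  then show "a = 0" by (simp add: mconst_def)
qed

lemma mvars_psi: "mvars (\<psi> r) \<subseteq> {..<N}"
  using psi_range by auto

definition eh :: "('k \<Rightarrow> 's::comm_ring_1) \<Rightarrow> (nat \<Rightarrow> 's) \<Rightarrow> 'e \<Rightarrow> 's" where
  "eh c \<tau> r = meval c \<tau> (\<psi> r)"

lemma eh_hom: "comm_ring_hom c \<Longrightarrow> comm_ring_hom (eh c \<tau>)"
  using comp_hom[OF comm_ring_hom.meval_hom psi_hom, of c \<tau>] by (simp add: eh_def[abs_def] o_def)

lemma eh_cE: "c 0 = 0 \<Longrightarrow> eh c \<tau> (cE a) = c a"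
  by (simp add: eh_def psi_cE)

lemma eh_xE: "i < N \<Longrightarrow> c 0 = 0 \<Longrightarrow> c 1 = 1 \<Longrightarrow> eh c \<tau> (xE i) = \<tau> i"
  by (simp add: eh_def psi_xE)

lemma expand: "meval cE xE (\<psi> r) = r"
proof (rule injD[OF psi_inj])
  have "\<psi> (meval cE xE (\<psi> r)) = meval (\<psi> \<circ> cE) (\<psi> \<circ> xE) (\<psi> r)" by (rule psi.hom_meval)
  also have "\<dots> = meval mconst (\<psi> \<circ> xE) (\<psi> r)" by (simp add: o_def psi_cE)
  also have "\<dots> = meval mconst mvar (\<psi> r)"
    by (rule meval_cong) (use mvars_psi[of r] in \<open>auto simp: psi_xE\<close>)
  finally show "\<psi> (meval cE xE (\<psi> r)) = \<psi> r" by simp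
qed

lemma hom_eqI:
  assumes "comm_ring_hom h1" "comm_ring_hom h2" "\<And>a. h1 (cE a) = h2 (cE a)" "\<And>i. i < N \<Longrightarrow> h1 (xE i) = h2 (xE i)"
  shows "h1 r = h2 r"
proof -
  have "h1 r = meval (h1 \<circ> cE) (h1 \<circ> xE) (\<psi> r)"
    by (subst expand[symmetric]) (rule comm_ring_hom.hom_meval[OF assms(1)])
  also have "\<dots> = meval (h2 \<circ> cE) (h1 \<circ> xE) (\<psi> r)" using assms(3) by (simp add: o_def)
  also have "\<dots> = meval (h2 \<circ> cE) (h2 \<circ> xE) (\<psi> r)"
    by (rule meval_cong) (use mvars_psi[of r] assms(4) in auto)
  also have "\<dots> = h2 r"
    by (subst (2) expand[symmetric]) (rule comm_ring_hom.hom_meval[OF assms(2), symmetric])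
  finally show ?thesis .
qed

lemma const_cE_hom: "comm_ring_hom (\<lambda>a. [:cE a:])"
  using comp_hom[OF const_poly_hom cE_hom] by (simp add: o_def)

text \<open>At x = \<tau> the generic section is G(P + \<tau> X + y e), and since \<tau> is
  invertible the substitution X -> (X - P - y e)/\<tau> turns it into G(X). \<open>H\<close> is this
  specialisation followed by the substitution, and \<theta> undoes the substitution; thus primality
  of \<open>g\<close> is inherited by the section at x = \<tau>.\<close>

lemma plane_specialise:
  assumes "\<tau> \<noteq> 0" "\<psi> g = G"
  shows "\<exists>H :: 'e poly poly \<Rightarrow> 'e poly. \<exists>\<theta> :: 'e poly \<Rightarrow> 'e poly. comm_ring_hom H \<and> comm_ring_hom \<theta> \<and>
    H (plane_poly cE P xE e G) = [:g:] \<and> (\<forall>w. \<theta> (H w) = map_poly (\<lambda>p. poly p (cE \<tau>)) w)"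
proof -
  define b where "b = cE (inverse \<tau>)"
  have b: "b * cE \<tau> = 1" "cE \<tau> * b = 1" using assms(1) by (simp_all add: b_def flip: cE.hom_mult)
  have bz: "cE \<tau> * (b * z) = z" "b * (cE \<tau> * z) = z" "b * z * cE \<tau> = z" for z
  proof -
    show "cE \<tau> * (b * z) = z" "b * (cE \<tau> * z) = z" by (simp_all add: b flip: mult.assoc)
    then show "b * z * cE \<tau> = z" by (simp add: mult.commute)
  qed
  define \<eta> where "\<eta> = eh (\<lambda>a. [:cE a:]) (\<lambda>i. [:b * (xE i - cE (P i)), - (b * cE (e i)):])"
  define H where "H = lift_hom (lift_hom \<eta> [:cE \<tau>:]) [:0, 1:]"
  define \<eta>' where "\<eta>' = eh (\<lambda>a. [:cE a:]) (\<lambda>i. [:cE (P i) + cE \<tau> * xE i, cE (e i):])"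
  define \<theta> where "\<theta> = lift_hom \<eta>' [:0, 1:]"
  have \<eta>_hom: "comm_ring_hom \<eta>" unfolding \<eta>_def by (intro eh_hom const_cE_hom)
  have \<eta>'_hom: "comm_ring_hom \<eta>'" unfolding \<eta>'_def by (intro eh_hom const_cE_hom)
  have H1_hom: "comm_ring_hom (lift_hom \<eta> [:cE \<tau>:])" by (intro lift_hom_hom \<eta>_hom)
  have H_hom: "comm_ring_hom H" unfolding H_def by (intro lift_hom_hom H1_hom)
  have \<theta>_hom: "comm_ring_hom \<theta>" unfolding \<theta>_def by (intro lift_hom_hom \<eta>'_hom)
  interpret \<eta>: comm_ring_hom \<eta> by fact
  interpret \<eta>': comm_ring_hom \<eta>' by fact
  interpret H1: comm_ring_hom "lift_hom \<eta> [:cE \<tau>:]" by fact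
  interpret H: comm_ring_hom H by fact
  interpret \<theta>: comm_ring_hom \<theta> by fact
  have \<eta>_cE: "\<eta> (cE a) = [:cE a:]" for a by (simp add: \<eta>_def eh_cE)
  have \<eta>_xE: "\<eta> (xE i) = [:b * (xE i - cE (P i)), - (b * cE (e i)):]" if "i < N" for i
    using that by (simp add: \<eta>_def eh_xE one_pCons)
  have \<eta>'_cE: "\<eta>' (cE a) = [:cE a:]" for a by (simp add: \<eta>'_def eh_cE)
  have \<eta>'_xE: "\<eta>' (xE i) = [:cE (P i) + cE \<tau> * xE i, cE (e i):]" if "i < N" for i
    using that by (simp add: \<eta>'_def eh_xE one_pCons)
  have H_const: "H [:[:r:]:] = \<eta> r" for r
    unfolding H_def by (simp add: H1.hom_zero)
  have H_t: "H [:[:0, 1:]:] = [:cE \<tau>:]"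
    unfolding H_def by (simp add: H1.hom_zero)
  have H_y: "H [:0, 1:] = [:0, 1:]"
    unfolding H_def by (simp add: H1.hom_zero H1.hom_one)
  have \<theta>_const: "\<theta> [:r:] = \<eta>' r" for r
    unfolding \<theta>_def by simp
  have \<theta>_y: "\<theta> [:0, 1:] = [:0, 1:]"
    unfolding \<theta>_def by simp
  have H_sigma: "H [:[:cE (P i), xE i:], [:cE (e i):]:] = [:xE i:]" if "i < N" for i
  proof -
    have "[:[:cE (P i), xE i:], [:cE (e i):]:] = [:[:cE (P i):]:] + [:[:0, 1:]:] * [:[:xE i:]:] + [:0, 1:] * [:[:cE (e i):]:]"
      by simp
    then have "H [:[:cE (P i), xE i:], [:cE (e i):]:] =
        [:cE (P i):] + [:cE \<tau>:] * [:b * (xE i - cE (P i)), - (b * cE (e i)):] + [:0, 1:] * [:cE (e i):]"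
      by (simp only: H.hom_add H.hom_mult H_const H_t H_y \<eta>_cE \<eta>_xE[OF that])
    also have "\<dots> = [:xE i:]" by (simp add: b bz)
    finally show ?thesis .
  qed
  have "H (plane_poly cE P xE e G) = [:g:]"
  proof -
    have "H (plane_poly cE P xE e G) = meval (\<lambda>a. [:cE a:]) (\<lambda>i. H [:[:cE (P i), xE i:], [:cE (e i):]:]) G"
      unfolding plane_poly_def comm_ring_hom.hom_meval[OF H_hom]
      by (simp add: o_def kconst_def H_const \<eta>_cE)
    also have "\<dots> = meval (\<lambda>a. [:cE a:]) (\<lambda>i. [:xE i:]) G"
      by (rule meval_cong) (use mvars_psi[of g] assms(2) H_sigma in auto)
    also have "\<dots> = [:meval cE xE G:]"
      unfolding comm_ring_hom.hom_meval[OF const_poly_hom] by (simp add: o_def)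
    also have "meval cE xE G = g" using expand[of g] assms(2) by simp
    finally show ?thesis .
  qed
  moreover have "\<theta> (H w) = map_poly (\<lambda>p. poly p (cE \<tau>)) w" for w
  proof -
    let ?m = "map_poly (\<lambda>p. poly p (cE \<tau>))"
    have m_hom: "comm_ring_hom ?m" by (intro map_poly_hom poly_eval_hom)
    have m_const: "?m [:p:] = [:poly p (cE \<tau>):]" for p by (simp add: map_poly_simps)
    have comp: "comm_ring_hom (\<lambda>w. \<theta> (H w))" using comp_hom[OF \<theta>_hom H_hom] by (simp add: o_def)
    have constp: "comm_ring_hom (\<lambda>p :: 'e poly. [:p:])" by (rule const_poly_hom)
    show ?thesis
    proof (rule poly_hom_eqI[OF comp m_hom])
      show "\<theta> (H [:0, 1:]) = ?m [:0, 1:]" by (simp add: H_y \<theta>_y map_poly_pCons)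
      fix p :: "'e poly"
      show "\<theta> (H [:p:]) = ?m [:p:]"
      proof (rule poly_hom_eqI[of "\<lambda>p. \<theta> (H [:p:])" "\<lambda>p. ?m [:p:]"])
        show "comm_ring_hom (\<lambda>p. \<theta> (H [:p:]))" using comp_hom[OF comp constp] by (simp add: o_def)
        show "comm_ring_hom (\<lambda>p. ?m [:p:])" using comp_hom[OF m_hom constp] by (simp add: o_def)
        show "\<theta> (H [:[:0, 1:]:]) = ?m [:[:0, 1:]:]"
          by (simp add: H_t \<theta>_const \<eta>'_cE m_const)
        fix r :: 'e
        have "\<eta>' (b * (xE i - cE (P i))) + [:0, 1:] * \<eta>' (- (b * cE (e i))) = [:xE i:]" if "i < N" for i
        proof -
          have "\<eta>' (b * (xE i - cE (P i))) + [:0, 1:] * \<eta>' (- (b * cE (e i))) =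
            [:b:] * ([:cE (P i) + cE \<tau> * xE i, cE (e i):] - [:cE (P i):]) + [:0, 1:] * (- ([:b:] * [:cE (e i):]))"
            by (simp only: b_def \<eta>'.hom_mult \<eta>'.hom_minus \<eta>'.hom_uminus \<eta>'_cE \<eta>'_xE[OF that])
          also have "\<dots> = [:xE i:]" by (simp add: b bz)
          finally show ?thesis .
        qed
        then have x_case: "\<theta> (\<eta> (xE i)) = [:xE i:]" if "i < N" for i
        proof -
          have "\<eta> (xE i) = [:b * (xE i - cE (P i)):] + [:0, 1:] * [:- (b * cE (e i)):]"
            by (simp add: \<eta>_xE[OF that])
          then have "\<theta> (\<eta> (xE i)) = \<eta>' (b * (xE i - cE (P i))) + [:0, 1:] * \<eta>' (- (b * cE (e i)))"
            by (simp only: \<theta>.hom_add \<theta>.hom_mult \<theta>_const \<theta>_y)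
          then show ?thesis
            using \<open>\<And>i. i < N \<Longrightarrow> \<eta>' (b * (xE i - cE (P i))) + [:0, 1:] * \<eta>' (- (b * cE (e i))) = [:xE i:]\<close>[OF that]
            by (simp only:)
        qed
        have "\<theta> (\<eta> r) = [:r:]"
        proof (rule hom_eqI[of "\<lambda>r. \<theta> (\<eta> r)" "\<lambda>r. [:r:]"])
          show "comm_ring_hom (\<lambda>r. \<theta> (\<eta> r))" using comp_hom[OF \<theta>_hom \<eta>_hom] by (simp add: o_def)
          show "comm_ring_hom (\<lambda>r :: 'e. [:r:])" by (rule const_poly_hom)
        qed (simp_all add: \<eta>_cE \<theta>_const \<eta>'_cE x_case)
        then show "\<theta> (H [:[:r:]:]) = ?m [:[:r:]:]" by (simp add: H_const m_const)
      qed
    qed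
  qed
  ultimately show ?thesis using H_hom \<theta>_hom by blast
qed

text \<open>For each nonzero constant \<tau> the section at x = \<tau> is prime, so it divides
  \<open>w\<close> or \<open>h\<close> at x = \<tau>; its y-degree d then forces that factor to
  vanish there. One of \<open>w\<close>, \<open>h\<close> vanishes for infinitely many \<tau>, hence
  identically. Irreducibility is thus used only on the slices x = \<tau>.\<close>

lemma plane_domain:
  assumes inf: "infinite (UNIV :: 'k set)" and g: "prime_elem g" "\<psi> g = G"
    and f: "degree (plane_poly cE P xE e G) = d" "lead_coeff (plane_poly cE P xE e G) = 1"
    and wh: "degree w < d" "degree h < d" "plane_poly cE P xE e G dvd w * h"
  shows "w = 0 \<or> h = 0"
proof (rule ccontr)
  assume nz: "\<not> (w = 0 \<or> h = 0)"
  define f where "f = plane_poly cE P xE e G"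
  define m where "m = (\<lambda>\<tau>. map_poly (\<lambda>p. poly p (cE \<tau>)) :: 'e poly poly \<Rightarrow> 'e poly)"
  have m_zero: "m \<tau> u = 0" if "degree u < d" "m \<tau> f dvd m \<tau> u" for \<tau> u
  proof -
    have lc: "coeff (m \<tau> f) d = 1" using f by (simp add: m_def coeff_map_poly f_def)
    have "degree (m \<tau> f) \<le> d" using degree_map_poly_le[of _ f] f(1) by (simp add: m_def f_def)
    then have "degree (m \<tau> f) = d" using lc by (intro antisym le_degree) auto
    moreover have "degree (m \<tau> u) < d" using le_less_trans[OF degree_map_poly_le that(1)] by (simp add: m_def)
    ultimately show ?thesis using monic_dvd_degree_less[of "m \<tau> f" "m \<tau> u"] that(2) lc by simp
  qed
  have "m \<tau> w = 0 \<or> m \<tau> h = 0" if "\<tau> \<noteq> 0" for \<tau>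
  proof -
    from plane_specialise[OF that g(2), of P e]
    obtain H \<theta> where H: "comm_ring_hom H" "comm_ring_hom \<theta>" "H f = [:g:]" "\<And>u. \<theta> (H u) = m \<tau> u"
      unfolding f_def m_def by blast
    interpret H: comm_ring_hom H by fact
    interpret \<theta>: comm_ring_hom \<theta> by fact
    have "H f dvd H (w * h)" using wh(3) unfolding f_def[symmetric] by (rule H.hom_dvd)
    then have "[:g:] dvd H w * H h" by (simp only: H(3) H.hom_mult)
    moreover have "prime_elem [:g:]" using g(1) by (rule lift_prime_elem_poly)
    ultimately have "[:g:] dvd H w \<or> [:g:] dvd H h" by (simp only: prime_elem_dvd_mult_iff)
    then have "m \<tau> f dvd m \<tau> w \<or> m \<tau> f dvd m \<tau> h"
      using \<theta>.hom_dvd[of "[:g:]" "H w"] \<theta>.hom_dvd[of "[:g:]" "H h"] by (auto simp: H(4) simp flip: H(3))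
    then show ?thesis using m_zero wh(1,2) by blast
  qed
  moreover have "finite {\<tau>. m \<tau> u = 0}" if "u \<noteq> 0" for u
  proof -
    have i: "coeff u (degree u) \<noteq> 0" using that by simp
    define i where "i = degree u"
    note i = i[folded i_def]
    have "cE ` {\<tau>. m \<tau> u = 0} \<subseteq> {x. poly (coeff u i) x = 0}"
    proof
      fix x assume "x \<in> cE ` {\<tau>. m \<tau> u = 0}"
      then obtain \<tau> where \<tau>: "x = cE \<tau>" "m \<tau> u = 0" by auto
      have "coeff (m \<tau> u) i = poly (coeff u i) (cE \<tau>)" by (simp add: m_def coeff_map_poly)
      then show "x \<in> {x. poly (coeff u i) x = 0}" using \<tau> by simp
    qed
    then have "finite (cE ` {\<tau>. m \<tau> u = 0})" using poly_roots_finite[OF i] finite_subset by blast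
    moreover have "inj_on cE {\<tau>. m \<tau> u = 0}"
    proof (rule inj_onI)
      fix a b assume "cE a = cE b"
      then have "cE (a - b) = 0" by (simp add: cE.hom_minus)
      then show "a = b" using cE_eq_0 by fastforce
    qed
    ultimately show ?thesis by (rule finite_imageD)
  qed
  then have "finite ({\<tau>. m \<tau> w = 0} \<union> {\<tau>. m \<tau> h = 0} \<union> {0})" using nz by simp
  moreover have "UNIV \<subseteq> {\<tau>. m \<tau> w = 0} \<union> {\<tau>. m \<tau> h = 0} \<union> {0}"
    using calculation(1) by auto
  ultimately show False using inf finite_subset by blast
qed

end

section \<open>Change of coefficients for branches\<close>

definition fps_map :: "('r::comm_ring_1 \<Rightarrow> 's::comm_ring_1) \<Rightarrow> 'r fps \<Rightarrow> 's fps" where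
  "fps_map h u = Abs_fps (\<lambda>n. h (fps_nth u n))"

lemma fps_map_nth [simp]: "fps_nth (fps_map h u) n = h (fps_nth u n)"
  by (simp add: fps_map_def)

lemma fps_map_hom:
  assumes "comm_ring_hom h"
  shows "comm_ring_hom (fps_map h)"
proof -
  interpret h: comm_ring_hom h by fact
  show ?thesis
    by unfold_locales (auto intro!: fps_ext simp: h.hom_add fps_mult_nth h.hom_sum h.hom_mult)
qed

lemma curve_eval_map:
  fixes h :: "'r::idom \<Rightarrow> 's::idom"
  assumes "comm_ring_hom h"
  shows "curve_eval (fps_map h Y) (map_poly (map_poly h) p) = fps_map h (curve_eval Y p)"
proof -
  interpret h: comm_ring_hom h by fact
  have mm: "comm_ring_hom (map_poly (map_poly h))" by (intro map_poly_hom assms)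
  have fm: "comm_ring_hom (fps_map h)" by (rule fps_map_hom[OF assms])
  have c1: "comm_ring_hom (\<lambda>p. curve_eval (fps_map h Y) (map_poly (map_poly h) p))"
    using comp_hom[OF curve_eval_hom mm] by (simp add: o_def)
  have c2: "comm_ring_hom (\<lambda>p. fps_map h (curve_eval Y p))"
    using comp_hom[OF fm curve_eval_hom] by (simp add: o_def)
  have const: "map_poly (map_poly h) [:a:] = [:map_poly h a:]" for a by (simp add: map_poly_simps)
  have var: "map_poly (map_poly h) [:0, 1:] = [:0, 1:]"
    by (intro poly_eqI) (simp add: coeff_map_poly coeff_pCons split: nat.splits)
  show ?thesis
  proof (rule poly_hom_eqI[OF c1 c2])
    fix a
    have "fps_of_poly (map_poly h a) = fps_map h (fps_of_poly a)"
      by (intro fps_ext) (simp add: coeff_map_poly)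
    then show "curve_eval (fps_map h Y) (map_poly (map_poly h) [:a:]) = fps_map h (curve_eval Y [:a:])"
      by (simp only: const curve_eval_const)
    show "curve_eval (fps_map h Y) (map_poly (map_poly h) [:0, 1:]) = fps_map h (curve_eval Y [:0, 1:])"
      by (simp only: var) simp
  qed
qed

lemma map_poly_pderiv_hom:
  fixes h :: "'r::idom \<Rightarrow> 's::idom"
  assumes "comm_ring_hom h"
  shows "map_poly h (pderiv p) = pderiv (map_poly h p)"
proof -
  interpret h: comm_ring_hom h by fact
  show ?thesis
    by (intro poly_eqI) (simp add: coeff_map_poly coeff_pderiv h.hom_mult h.hom_add h.hom_of_nat)
qed

lemma fps_nth_0_hom: "comm_ring_hom (\<lambda>u :: 'r::comm_ring_1 fps. fps_nth u 0)"
  by unfold_locales simp_all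

lemma curve_eval_kconst:
  "curve_eval Y (kconst k * p) = fps_const k * curve_eval Y p"
proof -
  interpret ev: comm_ring_hom "curve_eval Y" by (rule curve_eval_hom)
  show ?thesis unfolding ev.hom_mult by (simp add: kconst_def fps_of_poly_const)
qed

lemma fps_nth_curve_eval_sum:
  "fps_nth (curve_eval Y (\<Sum>b\<in>A. kconst (c b) * p b)) r = (\<Sum>b\<in>A. fps_nth (curve_eval Y (p b)) r * c b)"
proof -
  interpret ev: comm_ring_hom "curve_eval Y" by (rule curve_eval_hom)
  show ?thesis unfolding ev.hom_sum fps_sum_nth curve_eval_kconst by (simp add: mult.commute)
qed

lemma curve_eval_xy:
  fixes Y :: "'k::idom fps"
  shows "curve_eval Y (xy i j) = fps_X ^ i * Y ^ j"
proof -
  interpret ev: comm_ring_hom "curve_eval Y" by (rule curve_eval_hom)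
  have "(xy i j :: 'k poly poly) = [:Polynomial.monom 1 i:] * [:0, 1:] ^ j"
    by (simp add: xy_def Polynomial.monom_altdef[of _ j])
  then have "curve_eval Y (xy i j) = curve_eval Y [:Polynomial.monom 1 i:] * curve_eval Y [:0, 1:] ^ j"
    by (simp only: ev.hom_mult ev.hom_power)
  then show ?thesis by (simp add: fps_of_poly_monom)
qed

section \<open>The branch on the generic plane and its specialisation\<close>

context generic_ring
begin

definition DE :: "nat \<Rightarrow> 'e set" where "DE n = {r. total_deg (\<psi> r) \<le> n}"

sublocale DE: ring_filtration DE
proof
  fix n m a b
  show "0 \<in> DE n" "1 \<in> DE n" by (simp_all add: DE_def)
  show "a \<in> DE n \<Longrightarrow> - a \<in> DE n" by (simp add: DE_def psi.hom_uminus)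
  show "a \<in> DE n \<Longrightarrow> b \<in> DE n \<Longrightarrow> a + b \<in> DE n" by (simp add: DE_def psi.hom_add total_deg_add_le)
  show "a \<in> DE m \<Longrightarrow> b \<in> DE n \<Longrightarrow> a * b \<in> DE (m + n)" by (simp add: DE_def psi.hom_mult total_deg_mult_le)
  show "m \<le> n \<Longrightarrow> DE m \<subseteq> DE n" by (auto simp: DE_def)
qed

lemma cE_in: "cE a \<in> DE n"
  by (simp add: DE_def psi_cE)

lemma xE_in: "xE i \<in> DE 1"
  using total_deg_mvar_le[of i] by (cases "i < N") (auto simp: DE_def psi_xE, simp add: xE_def)

text \<open>In P + x X + y e every coordinate of the generic direction X carries a factor x.\<close>

lemma plane_poly_graded: "coeff (coeff (plane_poly cE P xE e G) i) j \<in> DE j"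
proof -
  define gp where "gp = (\<lambda>p :: 'e poly poly. \<forall>i j. coeff (coeff p i) j \<in> DE j)"
  have gp_add: "gp (p + q)" if "gp p" "gp q" for p q using that by (simp add: gp_def DE.add_in)
  have gp_mult: "gp (p * q)" if "gp p" "gp q" for p q
    unfolding gp_def
  proof (intro allI)
    fix i j
    have "coeff (coeff p k) l * coeff (coeff q (i - k)) (j - l) \<in> DE j" if "l \<le> j" for k l
      using DE.mult_in[of "coeff (coeff p k) l" l "coeff (coeff q (i - k)) (j - l)" "j - l"]
        \<open>gp p\<close> \<open>gp q\<close> that by (simp add: gp_def)
    then show "coeff (coeff (p * q) i) j \<in> DE j"
      by (auto simp: coeff_mult coeff_sum intro!: DE.sum_in)
  qed
  have gp_const: "gp (kconst (cE a))" for a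
    by (auto simp: gp_def kconst_def coeff_pCons cE_in DE.zero_in split: nat.splits)
  have gp_0: "gp 0" by (simp add: gp_def DE.zero_in)
  have gp_1: "gp 1" using gp_const[of 1] by simp
  have gp_sigma: "gp [:[:cE (P i), xE i:], [:cE (e i):]:]" for i
    using xE_in[of i] by (auto simp: gp_def coeff_pCons cE_in DE.zero_in split: nat.splits)
  have gp_pow: "gp (p ^ k)" if "gp p" for p k using that by (induction k) (auto simp: gp_1 intro: gp_mult)
  have gp_prod: "gp (prod g A)" if "\<And>i. gp (g i)" for g and A :: "nat set"
    using that by (induction A rule: infinite_finite_induct) (auto simp: gp_1 intro: gp_mult)
  have gp_sum: "gp (sum g A)" if "\<And>i. gp (g i)" for g and A :: "(nat \<Rightarrow>\<^sub>0 nat) set"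
    using that by (induction A rule: infinite_finite_induct) (auto intro: gp_add simp: gp_0)
  have "gp (plane_poly cE P xE e G)"
    unfolding plane_poly_def meval_def monom_eval_def o_def
    by (intro gp_sum gp_mult gp_prod gp_pow gp_const gp_sigma)
  then show ?thesis by (simp add: gp_def)
qed

text \<open>At x = 0 the plane shrinks to the line P + y e, so all directions share the same
  starting root for the branch.\<close>

lemma plane_poly_at_0: "map_poly (\<lambda>p. coeff p 0) (plane_poly cE P v e G) = map_poly cE (line_poly P e G)"
proof -
  have "(\<lambda>p :: 'e poly. coeff p 0) = (\<lambda>p. poly p 0)" by (simp add: poly_0_coeff_0)
  then have h1: "comm_ring_hom (map_poly (\<lambda>p :: 'e poly. coeff p 0))"
    using map_poly_hom[OF poly_eval_hom[of "0 :: 'e"]] by simp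
  have h2: "comm_ring_hom (map_poly cE)" by (rule map_poly_hom[OF cE_hom])
  have "map_poly (\<lambda>p. coeff p 0) (kconst a) = [:a:]" for a :: 'e
    by (intro poly_eqI) (simp add: kconst_def coeff_map_poly coeff_pCons split: nat.splits)
  moreover have "map_poly (\<lambda>p. coeff p 0) [:[:a, b:], [:a':]:] = [:a, a':]" for a b a' :: 'e
    by (intro poly_eqI) (simp add: coeff_map_poly coeff_pCons split: nat.splits)
  moreover have "map_poly cE [:a:] = [:cE a:]" "map_poly cE [:a, b:] = [:cE a, cE b:]" for a b
    by (intro poly_eqI; simp add: coeff_map_poly coeff_pCons split: nat.splits)+
  ultimately show ?thesis
    unfolding plane_poly_def line_poly_def comm_ring_hom.hom_meval[OF h1] comm_ring_hom.hom_meval[OF h2]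
    by (simp add: o_def)
qed

theorem irreducible_plane_section:
  assumes inf: "infinite (UNIV :: 'k set)" and g: "prime_elem g" "\<psi> g = G"
    and hom: "\<And>m. m \<in> Poly_Mapping.keys G \<Longrightarrow> monom_deg m = d" and d: "0 < d"
    and e: "meval (\<lambda>x. x) e G = 1"
    and \<alpha>: "poly (line_poly P e G) \<alpha> = 0" "poly (pderiv (line_poly P e G)) \<alpha> \<noteq> 0"
    and S: "d * (d + 1) * (d * (3 * d - 2)) < card S"
  shows "\<exists>v Y. (\<forall>i. v i \<in> S) \<and> curve_eval Y (plane_poly (\<lambda>x. x) P v e G) = 0 \<and>
    (\<forall>h. degree h < d \<longrightarrow> curve_eval Y h = 0 \<longrightarrow> h = 0)"
proof -
  define f where "f = plane_poly cE P xE e G"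
  have f_tdeg: "tdeg d f" unfolding f_def by (rule plane_poly_top(1)[OF cE_hom]) (rule hom)
  have "coeff f d = [:cE (meval (\<lambda>x. x) e G):]"
    unfolding f_def by (rule plane_poly_top(2)[OF cE_hom]) (rule hom)
  then have f_lead: "coeff f d = 1" by (simp add: e one_pCons)
  have f_deg: "degree f = d"
    using deg.wdeg_degree[OF f_tdeg] f_lead by (intro antisym le_degree) auto
  have f_monic: "lead_coeff f = 1" using f_deg f_lead by simp
  have dom: "w = 0 \<or> h = 0" if "degree w < d" "degree h < d" "f dvd w * h" for w h
    using plane_domain[OF inf g] f_deg f_monic that unfolding f_def by simp
  define \<beta> where "\<beta> = poly (pderiv (line_poly P e G)) \<alpha>"
  define F where "F = map_poly fps_of_poly f"
  have F0: "map_poly (\<lambda>u. fps_nth u 0) F = map_poly cE (line_poly P e G)"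
  proof -
    have "map_poly (\<lambda>u. fps_nth u 0) F = map_poly (\<lambda>p. coeff p 0) f"
      unfolding F_def by (intro poly_eqI) (simp add: coeff_map_poly)
    then show ?thesis by (simp only: f_def plane_poly_at_0)
  qed
  have root: "fps_nth (poly F (fps_const (cE \<alpha>))) 0 = 0"
  proof -
    have "fps_nth (poly F (fps_const (cE \<alpha>))) 0 = poly (map_poly cE (line_poly P e G)) (cE \<alpha>)"
      unfolding hom_apply_poly[OF fps_nth_0_hom] F0 by simp
    also have "\<dots> = cE (poly (line_poly P e G) \<alpha>)" by (rule hom_apply_poly[OF cE_hom, symmetric])
    finally show ?thesis by (simp add: \<alpha>(1))
  qed
  have simple: "fps_nth (poly (pderiv F) (fps_const (cE \<alpha>))) 0 * cE (inverse \<beta>) = 1"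
  proof -
    have "fps_nth (poly (pderiv F) (fps_const (cE \<alpha>))) 0 = poly (pderiv (map_poly cE (line_poly P e G))) (cE \<alpha>)"
      unfolding hom_apply_poly[OF fps_nth_0_hom] map_poly_pderiv_hom[OF fps_nth_0_hom] F0 by simp
    also have "\<dots> = cE \<beta>"
      unfolding \<beta>_def map_poly_pderiv_hom[OF cE_hom, symmetric] by (rule hom_apply_poly[OF cE_hom, symmetric])
    finally show ?thesis using \<alpha>(2) by (simp add: \<beta>_def flip: cE.hom_mult)
  qed
  have Fin: "fps_nth (coeff F i) n \<in> DE n" for i n
    using plane_poly_graded[of P e G i n] by (simp add: F_def coeff_map_poly f_def)
  obtain Y where Y: "poly F Y = 0" "\<And>n. fps_nth Y n \<in> DE n"
    using fps_hensel[OF DE.ring_filtration_axioms Fin cE_in cE_in root simple] by blast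
  have Yf: "curve_eval Y f = 0" using Y(1) by (simp add: lift_hom_def F_def)
  \<comment> \<open>Columns are the monomials of the box restricted to the branch, rows are the
    coefficients of x^r. A kernel vector is a polynomial in the box vanishing on the branch.\<close>
  define M where "M = (\<lambda>r b. fps_nth (curve_eval Y (xy (b div d) (b mod d))) r)"
  have M_in: "M r b \<in> DE r" for r b
  proof -
    have "DE.graded (fps_X ^ (b div d) * Y ^ (b mod d))"
      using Y(2) by (intro DE.graded_mult DE.graded_power DE.graded_X) (simp add: DE.graded_def)
    then show ?thesis by (simp add: M_def curve_eval_xy DE.graded_def)
  qed
  \<comment> \<open>\<open>U\<close> is the number of monomials of x-degree at most d and y-degree
    below d. Such polynomials have total degree at most 2d - 1, so by
    \<open>curve_order_bound\<close> the rows 0, ..., \<open>R\<close> already detect them.\<close>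
  define U where "U = d * (d + 1)"
  define R where "R = d * (3 * d - 2)"
  have indep: "\<exists>r<R + 1. (\<Sum>b<U. M r b * c b) \<noteq> 0" if nz: "\<exists>b<U. c b \<noteq> 0" for c
  proof -
    define h where "h = (\<Sum>b<d * (d + 1). kconst (c b) * xy (b div d) (b mod d))"
    have h_coeff: "coeff (coeff h i) j = (if i < d \<and> j < d + 1 then c (j * d + i) else 0)" for i j
      unfolding h_def by (rule box_coeff[OF d])
    obtain b where b: "b < d * (d + 1)" "c b \<noteq> 0" using nz by (auto simp: U_def)
    have "b div d < d + 1" using b(1) by (simp add: less_mult_imp_div_less mult.commute)
    then have "coeff (coeff h (b mod d)) (b div d) = c b" using d by (simp add: h_coeff)
    then have "h \<noteq> 0" using b(2) by auto
    have hdeg: "degree h < d" using d by (intro degree_lessI) (auto simp: h_coeff intro!: poly_eqI)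
    have "tdeg (2 * d - 1) h"
    proof (rule deg.wdegI)
      fix i assume "coeff h i \<noteq> 0"
      then have "i < d" using hdeg le_degree by fastforce
      moreover have "degree (coeff h i) \<le> d" by (rule degree_le) (simp add: h_coeff)
      ultimately show "i \<le> 2 * d - 1 \<and> coeff h i \<in> {p. degree p \<le> 2 * d - 1 - i}" by auto
    qed
    from curve_order_bound[OF f_deg f_monic d f_tdeg dom Yf \<open>h \<noteq> 0\<close> hdeg this]
    obtain k where k: "k \<le> d * (2 * d - 1 + d - 1)" "fps_nth (curve_eval Y h) k \<noteq> 0" by blast
    have "2 * d - 1 + d - 1 = 3 * d - 2" using d by simp
    then have "k < R + 1" using k(1) by (simp add: R_def)
    moreover have "fps_nth (curve_eval Y h) k = (\<Sum>b<U. M k b * c b)"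
      unfolding h_def fps_nth_curve_eval_sum M_def U_def ..
    ultimately show ?thesis using k(2) by auto
  qed
  from nonzero_minor_exists[of U "R + 1" M, OF indep] obtain rs where
    rs: "length rs = U" "set rs \<subseteq> {..<R + 1}" "det (mat U U (\<lambda>(a, b). M (rs ! a) b)) \<noteq> 0" by blast
  \<comment> \<open>Each entry in a row r \<le> R has degree at most r in the direction, so the
    minor has degree at most U R, which is below \<open>card S\<close>.\<close>
  define \<Delta> where "\<Delta> = det (mat U U (\<lambda>(a, b). M (rs ! a) b))"
  have "\<Delta> \<in> DE (U * R)"
  proof -
    have "\<Delta> = (\<Sum>p | p permutes {0..<U}. of_int (sign p) * (\<Prod>i = 0..<U. M (rs ! i) (p i)))"
    proof -
      have "(\<Prod>i = 0..<U. mat U U (\<lambda>(a, b). M (rs ! a) b) $$ (i, p i)) = (\<Prod>i = 0..<U. M (rs ! i) (p i))"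
        if "p permutes {0..<U}" for p
        using permutes_in_image[OF that] by (intro prod.cong) auto
      then show ?thesis unfolding \<Delta>_def det_def by simp
    qed
    moreover have "of_int (sign p) * (\<Prod>i = 0..<U. M (rs ! i) (p i)) \<in> DE (U * R)" for p :: "nat \<Rightarrow> nat"
    proof -
      have "M (rs ! i) (p i) \<in> DE R" if "i \<in> {0..<U}" for i
      proof -
        have "rs ! i \<in> set rs" using rs(1) that by simp
        then have "rs ! i < R + 1" using subsetD[OF rs(2)] by simp
        then have "DE (rs ! i) \<subseteq> DE R" by (intro DE.mono) simp
        then show ?thesis using M_in[of "rs ! i" "p i"] by blast
      qed
      then have "(\<Prod>i = 0..<U. M (rs ! i) (p i)) \<in> DE (card {0..<U} * R)" by (rule DE.prod_in)
      then show ?thesis using DE.uminus_in by (auto simp: sign_def)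
    qed
    ultimately show ?thesis by (simp add: DE.sum_in)
  qed
  then have "total_deg (\<psi> \<Delta>) < card S" using S by (simp add: DE_def U_def R_def)
  moreover have "\<psi> \<Delta> \<noteq> 0"
    using rs(3) injD[OF psi_inj, of \<Delta> 0] by (auto simp: \<Delta>_def)
  ultimately obtain v where v: "\<forall>i. v i \<in> S" "meval (\<lambda>x. x) v (\<psi> \<Delta>) \<noteq> 0"
    using mpoly_nonzero_point by blast
  define \<epsilon> where "\<epsilon> = eh (\<lambda>x. x) v"
  have \<epsilon>_hom: "comm_ring_hom \<epsilon>" unfolding \<epsilon>_def by (intro eh_hom id_hom)
  interpret \<epsilon>: comm_ring_hom \<epsilon> by fact
  define fv where "fv = plane_poly (\<lambda>x. x) P v e G"
  define Yv where "Yv = fps_map \<epsilon> Y"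
  have fv: "map_poly (map_poly \<epsilon>) f = fv"
  proof -
    have \<epsilon>_cE: "\<epsilon> \<circ> cE = (\<lambda>x. x)" by (auto simp: \<epsilon>_def eh_cE)
    have "map_poly (map_poly \<epsilon>) f = plane_poly (\<lambda>x. x) P (\<epsilon> \<circ> xE) e G"
      unfolding f_def map_plane_poly[OF \<epsilon>_hom] \<epsilon>_cE ..
    also have "\<dots> = fv"
      unfolding fv_def plane_poly_def
      by (rule meval_cong) (use mvars_psi[of g] g(2) in \<open>auto simp: \<epsilon>_def eh_xE\<close>)
    finally show ?thesis .
  qed
  have Yfv: "curve_eval Yv fv = 0"
  proof -
    have "curve_eval Yv fv = fps_map \<epsilon> (curve_eval Y f)"
      unfolding Yv_def fv[symmetric] by (rule curve_eval_map[OF \<epsilon>_hom])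
    then show ?thesis using Yf comm_ring_hom.axioms(1)[OF fps_map_hom[OF \<epsilon>_hom]]
      by (simp add: fps_map_def fps_eq_iff)
  qed
  have fv_tdeg: "tdeg d fv" unfolding fv_def by (rule plane_poly_top(1)[OF id_hom]) (rule hom)
  have "coeff fv d = [:meval (\<lambda>x. x) e G:]"
    unfolding fv_def by (rule plane_poly_top(2)[OF id_hom]) (rule hom)
  then have fv_lead: "coeff fv d = 1" by (simp add: e one_pCons)
  have fv_deg: "degree fv = d"
    using deg.wdeg_degree[OF fv_tdeg] fv_lead by (intro antisym le_degree) auto
  have fv_monic: "lead_coeff fv = 1" using fv_deg fv_lead by simp
  \<comment> \<open>For the specialised branch the same minor takes the value \<Delta>(v), which is
    nonzero; so no nonzero polynomial of the box vanishes on it.\<close>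
  have box: "h = 0" if h: "degree h < d" "\<And>j. degree (coeff h j) \<le> d" "curve_eval Yv h = 0" for h
  proof -
    define c where "c = (\<lambda>b. coeff (coeff h (b mod d)) (b div d))"
    have h_eq: "h = (\<Sum>b<d * (d + 1). kconst (c b) * xy (b div d) (b mod d))"
    proof (intro poly_eqI)
      fix i j
      have "coeff (coeff h i) j = 0" if "\<not> (i < d \<and> j < d + 1)"
      proof (cases "i < d")
        case True
        then show ?thesis using h(2)[of i] that by (intro coeff_eq_0) simp
      next
        case False
        then show ?thesis using h(1) by (simp add: coeff_eq_0)
      qed
      then show "coeff (coeff h i) j = coeff (coeff (\<Sum>b<d * (d + 1). kconst (c b) * xy (b div d) (b mod d)) i) j"
        unfolding box_coeff[OF d] by (auto simp: c_def)
    qed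
    have Mv: "fps_nth (curve_eval Yv (xy (b div d) (b mod d))) r = \<epsilon> (M r b)" for r b
    proof -
      have "map_poly (map_poly \<epsilon>) (xy (b div d) (b mod d)) = xy (b div d) (b mod d)"
        by (intro poly_eqI) (simp add: coeff_map_poly coeff_xy)
      then have "curve_eval Yv (xy (b div d) (b mod d)) = fps_map \<epsilon> (curve_eval Y (xy (b div d) (b mod d)))"
        using curve_eval_map[OF \<epsilon>_hom, of Y "xy (b div d) (b mod d)"] by (simp add: Yv_def)
      then show ?thesis by (simp add: M_def)
    qed
    have zero: "(\<Sum>b<U. \<epsilon> (M r b) * c b) = 0" for r
    proof -
      have "fps_nth (curve_eval Yv h) r = (\<Sum>b<U. \<epsilon> (M r b) * c b)"
        unfolding U_def by (subst h_eq) (simp only: fps_nth_curve_eval_sum Mv)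
      then show ?thesis using h(3) by simp
    qed
    have "det (mat U U (\<lambda>(a, b). \<epsilon> (M (rs ! a) b))) \<noteq> 0"
    proof -
      have "mat U U (\<lambda>(a, b). \<epsilon> (M (rs ! a) b)) = map_mat \<epsilon> (mat U U (\<lambda>(a, b). M (rs ! a) b))"
        by (rule eq_matI) auto
      then have "det (mat U U (\<lambda>(a, b). \<epsilon> (M (rs ! a) b))) = \<epsilon> \<Delta>" by (simp add: \<Delta>_def)
      then show ?thesis using v(2) by (simp add: \<epsilon>_def eh_def)
    qed
    from trivial_kernel_of_det[OF this zero] have "c b = 0" if "b < U" for b using that by blast
    then show ?thesis by (subst h_eq) (simp add: U_def)
  qed
  have "h = 0" if "degree h < d" "curve_eval Yv h = 0" for h
    by (rule curve_kernel_trivial[OF fv_deg fv_monic fv_tdeg Yfv box that])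
  then show ?thesis using v(1) Yfv unfolding fv_def by blast
qed

end

section \<open>Finite fields\<close>

lemma poly_eqI_roots:
  fixes p r :: "'k::field poly"
  assumes "degree p \<le> n" "degree r \<le> n" "coeff p n = coeff r n" "finite S" "card S = n" "0 < n"
    and "\<And>c. c \<in> S \<Longrightarrow> poly p c = poly r c"
  shows "p = r"
proof (rule ccontr)
  assume "p \<noteq> r"
  then have nz: "p - r \<noteq> 0" by simp
  have "degree (p - r) \<le> n" using assms(1,2) by (rule degree_diff_le)
  moreover have "degree (p - r) \<noteq> n" using nz assms(3) by (metis coeff_diff diff_self leading_coeff_0_iff)
  ultimately have "degree (p - r) < n" by simp
  moreover have "card S \<le> card {x. poly (p - r) x = 0}"
    by (rule card_mono[OF poly_roots_finite[OF nz]]) (use assms(7) in auto)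
  ultimately show False using card_poly_roots_bound[OF nz] assms(5) by simp
qed

lemma prod_linear_factors:
  fixes S :: "'k::field set"
  assumes "finite S" "card S = q" "2 \<le> q" "\<And>c. c \<in> S \<Longrightarrow> c ^ q = c"
  shows "(\<Prod>c\<in>S. [:- c, 1:]) = Polynomial.monom 1 q - [:0, 1:]"
proof (rule poly_eqI_roots[of _ q _ S])
  have deg: "degree (\<Prod>c\<in>S. [:- c, 1:]) = q"
    using assms(2) by (subst degree_prod_sum_eq) auto
  then show "degree (\<Prod>c\<in>S. [:- c, 1:]) \<le> q" by simp
  show "degree (Polynomial.monom 1 q - [:0, 1 :: 'k:]) \<le> q"
    using assms(3) by (intro degree_diff_le) (auto simp: degree_monom_eq)
  have "lead_coeff (\<Prod>c\<in>S. [:- c, 1:]) = 1" by (simp add: lead_coeff_prod)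
  then have "coeff (\<Prod>c\<in>S. [:- c, 1:]) q = 1" by (simp add: deg)
  moreover have "coeff [:0, 1 :: 'k:] q = 0" using assms(3) by (intro coeff_eq_0) simp
  ultimately show "coeff (\<Prod>c\<in>S. [:- c, 1:]) q = coeff (Polynomial.monom 1 q - [:0, 1:]) q" by simp
  fix c assume c: "c \<in> S"
  then have "poly (\<Prod>c\<in>S. [:- c, 1:]) c = 0" using assms(1) by (auto simp: poly_prod)
  then show "poly (\<Prod>c\<in>S. [:- c, 1:]) c = poly (Polynomial.monom 1 q - [:0, 1:]) c"
    using assms(4)[OF c] by (simp add: poly_monom)
qed (use assms in auto)

text \<open>The polynomials \<open>(X + 1)\<^sup>q - (X + 1)\<close> and \<open>X\<^sup>q - X\<close> have the same roots and hence agree; if \<open>q\<close>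
  were \<open>nm\<close> with \<open>n\<close> a power of \<open>p\<close> and \<open>m > 1\<close> prime to \<open>p\<close>, then \<open>(X + 1)\<^sup>q = (X\<^sup>n + 1)\<^sup>m\<close> would contain
  the term \<open>m X\<^sup>n\<close>.\<close>

lemma card_finite_field: "\<exists>e. CARD('a::finite_field) = CHAR('a) ^ e"
proof -
  let ?q = "CARD('a)" and ?p = "CHAR('a)"
  have p: "prime ?p" by simp
  have q: "2 \<le> ?q"
  proof -
    have "card {0, 1 :: 'a} \<le> ?q" by (intro card_mono) auto
    then show ?thesis by simp
  qed
  have "[:1, 1 :: 'a:] ^ ?q - [:1, 1:] = Polynomial.monom 1 ?q - [:0, 1:]"
  proof (rule poly_eqI_roots[of _ ?q _ UNIV])
    have deg: "degree ([:1, 1 :: 'a:] ^ ?q) = ?q" by (simp add: degree_power_eq)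
    then show "degree ([:1, 1 :: 'a:] ^ ?q - [:1, 1:]) \<le> ?q"
      using q by (intro degree_diff_le) auto
    show "degree (Polynomial.monom 1 ?q - [:0, 1 :: 'a:]) \<le> ?q"
      using q by (intro degree_diff_le) (auto simp: degree_monom_eq)
    have "coeff ([:1, 1 :: 'a:] ^ ?q) ?q = 1"
      using lead_coeff_power[of "[:1, 1 :: 'a:]" ?q] by (simp add: deg)
    moreover have "coeff [:1, 1 :: 'a:] ?q = 0" "coeff [:0, 1 :: 'a:] ?q = 0"
      using q by (auto intro!: coeff_eq_0)
    ultimately show "coeff ([:1, 1 :: 'a:] ^ ?q - [:1, 1:]) ?q = coeff (Polynomial.monom 1 ?q - [:0, 1:]) ?q"
      by simp
    show "poly ([:1, 1 :: 'a:] ^ ?q - [:1, 1:]) c = poly (Polynomial.monom 1 ?q - [:0, 1:]) c" for c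
      by (simp add: poly_monom finite_field_power_card_eq_same)
  qed (use q in auto)
  then have "[:1, 1 :: 'a:] ^ ?q = Polynomial.monom 1 ?q + ([:1, 1:] - [:0, 1:])"
    by (simp only: algebra_simps)
  moreover have "[:1, 1 :: 'a:] - [:0, 1:] = 1" by (simp add: one_pCons)
  ultimately have id: "[:1, 1 :: 'a:] ^ ?q = Polynomial.monom 1 ?q + 1" by (simp only:)
  obtain e m where em: "?q = ?p ^ e * m" "\<not> ?p dvd m"
  proof (rule multiplicity_decompose'[of ?q ?p])
    show "?q \<noteq> 0" using q by simp
    show "\<not> is_unit ?p" using p by (metis not_prime_unit)
  qed
  let ?n = "?p ^ e"
  have n: "0 < ?n" using p by (simp add: prime_gt_0_nat)
  have "[:1, 1 :: 'a:] ^ ?n = Polynomial.monom 1 ?n + 1"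
  proof -
    have "[:1, 1 :: 'a:] = [:0, 1:] + 1" by (simp add: one_pCons)
    moreover have "([:0, 1 :: 'a:] + 1) ^ ?n = [:0, 1:] ^ ?n + 1 ^ ?n"
      by (rule freshmans_dream') simp_all
    ultimately show ?thesis by (simp add: Polynomial.monom_altdef)
  qed
  then have pw: "(Polynomial.monom (1 :: 'a) ?n + 1) ^ m = Polynomial.monom 1 (?n * m) + 1"
    using id by (simp add: em(1) power_mult)
  have "coeff ((Polynomial.monom (1 :: 'a) ?n + 1) ^ m) ?n = of_nat m"
  proof -
    have "(Polynomial.monom (1 :: 'a) ?n + 1) ^ m = (\<Sum>k\<le>m. Polynomial.monom (of_nat (m choose k)) (?n * k))"
      unfolding binomial_ring by (intro sum.cong refl) (simp add: monom_power of_nat_poly smult_monom)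
    then have "coeff ((Polynomial.monom (1 :: 'a) ?n + 1) ^ m) ?n = (\<Sum>k\<le>m. if k = 1 then of_nat (m choose k) else 0)"
      using n by (simp add: coeff_sum)
    then show ?thesis by (cases m) (auto simp: em)
  qed
  moreover have "coeff (Polynomial.monom (1 :: 'a) (?n * m) + 1) ?n = (if m = 1 then 1 else 0)"
    using n by (simp add: coeff_1)
  ultimately have "m = 1"
    using pw em(2) of_nat_eq_0_iff_char_dvd[of m, where ?'a = 'a] by (metis zero_neq_one)
  then show ?thesis using em(1) by auto
qed

section \<open>Directions with a simple root\<close>

text \<open>Substituting elements of degree one for the variables does not raise the degree,
  whichever filtration measures it; the degree bounds for lines, shifts and dehomogenisation are
  instances.\<close>

lemma meval_filtration:
  assumes "ring_filtration D" "\<And>a. c a \<in> D 0" "\<And>i. \<sigma> i \<in> D 1"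
  shows "meval c \<sigma> p \<in> D (total_deg p)"
proof -
  interpret ring_filtration D by fact
  have pow: "\<sigma> i ^ k \<in> D k" for i k
    using mult_in[OF assms(3)] by (induction k) (auto simp: one_in)
  have prod: "(\<Prod>i\<in>A. \<sigma> i ^ g i) \<in> D (sum g A)" if "finite A" for A g
    using that by induction (auto simp: one_in intro!: mult_in pow)
  have "c (Poly_Mapping.lookup p m) * monom_eval \<sigma> m \<in> D (total_deg p)" if "m \<in> Poly_Mapping.keys p" for m
  proof -
    have "c (Poly_Mapping.lookup p m) * monom_eval \<sigma> m \<in> D (0 + monom_deg m)"
      unfolding monom_eval_def monom_deg_def by (intro mult_in assms prod) simp
    then show ?thesis using mono[OF monom_deg_le_total_deg[OF that]] by auto
  qed
  then show ?thesis unfolding meval_def by (rule sum_in)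
qed

lemma total_deg_filtration: "ring_filtration (\<lambda>n. {p :: 'k::comm_ring_1 mpoly. total_deg p \<le> n})"
  by unfold_locales (auto simp: total_deg_add_le total_deg_mult_le)

lemma total_deg_coeff_filtration:
  "ring_filtration (\<lambda>n. {p :: 'k::comm_ring_1 mpoly poly. \<forall>k. total_deg (coeff p k) \<le> n})"
proof
  fix m n and a b :: "'k mpoly poly"
  assume ab: "a \<in> {p. \<forall>k. total_deg (coeff p k) \<le> m}" "b \<in> {p. \<forall>k. total_deg (coeff p k) \<le> n}"
  then show "a * b \<in> {p. \<forall>k. total_deg (coeff p k) \<le> m + n}"
    by (auto simp: coeff_mult intro!: total_deg_sum_le total_deg_mult_le)
qed (auto simp: total_deg_add_le coeff_1 intro: order_trans)

lemma CHAR_mpoly: "CHAR('k::comm_ring_1 mpoly) = CHAR('k)"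
proof (rule CHAR_eqI)
  have *: "of_nat n = (0 :: 'k mpoly) \<longleftrightarrow> of_nat n = (0 :: 'k)" for n
  proof -
    have "of_nat n = (Poly_Mapping.single 0 (of_nat n) :: 'k mpoly)" by (simp add: single_of_nat)
    moreover have "Poly_Mapping.single 0 (of_nat n) = (0 :: 'k mpoly) \<longleftrightarrow> of_nat n = (0 :: 'k)"
      by (metis lookup_single_eq lookup_zero single_zero)
    ultimately show ?thesis by simp
  qed
  show "of_nat CHAR('k) = (0 :: 'k mpoly)" by (simp add: *)
  show "CHAR('k) dvd n" if "of_nat n = (0 :: 'k mpoly)" for n
    using that by (simp add: * of_nat_eq_0_iff_char_dvd)
qed

lemma single_power:
  "(Poly_Mapping.single m b :: 'k::comm_ring_1 mpoly) ^ k =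
    Poly_Mapping.single (Poly_Mapping.map ((*) k) m) (b ^ k)"
proof (induction k)
  case 0
  have "Poly_Mapping.map ((*) 0) m = 0" by (rule poly_mapping_eqI) (simp add: map.rep_eq when_def)
  then show ?case by (simp only: power_0 single_one)
next
  case (Suc k)
  have "m + Poly_Mapping.map ((*) k) m = Poly_Mapping.map ((*) (Suc k)) m"
    by (rule poly_mapping_eqI) (simp add: map.rep_eq when_def lookup_add)
  then show ?case by (simp only: power_Suc Suc.IH mult_single)
qed

text \<open>If p divided all exponents, \<open>G\<close> would be the p-th power of the polynomial
  \<open>H\<close> formed from p-th roots of the coefficients. The exponent found here yields a
  nonzero partial derivative.\<close>

lemma irreducible_exponent_not_divisible:
  fixes G :: "'k::field mpoly"
  assumes "irreducible G" "prime CHAR('k)" "\<And>a :: 'k. \<exists>b. b ^ CHAR('k) = a"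
  shows "\<exists>m\<in>Poly_Mapping.keys G. \<exists>i. \<not> CHAR('k) dvd Poly_Mapping.lookup m i"
proof (rule ccontr)
  let ?p = "CHAR('k)"
  assume "\<not> ?thesis"
  then have div: "?p dvd Poly_Mapping.lookup m i" if "m \<in> Poly_Mapping.keys G" for m i using that by auto
  have "\<forall>a :: 'k. \<exists>b. b ^ ?p = a" using assms(3) by blast
  from choice[OF this] obtain \<rho> where \<rho>: "\<And>a :: 'k. \<rho> a ^ ?p = a" by blast
  define H where "H = (\<Sum>m\<in>Poly_Mapping.keys G.
      Poly_Mapping.single (Poly_Mapping.map (\<lambda>k. k div ?p) m) (\<rho> (Poly_Mapping.lookup G m)))"
  have "H ^ ?p = (\<Sum>m\<in>Poly_Mapping.keys G.
      Poly_Mapping.single (Poly_Mapping.map (\<lambda>k. k div ?p) m) (\<rho> (Poly_Mapping.lookup G m)) ^ ?p)"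
    unfolding H_def by (rule freshmans_dream_sum) (simp_all add: CHAR_mpoly assms(2))
  also have "\<dots> = (\<Sum>m\<in>Poly_Mapping.keys G. Poly_Mapping.single m (Poly_Mapping.lookup G m))"
  proof (rule sum.cong[OF refl])
    fix m assume m: "m \<in> Poly_Mapping.keys G"
    have "Poly_Mapping.map ((*) ?p) (Poly_Mapping.map (\<lambda>k. k div ?p) m) = m"
    proof (rule poly_mapping_eqI)
      fix k
      have "?p * (Poly_Mapping.lookup m k div ?p) = Poly_Mapping.lookup m k" using div[OF m] by simp
      then show "Poly_Mapping.lookup (Poly_Mapping.map ((*) ?p) (Poly_Mapping.map (\<lambda>k. k div ?p) m)) k =
          Poly_Mapping.lookup m k"
        by (cases "Poly_Mapping.lookup m k div ?p = 0") (auto simp: map.rep_eq when_def)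
    qed
    then show "Poly_Mapping.single (Poly_Mapping.map (\<lambda>k. k div ?p) m) (\<rho> (Poly_Mapping.lookup G m)) ^ ?p =
        Poly_Mapping.single m (Poly_Mapping.lookup G m)"
      by (simp add: single_power \<rho>)
  qed
  also have "\<dots> = G" by (rule mpoly_expand[symmetric])
  finally have G: "G = H ^ ?p" by simp
  have p2: "2 \<le> ?p" using assms(2) by (rule prime_ge_2_nat)
  then obtain k where k: "?p = Suc (Suc k)" by (metis add_2_eq_Suc le_Suc_ex)
  have "G = H * H ^ Suc k" by (simp add: G k)
  then have "H dvd 1 \<or> H ^ Suc k dvd 1" by (rule irreducibleD[OF assms(1)])
  moreover have "H dvd H ^ Suc k" by simp
  ultimately have "H dvd 1" by (auto dest: dvd_trans)
  then have "G dvd 1" unfolding G by (metis dvd_power_same power_one)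
  then show False using assms(1) by (auto simp: irreducible_def)
qed

lemma coeff_1_conv_pderiv: "coeff p 1 = poly (pderiv p) (0 :: 'r::idom)"
  by (simp add: poly_0_coeff_0 coeff_pderiv)

lemma coeff_var_poly_nonzero:
  assumes "m \<in> Poly_Mapping.keys G"
  shows "coeff (var_poly i G) (Poly_Mapping.lookup m i) \<noteq> 0"
proof -
  let ?k = "Poly_Mapping.lookup m i" and ?e = "\<lambda>m. m - Poly_Mapping.single i (Poly_Mapping.lookup m i)"
  have inj: "m' = m" if "Poly_Mapping.lookup m' i = ?k" "m' - Poly_Mapping.single i ?k = ?e m" for m'
  proof (rule poly_mapping_eqI)
    fix j
    have "Poly_Mapping.lookup (m' - Poly_Mapping.single i ?k) j = Poly_Mapping.lookup (?e m) j"
      using that(2) by simp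
    then show "Poly_Mapping.lookup m' j = Poly_Mapping.lookup m j"
      using that(1) by (cases "j = i") (auto simp: lookup_minus lookup_single when_def)
  qed
  have "Poly_Mapping.lookup (coeff (var_poly i G) ?k) (?e m) =
      (\<Sum>m'\<in>{m'\<in>Poly_Mapping.keys G. Poly_Mapping.lookup m' i = ?k}. if m' = m then Poly_Mapping.lookup G m else 0)"
    unfolding coeff_var_poly lookup_sum lookup_single when_def
    by (intro sum.cong refl) (use inj in auto)
  also have "\<dots> = Poly_Mapping.lookup G m" using assms by (simp add: sum.delta)
  also have "\<dots> \<noteq> 0" using assms by (simp add: in_keys_iff)
  finally show ?thesis by auto
qed

text \<open>The coefficient of \<open>t\<close> in \<open>G(X + t e\<^sub>i)\<close> is the partial derivative of \<open>G\<close>.\<close>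

lemma partial_derivative_nonzero:
  fixes G :: "'k::field mpoly"
  assumes "m \<in> Poly_Mapping.keys G" "\<not> CHAR('k) dvd Poly_Mapping.lookup m i"
  shows "coeff (meval (\<lambda>a. [:mconst a:]) (\<lambda>j. [:mvar j, if j = i then 1 else 0:]) G) 1 \<noteq> 0"
proof -
  define v where "v = var_poly i G"
  interpret vp: comm_ring_hom "var_poly i :: 'k mpoly \<Rightarrow> _" by (rule var_poly_hom)
  let ?r = "[:mvar i, 1 :: 'k mpoly:]"
  define sh where "sh = lift_hom (\<lambda>a :: 'k mpoly. [:a:]) ?r"
  have sh_hom: "comm_ring_hom sh" unfolding sh_def by (intro lift_hom_hom const_poly_hom)
  have sh_p: "sh p = pcompose p ?r" for p
    unfolding sh_def lift_hom_def pcompose_altdef ..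
  have "meval (\<lambda>a. [:mconst a:]) (\<lambda>j. [:mvar j, if j = i then 1 else 0:]) G = sh v"
    unfolding v_def var_poly_def comm_ring_hom.hom_meval[OF sh_hom]
    by (intro arg_cong2[of _ _ _ _ "\<lambda>c \<sigma>. meval c \<sigma> G"] ext) (auto simp: sh_def)
  then have c1: "coeff (meval (\<lambda>a. [:mconst a:]) (\<lambda>j. [:mvar j, if j = i then 1 else 0:]) G) 1 = poly (pderiv v) (mvar i)"
    by (simp add: sh_p coeff_1_conv_pderiv[unfolded One_nat_def] pderiv_pcompose poly_pcompose pderiv_pCons)
  define w where "w = pderiv v"
  have free: "var_poly i (coeff w k) = [:coeff w k:]" for k
  proof -
    have "var_poly i (coeff v (Suc k)) = [:coeff v (Suc k):]"
      unfolding v_def by (rule var_poly_free) (use mvars_coeff_var_poly[of i G "Suc k"] in auto)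
    then show ?thesis
      unfolding w_def coeff_pderiv vp.hom_mult vp.hom_of_nat by (simp add: of_nat_poly)
  qed
  have "var_poly i (poly p (mvar i)) = p" if "\<And>k. var_poly i (coeff p k) = [:coeff p k:]" for p :: "'k mpoly poly"
    using that
  proof (induction p)
    case (pCons a p)
    have "var_poly i (coeff p k) = [:coeff p k:]" for k using pCons.prems[of "Suc k"] by simp
    then have IH: "var_poly i (poly p (mvar i)) = p" by (rule pCons.IH)
    have "var_poly i a = [:a:]" using pCons.prems[of 0] by simp
    then show ?case by (simp add: vp.hom_add vp.hom_mult IH var_poly_mvar)
  qed simp
  from this[OF free] have w: "poly w (mvar i) = 0 \<Longrightarrow> w = 0" by (metis vp.hom_zero)
  obtain k where k: "Poly_Mapping.lookup m i = Suc k" using assms(2) by (cases "Poly_Mapping.lookup m i") auto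
  have "coeff w k = of_nat (Suc k) * coeff v (Suc k)" by (simp only: w_def coeff_pderiv)
  moreover have "coeff v (Suc k) \<noteq> 0" using coeff_var_poly_nonzero[OF assms(1), of i] by (simp only: k v_def) simp
  moreover have "of_nat (Suc k) \<noteq> (0 :: 'k mpoly)"
    using assms(2) by (simp only: of_nat_eq_0_iff_char_dvd CHAR_mpoly k) simp
  ultimately have "coeff w k \<noteq> 0" by (simp only: mult_eq_0_iff) simp
  then have "w \<noteq> 0" by auto
  then show ?thesis using w unfolding c1 w_def by blast
qed

text \<open>One polynomial \<open>Q\<close> of degree at most 2d + 2, d the total degree of
  \<open>G\<close>, in the coordinates of P and e collects all conditions. The last two let the
  hyperplanes X_0 = 0 and X_1 = X_4 be solved for y on every plane P + x v + y e, so that each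
  becomes a graph over the x-axis.\<close>

lemma direction_exists:
  fixes G :: "'k::field mpoly"
  assumes "G \<noteq> 0" "m \<in> Poly_Mapping.keys G" "\<not> CHAR('k) dvd Poly_Mapping.lookup m i0"
    and "2 * total_deg G + 2 < card S"
  shows "\<exists>e P. (\<forall>i. e i \<in> S) \<and> (\<forall>i. P i \<in> S) \<and> meval (\<lambda>x. x) e G \<noteq> 0 \<and>
    coeff (line_poly P e G) 1 \<noteq> 0 \<and> e 0 \<noteq> 0 \<and> e 1 \<noteq> e (4 :: nat)"
proof -
  let ?d = "total_deg G"
  obtain K where K: "mvars G \<subseteq> {..<K}" "4 < K"
  proof -
    obtain b where "\<forall>x\<in>mvars G. x < b" using finite_nat_set_iff_bounded[of "mvars G"] by auto
    then show ?thesis by (intro that[of "b + 5"]) auto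
  qed
  \<comment> \<open>The variables below \<open>K\<close> stand for the coordinates of P, those from
    \<open>K\<close> on for the coordinates of e.\<close>
  define G2 where "G2 = meval mconst (\<lambda>i. mvar (i + K)) G"
  define L2 where "L2 = meval (\<lambda>a. [:mconst a:]) (\<lambda>i. [:mvar i, mvar (i + K):]) G"
  define Q where "Q = G2 * coeff L2 1 * mvar K * (mvar (1 + K) - mvar (4 + K))"
  have mc: "mconst (0::'k) = 0" "mconst (1::'k) = 1" by (simp_all add: mconst_def)
  have "G2 \<noteq> 0"
  proof
    assume "G2 = 0"
    have h: "comm_ring_hom (meval mconst (\<lambda>j. mvar (j - K) :: 'k mpoly))"
      by (intro comm_ring_hom.meval_hom mconst_hom)
    interpret h: comm_ring_hom "meval mconst (\<lambda>j. mvar (j - K) :: 'k mpoly)" by (rule h)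
    have "meval mconst (\<lambda>j. mvar (j - K)) G2 = meval mconst mvar G"
      unfolding G2_def comm_ring_hom.hom_meval[OF h]
      by (intro arg_cong2[of _ _ _ _ "\<lambda>c \<sigma>. meval c \<sigma> G"] ext) (auto simp: mc)
    then show False using assms(1) \<open>G2 = 0\<close> by (simp add: h.hom_zero)
  qed
  moreover have "coeff L2 1 \<noteq> 0"
  proof
    assume z: "coeff L2 1 = 0"
    \<comment> \<open>Setting e to the unit vector \<open>i0\<close> turns the coefficient of t into
      the partial derivative with respect to X_i0.\<close>
    define \<tau> where "\<tau> = (\<lambda>j. if j < K then mvar j else if j = i0 + K then 1 else (0 :: 'k mpoly))"
    have h: "comm_ring_hom (meval mconst \<tau>)" by (intro comm_ring_hom.meval_hom mconst_hom)
    interpret h: comm_ring_hom "meval mconst \<tau>" by fact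
    have "map_poly (meval mconst \<tau>) L2 = meval (\<lambda>a. [:mconst a:]) (\<lambda>j. [:meval mconst \<tau> (mvar j), meval mconst \<tau> (mvar (j + K)):]) G"
      unfolding L2_def comm_ring_hom.hom_meval[OF map_poly_hom[OF h]]
      by (intro arg_cong2[of _ _ _ _ "\<lambda>c \<sigma>. meval c \<sigma> G"] ext) (auto simp: mc h.map_poly_pCons_hom)
    also have "\<dots> = meval (\<lambda>a. [:mconst a:]) (\<lambda>j. [:mvar j, if j = i0 then 1 else 0:]) G"
      by (rule meval_cong) (use K(1) in \<open>auto simp: mc \<tau>_def\<close>)
    finally have "coeff (map_poly (meval mconst \<tau>) L2) 1 \<noteq> 0"
      using partial_derivative_nonzero[OF assms(2,3)] by simp
    then show False using z by (simp add: h.coeff_map_poly_hom)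
  qed
  moreover have mv: "mvar i \<noteq> (0 :: 'k mpoly)" for i
    by (metis lookup_single_eq lookup_zero mvar_def zero_neq_one)
  moreover have "mvar (1 + K) - mvar (4 + K) \<noteq> (0 :: 'k mpoly)"
  proof
    assume "mvar (1 + K) - mvar (4 + K) = (0 :: 'k mpoly)"
    then have "Poly_Mapping.lookup (mvar (1 + K) :: 'k mpoly) (Poly_Mapping.single (1 + K) 1) =
        Poly_Mapping.lookup (mvar (4 + K) :: 'k mpoly) (Poly_Mapping.single (1 + K) 1)" by simp
    moreover have "Poly_Mapping.single (4 + K) (1 :: nat) \<noteq> Poly_Mapping.single (1 + K) 1"
    proof
      assume "Poly_Mapping.single (4 + K) (1 :: nat) = Poly_Mapping.single (1 + K) 1"
      then have "Poly_Mapping.lookup (Poly_Mapping.single (4 + K) (1 :: nat)) (4 + K) =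
          Poly_Mapping.lookup (Poly_Mapping.single (1 + K) 1) (4 + K)" by simp
      then show False by (simp add: lookup_single)
    qed
    ultimately show False by (simp add: mvar_def lookup_single)
  qed
  ultimately have "Q \<noteq> 0" by (simp add: Q_def)
  moreover have "total_deg Q < card S"
  proof -
    have "G2 \<in> {p. total_deg p \<le> ?d}"
      unfolding G2_def by (rule meval_filtration[OF total_deg_filtration])
        (auto intro: total_deg_mvar_le[simplified])
    then have 1: "total_deg G2 \<le> ?d" by simp
    have "L2 \<in> {p. \<forall>k. total_deg (coeff p k) \<le> ?d}"
      unfolding L2_def
    proof (rule meval_filtration[OF total_deg_coeff_filtration])
      show "[:mvar i, mvar (i + K):] \<in> {p. \<forall>k. total_deg (coeff p k :: 'k mpoly) \<le> 1}" for i
        using total_deg_mvar_le[of i] total_deg_mvar_le[of "i + K"]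
        by (auto simp: coeff_pCons split: nat.splits)
      show "[:mconst a:] \<in> {p. \<forall>k. total_deg (coeff p k :: 'k mpoly) \<le> 0}" for a
        by (auto simp: coeff_pCons split: nat.splits)
    qed
    then have 2: "total_deg (coeff L2 1) \<le> ?d" by simp
    have 3: "total_deg (mvar (1 + K) - mvar (4 + K) :: 'k mpoly) \<le> 1"
      by (intro total_deg_diff_le total_deg_mvar_le)
    have "total_deg Q \<le> ?d + ?d + 1 + 1"
      unfolding Q_def by (intro total_deg_mult_le 1 2 3 total_deg_mvar_le)
    then show ?thesis using assms(4) by simp
  qed
  ultimately obtain \<sigma> where \<sigma>: "\<forall>i. \<sigma> i \<in> S" "meval (\<lambda>x. x) \<sigma> Q \<noteq> 0"
    using mpoly_nonzero_point by blast
  interpret \<sigma>: comm_ring_hom "meval (\<lambda>x. x) \<sigma> :: 'k mpoly \<Rightarrow> _" by (intro comm_ring_hom.meval_hom id_hom)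
  define e where "e = (\<lambda>i. \<sigma> (i + K))"
  have nz: "meval (\<lambda>x. x) \<sigma> G2 \<noteq> 0" "meval (\<lambda>x. x) \<sigma> (coeff L2 1) \<noteq> 0" "\<sigma> K \<noteq> 0" "\<sigma> (1 + K) \<noteq> \<sigma> (4 + K)"
    using \<sigma>(2) unfolding Q_def \<sigma>.hom_mult \<sigma>.hom_minus by auto
  have "meval (\<lambda>x. x) \<sigma> G2 = meval (\<lambda>x. x) e G"
    unfolding G2_def \<sigma>.hom_meval
    by (intro arg_cong2[of _ _ _ _ "\<lambda>c \<sigma>. meval c \<sigma> G"] ext) (auto simp: e_def)
  moreover have "map_poly (meval (\<lambda>x. x) \<sigma>) L2 = line_poly \<sigma> e G"
    unfolding L2_def line_poly_def comm_ring_hom.hom_meval[OF map_poly_hom[OF \<sigma>.comm_ring_hom_axioms]]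
    by (intro arg_cong2[of _ _ _ _ "\<lambda>c \<sigma>. meval c \<sigma> G"] ext) (auto simp: e_def \<sigma>.map_poly_pCons_hom)
  then have "meval (\<lambda>x. x) \<sigma> (coeff L2 1) = coeff (line_poly \<sigma> e G) 1" by (metis \<sigma>.coeff_map_poly_hom)
  ultimately show ?thesis using nz \<sigma>(1)
    by (intro exI[of _ e] exI[of _ \<sigma>]) (auto simp: e_def)
qed

section \<open>Choosing the base point\<close>

text \<open>The roots of \<open>u\<close> are split off one at a time, each using up one factor
  \<open>w\<close>.\<close>

lemma dvd_power_of_roots:
  fixes u w :: "'k::field poly"
  assumes alg: "\<And>p :: 'k poly. 0 < degree p \<Longrightarrow> \<exists>x. poly p x = 0"
  shows "u \<noteq> 0 \<Longrightarrow> degree u \<le> n \<Longrightarrow> (\<And>x. poly u x = 0 \<Longrightarrow> poly w x = 0) \<Longrightarrow> u dvd w ^ n"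
proof (induction n arbitrary: u)
  case 0
  then show ?case by (simp add: is_unit_iff_degree)
next
  case (Suc n)
  show ?case
  proof (cases "degree u = 0")
    case True
    then show ?thesis using Suc.prems(1) by (metis is_unit_iff_degree unit_imp_dvd)
  next
    case False
    then obtain x where x: "poly u x = 0" using alg by blast
    then obtain u1 where u1: "u = [:- x, 1:] * u1" by (metis dvdE poly_eq_0_iff_dvd)
    have "poly w x = 0" using x by (rule Suc.prems(3))
    then have w: "[:- x, 1:] dvd w" by (simp add: poly_eq_0_iff_dvd)
    have "u1 \<noteq> 0" using Suc.prems(1) u1 by auto
    then have "degree u = Suc (degree u1)" unfolding u1 by (subst degree_mult_eq) auto
    then have "u1 dvd w ^ n"
      by (intro Suc.IH) (use Suc.prems \<open>u1 \<noteq> 0\<close> in \<open>auto simp: u1\<close>)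
    then show ?thesis unfolding u1 power_Suc by (intro mult_dvd_mono w)
  qed
qed

lemma (in ring_filtration) wdeg_filtration: "ring_filtration (\<lambda>n. {p. wdeg n p})"
  by unfold_locales (auto simp: wdeg_uminus wdeg_mult intro: wdeg_add wdeg_mono[OF wdeg_1] wdeg_mono)

context generic_ring
begin

text \<open>The automorphism X -> X + t w that fixes t. Its image of the constant \<open>g\<close>
  is the restriction of \<open>G\<close> to the generic line with direction w.\<close>

definition shift_hom :: "(nat \<Rightarrow> 'k) \<Rightarrow> 'e poly \<Rightarrow> 'e poly" where
  "shift_hom w = lift_hom (eh (\<lambda>a. [:cE a:]) (\<lambda>i. [:xE i, cE (w i):])) [:0, 1:]"

lemma shift_hom_hom: "comm_ring_hom (shift_hom w)"
  unfolding shift_hom_def by (intro lift_hom_hom eh_hom const_cE_hom)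

lemma shift_hom_const: "shift_hom w [:r:] = meval (\<lambda>a. [:cE a:]) (\<lambda>i. [:xE i, cE (w i):]) (\<psi> r)"
proof -
  interpret h: comm_ring_hom "eh (\<lambda>a. [:cE a:]) (\<lambda>i. [:xE i, cE (w i):])"
    by (intro eh_hom const_cE_hom)
  show ?thesis unfolding shift_hom_def lift_hom_const[of "eh (\<lambda>a. [:cE a:]) (\<lambda>i. [:xE i, cE (w i):])", OF h.hom_zero]
    by (simp only: eh_def)
qed

lemma shift_hom_X: "shift_hom w [:0, 1:] = [:0, 1:]"
proof -
  interpret h: comm_ring_hom "eh (\<lambda>a. [:cE a:]) (\<lambda>i. [:xE i, cE (w i):])"
    by (intro eh_hom const_cE_hom)
  show ?thesis unfolding shift_hom_def by (rule lift_hom_X) (rule h.hom_zero h.hom_one)+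
qed

lemma shift_hom_shift_hom:
  assumes "\<And>i. w i + w' i = 0"
  shows "shift_hom w (shift_hom w' p) = p"
proof -
  interpret s: comm_ring_hom "shift_hom w" by (rule shift_hom_hom)
  interpret s': comm_ring_hom "shift_hom w'" by (rule shift_hom_hom)
  have ss: "comm_ring_hom (\<lambda>p. shift_hom w (shift_hom w' p))"
    using comp_hom[OF shift_hom_hom shift_hom_hom] by (simp add: o_def)
  have ss': "comm_ring_hom (\<lambda>r. shift_hom w (shift_hom w' [:r:]))"
    using comp_hom[OF ss const_poly_hom] by (simp add: o_def)
  have c: "shift_hom v [:cE a:] = [:cE a:]" for v a by (simp add: shift_hom_const psi_cE)
  have x: "shift_hom v [:xE i:] = [:xE i, cE (v i):]" if "i < N" for v i
    using that by (simp add: shift_hom_const psi_xE one_pCons)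
  show ?thesis
  proof (rule poly_hom_eqI[OF ss id_hom])
    fix r
    show "shift_hom w (shift_hom w' [:r:]) = [:r:]"
    proof (rule hom_eqI[OF ss' const_poly_hom])
      show "shift_hom w (shift_hom w' [:cE a:]) = [:cE a:]" for a by (simp only: c)
      fix i assume i: "i < N"
      have "shift_hom w' [:xE i:] = [:xE i:] + [:cE (w' i):] * [:0, 1:]" using x[OF i] by simp
      then have "shift_hom w (shift_hom w' [:xE i:]) = [:xE i, cE (w i):] + [:cE (w' i):] * [:0, 1:]"
        by (simp only: s.hom_add s.hom_mult c shift_hom_X x[OF i])
      also have "\<dots> = [:xE i, cE (w i + w' i):]" by (simp add: cE.hom_add)
      finally show "shift_hom w (shift_hom w' [:xE i:]) = [:xE i:]" by (simp add: assms)
    qed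
  qed (simp only: shift_hom_X)
qed

text \<open>The shift by -w is an inverse automorphism, so the restriction to the generic line is as
  prime as \<open>g\<close>.\<close>

lemma prime_dvd_power_shift:
  assumes "prime_elem g" "shift_hom w [:g:] dvd p ^ n"
  shows "shift_hom w [:g:] dvd p"
proof -
  let ?w = "\<lambda>i. - w i"
  interpret s: comm_ring_hom "shift_hom w" by (rule shift_hom_hom)
  interpret s': comm_ring_hom "shift_hom ?w" by (rule shift_hom_hom)
  have "shift_hom ?w (shift_hom w [:g:]) dvd shift_hom ?w (p ^ n)" using assms(2) by (rule s'.hom_dvd)
  then have "[:g:] dvd shift_hom ?w p ^ n" by (simp add: shift_hom_shift_hom s'.hom_power)
  then have "[:g:] dvd shift_hom ?w p"
    by (rule prime_elem_dvd_power[OF lift_prime_elem_poly[OF assms(1)]])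
  then have "shift_hom w [:g:] dvd shift_hom w (shift_hom ?w p)" by (rule s.hom_dvd)
  then show ?thesis by (simp add: shift_hom_shift_hom)
qed

text \<open>If no base point works, then on every rational line each root of \<open>G\<close> is multiple, so the restriction of
  \<open>G\<close> divides the \<open>d\<close>-th power of its derivative; by the degree bound this holds on the generic line
  too, where the restriction of \<open>G\<close> is prime and so divides the derivative itself.\<close>

lemma base_point_exists:
  assumes alg: "\<And>p :: 'k poly. 0 < degree p \<Longrightarrow> \<exists>x. poly p x = 0"
    and g: "prime_elem g" "\<psi> g = G"
    and hom: "\<And>m. m \<in> Poly_Mapping.keys G \<Longrightarrow> monom_deg m = d"
    and d: "0 < d" and e: "meval (\<lambda>x. x) e G = 1"
    and P0: "coeff (line_poly P0 e G) 1 \<noteq> 0"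
    and S: "d * (d - 1) < card S"
  shows "\<exists>P \<alpha>. (\<forall>i. P i \<in> S) \<and> poly (line_poly P e G) \<alpha> = 0 \<and> poly (pderiv (line_poly P e G)) \<alpha> \<noteq> 0"
proof (rule ccontr)
  assume none: "\<not> ?thesis"
  define f0 where "f0 = shift_hom e [:g:]"
  have f0: "f0 = meval (\<lambda>a. [:cE a:]) (\<lambda>i. [:xE i, cE (e i):]) G"
    unfolding f0_def shift_hom_const g(2) ..
  have vars: "mvars G \<subseteq> {..<N}" using mvars_psi[of g] g(2) by simp
  have spec: "map_poly (eh (\<lambda>x. x) P) f0 = line_poly P e G" for P
  proof -
    have h: "comm_ring_hom (eh (\<lambda>x. x) P)" by (intro eh_hom id_hom)
    interpret h: comm_ring_hom "eh (\<lambda>x. x) P" by (rule h)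
    have "map_poly (eh (\<lambda>x. x) P) f0 = meval (map_poly (eh (\<lambda>x. x) P) \<circ> (\<lambda>a. [:cE a:]))
        (map_poly (eh (\<lambda>x. x) P) \<circ> (\<lambda>i. [:xE i, cE (e i):])) G"
      unfolding f0 by (rule comm_ring_hom.hom_meval[OF map_poly_hom[OF h]])
    also have "map_poly (eh (\<lambda>x. x) P) \<circ> (\<lambda>a. [:cE a:]) = (\<lambda>a. [:a:])"
      by (rule ext) (simp add: h.map_poly_pCons_hom eh_cE)
    also have "meval (\<lambda>a. [:a:]) (map_poly (eh (\<lambda>x. x) P) \<circ> (\<lambda>i. [:xE i, cE (e i):])) G = line_poly P e G"
      unfolding line_poly_def
      by (rule meval_cong) (use vars in \<open>auto simp: h.map_poly_pCons_hom eh_cE eh_xE\<close>)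
    finally show ?thesis .
  qed
  have td: "total_deg G \<le> d" using hom by (simp add: total_deg_le_iff)
  have "f0 \<in> {p. DE.wdeg (total_deg G) p}"
    unfolding f0
  proof (rule meval_filtration[OF DE.wdeg_filtration])
    show "[:cE a:] \<in> {p. DE.wdeg 0 p}" for a by (simp add: DE.wdeg_const cE_in)
    show "[:xE i, cE (e i):] \<in> {p. DE.wdeg 1 p}" for i
      using xE_in[of i] by (auto simp: DE.wdeg_def coeff_pCons cE_in split: nat.splits)
  qed
  then have wf: "DE.wdeg d f0" using DE.wdeg_mono td by simp
  have cf: "coeff f0 d = 1"
  proof -
    let ?ev = "\<lambda>p :: 'e poly. poly p 1"
    have ev: "comm_ring_hom ?ev" by (rule poly_eval_hom)
    have "map_poly ?ev (plane_poly cE (\<lambda>_. 0) xE e G) = f0"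
      unfolding f0 plane_poly_def comm_ring_hom.hom_meval[OF map_poly_hom[OF ev]]
      by (intro arg_cong2[of _ _ _ _ "\<lambda>c \<sigma>. meval c \<sigma> G"] ext) (auto simp: kconst_def map_poly_simps)
    then have "coeff f0 d = poly (coeff (plane_poly cE (\<lambda>_. 0) xE e G) d) 1"
      by (metis coeff_map_poly poly_0)
    also have "coeff (plane_poly cE (\<lambda>_. 0) xE e G) d = [:cE 1:]"
      using plane_poly_top(2)[of cE G d "\<lambda>_. 0" xE e] hom cE_hom e by simp
    finally show ?thesis by simp
  qed
  have df: "degree f0 = d" using DE.wdeg_degree[OF wf] cf by (metis le_antisym le_degree zero_neq_one)
  have lf: "lead_coeff f0 = 1" using df cf by simp
  define d0 where "d0 = pderiv f0"
  have wd0: "DE.wdeg (d - 1) d0"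
  proof (rule DE.wdegI)
    fix i assume "coeff d0 i \<noteq> 0"
    then have "coeff f0 (Suc i) \<noteq> 0" by (auto simp: d0_def coeff_pderiv)
    then have c: "Suc i \<le> d" "coeff f0 (Suc i) \<in> DE (d - Suc i)" using wf by (auto simp: DE.wdeg_def)
    have "of_nat (Suc i) = cE (of_nat (Suc i))" by (simp only: cE.hom_of_nat)
    then have "of_nat (Suc i) \<in> DE 0" using cE_in by simp
    then have "coeff d0 i \<in> DE (0 + (d - Suc i))"
      unfolding d0_def coeff_pderiv by (intro DE.mult_in c)
    then show "i \<le> d - 1 \<and> coeff d0 i \<in> DE (d - 1 - i)" using c(1) by simp
  qed
  \<comment> \<open>The derivative has weight d - 1, so the remainder of its d-th power has degree
    at most d(d - 1) in the base point; \<open>card S\<close> exceeds this, and a nonzero remainder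
    would survive at some rational base point.\<close>
  from DE.wdeg_reduce[OF df lf d wf DE.wdeg_power[OF wd0, of d]]
  obtain q r where qr: "d0 ^ d = f0 * q + r" "degree r < d" "DE.wdeg (d * (d - 1)) r" by blast
  have "r = 0"
  proof (rule ccontr)
    assume "r \<noteq> 0"
    then obtain k where k: "coeff r k \<noteq> 0" by (metis leading_coeff_0_iff)
    have "\<psi> (coeff r k) \<noteq> 0"
    proof
      assume "\<psi> (coeff r k) = 0"
      then have "\<psi> (coeff r k) = \<psi> 0" by simp
      then show False using k injD[OF psi_inj] by blast
    qed
    moreover have "total_deg (\<psi> (coeff r k)) < card S"
      using DE.wdeg_coeff[OF qr(3), of k] S by (simp add: DE_def)
    ultimately obtain \<sigma> where \<sigma>: "\<forall>i. \<sigma> i \<in> S" "meval (\<lambda>x. x) \<sigma> (\<psi> (coeff r k)) \<noteq> 0"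
      using mpoly_nonzero_point by blast
    have h: "comm_ring_hom (eh (\<lambda>x. x) \<sigma>)" by (intro eh_hom id_hom)
    interpret h: comm_ring_hom "eh (\<lambda>x. x) \<sigma>" by (rule h)
    interpret mh: comm_ring_hom "map_poly (eh (\<lambda>x. x) \<sigma>)" by (rule map_poly_hom[OF h])
    define u where "u = line_poly \<sigma> e G"
    have u: "map_poly (eh (\<lambda>x. x) \<sigma>) f0 = u" unfolding u_def by (rule spec)
    have "coeff u d = 1" unfolding u[symmetric] by (simp add: h.coeff_map_poly_hom cf)
    moreover have "degree u \<le> d" unfolding u[symmetric] using degree_map_poly_le[of "eh (\<lambda>x. x) \<sigma>" f0] df by simp
    ultimately have "degree u = d" by (intro antisym le_degree) auto
    then have du: "degree u = d" "lead_coeff u = 1" using \<open>coeff u d = 1\<close> by auto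
    have "u dvd pderiv u ^ d"
    proof (rule dvd_power_of_roots[OF alg])
      show "u \<noteq> 0" using du(2) by auto
      show "degree u \<le> d" using du(1) by simp
      show "poly (pderiv u) x = 0" if "poly u x = 0" for x using none \<sigma>(1) that unfolding u_def by blast
    qed
    moreover have "pderiv u ^ d = u * map_poly (eh (\<lambda>x. x) \<sigma>) q + map_poly (eh (\<lambda>x. x) \<sigma>) r"
    proof -
      have "map_poly (eh (\<lambda>x. x) \<sigma>) d0 = pderiv u"
        unfolding d0_def map_poly_pderiv_hom[OF h] u ..
      then show ?thesis using arg_cong[OF qr(1), of "map_poly (eh (\<lambda>x. x) \<sigma>)"]
        by (simp only: mh.hom_add mh.hom_mult mh.hom_power u)
    qed
    ultimately have "u dvd map_poly (eh (\<lambda>x. x) \<sigma>) r" by (metis dvd_add_right_iff dvd_triv_left)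
    moreover have "degree (map_poly (eh (\<lambda>x. x) \<sigma>) r) < degree u"
      using degree_map_poly_le[of "eh (\<lambda>x. x) \<sigma>" r] qr(2) du(1) by simp
    ultimately have "map_poly (eh (\<lambda>x. x) \<sigma>) r = 0" using du(2) by (intro monic_dvd_degree_less)
    then have "coeff (map_poly (eh (\<lambda>x. x) \<sigma>) r) k = 0" by simp
    then show False using \<sigma>(2) by (simp add: h.coeff_map_poly_hom eh_def)
  qed
  then have "f0 dvd d0 ^ d" using qr(1) by simp
  then have "f0 dvd d0" unfolding f0_def by (rule prime_dvd_power_shift[OF g(1)])
  moreover have "degree d0 < degree f0" using DE.wdeg_degree[OF wd0] d df by simp
  ultimately have "d0 = 0" using lf by (intro monic_dvd_degree_less)
  \<comment> \<open>A vanishing derivative on the generic line would vanish on every line with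
    direction e, which the line through \<open>P0\<close> contradicts.\<close>
  then have "pderiv (line_poly P0 e G) = 0"
    using map_poly_pderiv_hom[OF eh_hom[OF id_hom], of P0 f0] by (simp add: d0_def spec)
  then show False using P0 unfolding coeff_1_conv_pderiv by simp
qed

end

section \<open>Rational points off two hyperplanes\<close>

text \<open>In a finite field the product of all linear factors, plus 1, has no root.\<close>

lemma infinite_alg_closed: "infinite (UNIV :: 'k::alg_closed_field set)"
proof
  assume fin: "finite (UNIV :: 'k set)"
  define p where "p = (\<Prod>c\<in>(UNIV :: 'k set). [:- c, 1:])"
  have deg: "degree p = CARD('k)" unfolding p_def by (subst degree_prod_sum_eq) auto
  have "0 < CARD('k)" using fin by (simp add: card_gt_0_iff)
  moreover from this have "degree (p + 1) = CARD('k)"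
    unfolding deg[symmetric] by (intro degree_add_eq_left) simp
  ultimately obtain x where "poly (p + 1) x = 0" using alg_closed_imp_poly_has_root[of "p + 1"] by auto
  moreover have "poly p x = 0" unfolding p_def poly_prod by (rule prod_zero[OF fin]) auto
  ultimately show False by simp
qed

lemma to_ac_hom: "comm_ring_hom (to_ac :: 'a::field \<Rightarrow> _)"
  by unfold_locales simp_all

lemma poly_poly_eval:
  fixes f :: "'k::idom poly poly"
  shows "poly (poly f l) x = poly (poly f [:poly l x:]) x"
proof -
  have "poly (poly f a) x = poly (map_poly (\<lambda>p. poly p x) f) (poly a x)" for a
    by (rule hom_apply_poly[OF poly_eval_hom])
  from this[of l] this[of "[:poly l x:]"] show ?thesis by simp
qed

lemma degree_poly_tdeg:
  assumes "tdeg d f" "degree l \<le> 1"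
  shows "degree (poly f l) \<le> d"
proof -
  have "degree (coeff f i * l ^ i) \<le> d" if "i \<le> degree f" for i
  proof -
    have i: "i \<le> d" using that deg.wdeg_degree[OF assms(1)] by simp
    have "degree (l ^ i) \<le> 1 * i" by (rule order_trans[OF degree_power_le]) (use assms(2) in simp)
    moreover have "degree (coeff f i) \<le> d - i" using deg.wdeg_coeff[OF assms(1), of i] by simp
    ultimately have "degree (coeff f i) + degree (l ^ i) \<le> d" using i by simp
    then show ?thesis by (rule order_trans[OF degree_mult_le])
  qed
  then show ?thesis unfolding poly_altdef by (intro degree_sum_le) auto
qed

text \<open>If \<open>f\<close> vanished identically on the line y = l(x), it would split as (y - l)
  h with both factors of y-degree below d, because d is at least 2; one of the factors would vanish
  on the branch, against \<open>ker\<close>.\<close>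

lemma card_line_intersection:
  fixes f :: "'k::field poly poly"
  assumes f: "tdeg d f" "degree f = d" "2 \<le> d" and Y: "curve_eval Y f = 0"
    and ker: "\<And>h. degree h < d \<Longrightarrow> curve_eval Y h = 0 \<Longrightarrow> h = 0" and "\<epsilon> \<noteq> 0"
  shows "finite {x. \<exists>c. \<alpha> + \<beta> * x + \<epsilon> * c = 0 \<and> poly (poly f [:c:]) x = 0}"
    and "card {x. \<exists>c. \<alpha> + \<beta> * x + \<epsilon> * c = 0 \<and> poly (poly f [:c:]) x = 0} \<le> d"
proof -
  define l where "l = [:- \<alpha> / \<epsilon>, - \<beta> / \<epsilon>:]"
  have dl: "degree l \<le> 1" by (simp add: l_def)
  interpret ev: comm_ring_hom "curve_eval Y" by (rule curve_eval_hom)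
  have nz: "poly f l \<noteq> 0"
  proof
    assume "poly f l = 0"
    then obtain h where h: "f = [:- l, 1:] * h" by (metis dvdE poly_eq_0_iff_dvd)
    then have "h \<noteq> 0" using f(2,3) by auto
    then have "degree f = Suc (degree h)" unfolding h by (subst degree_mult_eq) auto
    then have "degree h < d" "degree [:- l, 1:] < d" using f(2,3) by auto
    moreover have "curve_eval Y [:- l, 1:] = 0 \<or> curve_eval Y h = 0"
      using Y unfolding h ev.hom_mult by simp
    ultimately show False using ker \<open>h \<noteq> 0\<close> by (metis pCons_eq_0_iff zero_neq_one)
  qed
  have sub: "{x. \<exists>c. \<alpha> + \<beta> * x + \<epsilon> * c = 0 \<and> poly (poly f [:c:]) x = 0} \<subseteq> {x. poly (poly f l) x = 0}"
  proof clarify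
    fix x c assume c: "\<alpha> + \<beta> * x + \<epsilon> * c = 0" "poly (poly f [:c:]) x = 0"
    have "\<epsilon> * c = - \<alpha> - \<beta> * x" using c(1) by (simp add: algebra_simps eq_neg_iff_add_eq_0)
    then have "c = (- \<alpha> - \<beta> * x) / \<epsilon>" using assms(6) by (simp add: field_simps)
    then have "poly l x = c" by (simp add: l_def diff_divide_distrib mult.commute)
    then show "poly (poly f l) x = 0" using c(2) poly_poly_eval[of f l x] by simp
  qed
  show "finite {x. \<exists>c. \<alpha> + \<beta> * x + \<epsilon> * c = 0 \<and> poly (poly f [:c:]) x = 0}"
    by (rule finite_subset[OF sub poly_roots_finite[OF nz]])
  have "card {x. \<exists>c. \<alpha> + \<beta> * x + \<epsilon> * c = 0 \<and> poly (poly f [:c:]) x = 0} \<le> card {x. poly (poly f l) x = 0}"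
    by (rule card_mono[OF poly_roots_finite[OF nz] sub])
  also have "\<dots> \<le> degree (poly f l)" by (rule card_poly_roots_bound[OF nz])
  also have "\<dots> \<le> d" by (rule degree_poly_tdeg[OF f(1) dl])
  finally show "card {x. \<exists>c. \<alpha> + \<beta> * x + \<epsilon> * c = 0 \<and> poly (poly f [:c:]) x = 0} \<le> d" .
qed

lemma frobenius_hom:
  assumes "prime CHAR('r::comm_ring_1)" "q = CHAR('r) ^ k"
  shows "comm_ring_hom (\<lambda>x :: 'r. x ^ q)"
proof -
  have "0 < q" using assms by (simp add: prime_gt_0_nat)
  then show ?thesis
    by unfold_locales (auto simp: freshmans_dream'[OF assms] power_mult_distrib zero_power)
qed

text \<open>Substituting x^q, y^q and raising to the q-th power are both ring homomorphisms. They
  agree on x, y and constants from F_q, hence on a section of \<open>V\<close> by a plane with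
  rational data.\<close>

lemma plane_poly_frobenius:
  fixes V :: "'a::finite_field mpoly"
  defines "q \<equiv> CARD('a)"
  shows "lift_hom (lift_hom kconst (xy q 0)) (xy 0 q)
      (plane_poly (\<lambda>x. x) (to_ac \<circ> P) (to_ac \<circ> v) (to_ac \<circ> e) (Poly_Mapping.map to_ac V)) =
    plane_poly (\<lambda>x. x) (to_ac \<circ> P) (to_ac \<circ> v) (to_ac \<circ> e) (Poly_Mapping.map to_ac V) ^ q"
proof -
  obtain k where k: "q = CHAR('a) ^ k" using card_finite_field[where 'a = 'a] by (auto simp: q_def)
  let ?F = "\<lambda>p :: 'a alg_closure poly poly. p ^ q"
  define H where "H = lift_hom (lift_hom kconst (xy q 0)) (xy 0 q :: 'a alg_closure poly poly)"
  have F_hom: "comm_ring_hom ?F"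
    by (rule frobenius_hom[of _ k]) (simp_all add: k)
  have H1_hom: "comm_ring_hom (lift_hom kconst (xy q 0 :: 'a alg_closure poly poly))"
    by (intro lift_hom_hom kconst_hom)
  have H_hom: "comm_ring_hom H" unfolding H_def by (intro lift_hom_hom H1_hom)
  interpret F: comm_ring_hom ?F by (rule F_hom)
  interpret H1: comm_ring_hom "lift_hom kconst (xy q 0 :: 'a alg_closure poly poly)" by (rule H1_hom)
  interpret H: comm_ring_hom H by (rule H_hom)
  have Hc: "H (kconst a) = kconst a" for a
    unfolding H_def by (simp add: kconst_def[of a] H1.hom_zero) 
  have Hx: "H (xy 1 0) = xy q 0"
  proof -
    have "xy 1 0 = [:[:0, 1 :: 'a alg_closure:]:]" by (simp add: xy_def monom_0 Polynomial.monom_altdef)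
    then show ?thesis unfolding H_def by (simp add: H1.hom_zero)
  qed
  have Hy: "H (xy 0 1) = xy 0 q"
  proof -
    have "xy 0 1 = [:0, 1 :: 'a alg_closure poly:]" by (simp add: xy_def monom_0 Polynomial.monom_altdef one_pCons)
    then show ?thesis unfolding H_def by (simp add: H1.hom_zero H1.hom_one)
  qed
  interpret kc: comm_ring_hom "kconst :: 'a alg_closure \<Rightarrow> _" by (rule kconst_hom)
  have Fc: "?F (kconst (to_ac a)) = kconst (to_ac a)" for a :: 'a
  proof -
    have "to_ac a ^ q = to_ac a"
      using finite_field_power_card_eq_same[of a] by (simp add: q_def flip: to_ac_power)
    then show ?thesis by (simp flip: kc.hom_power)
  qed
  have pw: "xy i j ^ n = (xy (i * n) (j * n) :: 'a alg_closure poly poly)" for i j n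
    by (simp add: xy_def monom_power)
  have split: "[:[:a, b:], [:c:]:] = kconst a + kconst b * xy 1 0 + kconst c * xy 0 1"
    for a b c :: "'a alg_closure"
  proof -
    have "xy 1 0 = [:[:0, 1 :: 'a alg_closure:]:]" "xy 0 1 = [:0, 1 :: 'a alg_closure poly:]"
      by (simp_all add: xy_def monom_0 Polynomial.monom_altdef one_pCons)
    then show ?thesis by (simp add: kconst_def)
  qed
  have lin: "H [:[:to_ac a, to_ac b:], [:to_ac c:]:] = ?F [:[:to_ac a, to_ac b:], [:to_ac c:]:]" for a b c :: 'a
    unfolding split H.hom_add H.hom_mult F.hom_add F.hom_mult Hc Hx Hy Fc pw by simp
  have "meval (H \<circ> (kconst \<circ> (\<lambda>x. x)) \<circ> to_ac) (H \<circ> (\<lambda>i. [:[:(to_ac \<circ> P) i, (to_ac \<circ> v) i:], [:(to_ac \<circ> e) i:]:])) V =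
      meval (?F \<circ> (kconst \<circ> (\<lambda>x. x)) \<circ> to_ac) (?F \<circ> (\<lambda>i. [:[:(to_ac \<circ> P) i, (to_ac \<circ> v) i:], [:(to_ac \<circ> e) i:]:])) V"
    by (intro arg_cong2[of _ _ _ _ "\<lambda>c \<sigma>. meval c \<sigma> V"] ext) (simp_all only: o_def Hc Fc lin)
  moreover have "meval (h \<circ> (kconst \<circ> (\<lambda>x. x)) \<circ> to_ac) \<sigma> V =
      meval (h \<circ> (kconst \<circ> (\<lambda>x. x))) \<sigma> (Poly_Mapping.map to_ac V)"
    if "comm_ring_hom h" for h :: "'a alg_closure poly poly \<Rightarrow> 'a alg_closure poly poly" and \<sigma>
  proof -
    interpret h: comm_ring_hom h by (rule that)
    show ?thesis by (rule meval_map[symmetric]) (simp_all add: h.hom_zero)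
  qed
  ultimately have "meval (H \<circ> (kconst \<circ> (\<lambda>x. x))) (H \<circ> (\<lambda>i. [:[:(to_ac \<circ> P) i, (to_ac \<circ> v) i:], [:(to_ac \<circ> e) i:]:])) (Poly_Mapping.map to_ac V) =
      meval (?F \<circ> (kconst \<circ> (\<lambda>x. x))) (?F \<circ> (\<lambda>i. [:[:(to_ac \<circ> P) i, (to_ac \<circ> v) i:], [:(to_ac \<circ> e) i:]:])) (Poly_Mapping.map to_ac V)"
    using H_hom F_hom by simp
  then show ?thesis
    unfolding plane_poly_def H_def[symmetric] H.hom_meval F.hom_meval .
qed

lemma keys_map_to_ac: "Poly_Mapping.keys (Poly_Mapping.map to_ac V) = Poly_Mapping.keys V"
  by (auto simp: in_keys_iff map.rep_eq when_def)

lemma map_to_ac_hom: "comm_ring_hom (Poly_Mapping.map (to_ac :: 'a::field \<Rightarrow> _) :: 'a mpoly \<Rightarrow> _)"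
proof -
  have "meval mconst mvar (Poly_Mapping.map to_ac V) = meval (mconst \<circ> to_ac) mvar V" for V :: "'a mpoly"
    by (rule meval_map) (simp_all add: mconst_def)
  then have "Poly_Mapping.map (to_ac :: 'a \<Rightarrow> _) = meval (mconst \<circ> to_ac) mvar"
    by (intro ext) simp
  moreover have "comm_ring_hom (mconst \<circ> to_ac :: 'a \<Rightarrow> _)" by (intro comp_hom mconst_hom to_ac_hom)
  ultimately show ?thesis by (simp add: comm_ring_hom.meval_hom)
qed

lemma meval_to_ac:
  "meval (\<lambda>x. x) (to_ac \<circ> a) (Poly_Mapping.map to_ac V) = to_ac (meval (\<lambda>x. x) a V)"
proof -
  interpret t: comm_ring_hom to_ac by (rule to_ac_hom)
  have "meval (\<lambda>x. x) (to_ac \<circ> a) (Poly_Mapping.map to_ac V) = meval ((\<lambda>x. x) \<circ> to_ac) (to_ac \<circ> a) V"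
    by (rule meval_map) simp_all
  also have "\<dots> = meval (to_ac \<circ> (\<lambda>x. x)) (to_ac \<circ> a) V" by (simp only: o_def)
  also have "\<dots> = to_ac (meval (\<lambda>x. x) a V)" by (rule t.hom_meval[symmetric])
  finally show ?thesis .
qed

lemma line_poly_to_ac:
  "line_poly (to_ac \<circ> P) (to_ac \<circ> e) (Poly_Mapping.map to_ac V) = map_poly to_ac (line_poly P e V)"
proof -
  interpret t: comm_ring_hom to_ac by (rule to_ac_hom)
  have "line_poly (to_ac \<circ> P) (to_ac \<circ> e) (Poly_Mapping.map to_ac V) =
      meval ((\<lambda>a. [:a:]) \<circ> to_ac) (\<lambda>i. [:(to_ac \<circ> P) i, (to_ac \<circ> e) i:]) V"
    unfolding line_poly_def by (rule meval_map) simp_all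
  also have "\<dots> = map_poly to_ac (line_poly P e V)"
    unfolding line_poly_def comm_ring_hom.hom_meval[OF map_poly_hom[OF to_ac_hom]]
    by (intro arg_cong2[of _ _ _ _ "\<lambda>c \<sigma>. meval c \<sigma> V"] ext) (simp_all add: t.map_poly_pCons_hom)
  finally show ?thesis .
qed

lemma rational_point_direction:
  fixes V :: "'a::finite_field mpoly" and e P0 :: "nat \<Rightarrow> 'a"
  assumes irr: "irreducible (Poly_Mapping.map to_ac V)" and vars: "mvars V \<subseteq> {..<7}"
    and hom: "\<And>m. m \<in> Poly_Mapping.keys V \<Longrightarrow> monom_deg m = d" and d: "2 \<le> d"
    and large: "6 * d ^ 4 < CARD('a)"
    and e: "meval (\<lambda>x. x) e V = 1" and P0: "coeff (line_poly P0 e V) 1 \<noteq> 0"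
    and e0: "e 0 \<noteq> 0" and e14: "e 1 \<noteq> e 4"
  shows "\<exists>a. meval (\<lambda>x. x) a V = 0 \<and> a 0 \<noteq> 0 \<and> a 1 \<noteq> a 4"
proof -
  let ?q = "CARD('a)"
  define S where "S = range (to_ac :: 'a \<Rightarrow> _)"
  have cS: "card S = ?q" unfolding S_def by (rule card_image[OF inj_to_ac])
  have S_to_ac: "\<exists>w'. w = to_ac \<circ> w'" if "\<forall>i. w i \<in> S" for w :: "nat \<Rightarrow> _"
  proof -
    have "\<forall>i. \<exists>b. w i = to_ac b" using that by (auto simp: S_def)
    from choice[OF this] show ?thesis by (auto simp: fun_eq_iff)
  qed
  define G where "G = Poly_Mapping.map to_ac V"
  have Gvars: "mvars G \<subseteq> {..<7}" using vars by (simp add: G_def mvars_def keys_map_to_ac)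
  have Ghom: "monom_deg m = d" if "m \<in> Poly_Mapping.keys G" for m
    using that hom by (simp add: G_def keys_map_to_ac)
  have irrG: "irreducible G" using irr by (simp add: G_def)
  from nested_prime[OF irrG Gvars] obtain
    \<psi> :: "'a alg_closure poly poly poly poly poly poly poly \<Rightarrow> 'a alg_closure mpoly" and g
    where \<psi>: "nested \<psi> 7" and g: "\<psi> g = G" "prime_elem g"
    by (elim exE conjE) (rule that)
  interpret gr: generic_ring \<psi> 7 by unfold_locales (rule \<psi>)
  let ?e = "to_ac \<circ> e"
  have eG: "meval (\<lambda>x. x) ?e G = 1" unfolding G_def meval_to_ac e by simp
  have P0G: "coeff (line_poly (to_ac \<circ> P0) ?e G) 1 \<noteq> 0"
    unfolding G_def line_poly_to_ac using P0 by (simp add: coeff_map_poly)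
  have b1: "d * (d - 1) < card S" and b2: "d * (d + 1) * (d * (3 * d - 2)) < card S"
  proof -
    have "d * (d - 1) \<le> d * d" by simp
    also have "\<dots> = d ^ 2" by (simp add: power2_eq_square)
    also have "\<dots> \<le> d ^ 4" using d by (intro power_increasing) auto
    finally show "d * (d - 1) < card S" using large cS by simp
    have "d * (d + 1) * (d * (3 * d - 2)) \<le> d * (2 * d) * (d * (3 * d))"
      using d by (intro mult_mono) auto
    also have "\<dots> = 6 * d ^ 4" by (simp add: power4_eq_xxxx)
    finally show "d * (d + 1) * (d * (3 * d - 2)) < card S" using large cS by simp
  qed
  have d0: "0 < d" using d by simp
  have "\<exists>P \<alpha>. (\<forall>i. P i \<in> S) \<and> poly (line_poly P ?e G) \<alpha> = 0 \<and> poly (pderiv (line_poly P ?e G)) \<alpha> \<noteq> 0"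
    by (rule gr.base_point_exists[OF _ g(2,1) _ d0 eG P0G b1]) (auto intro: alg_closed_imp_poly_has_root Ghom)
  then obtain P' \<alpha> where P': "\<forall>i. P' i \<in> S" and \<alpha>: "poly (line_poly P' ?e G) \<alpha> = 0" "poly (pderiv (line_poly P' ?e G)) \<alpha> \<noteq> 0"
    by blast
  have "\<exists>v Y. (\<forall>i. v i \<in> S) \<and> curve_eval Y (plane_poly (\<lambda>x. x) P' v ?e G) = 0 \<and>
    (\<forall>h. degree h < d \<longrightarrow> curve_eval Y h = 0 \<longrightarrow> h = 0)"
    by (rule gr.irreducible_plane_section[OF infinite_alg_closed g(2,1) _ d0 eG \<alpha> b2]) (rule Ghom)
  then obtain v' Y where v': "\<forall>i. v' i \<in> S" and Y: "curve_eval Y (plane_poly (\<lambda>x. x) P' v' ?e G) = 0"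
    and ker: "\<forall>h. degree h < d \<longrightarrow> curve_eval Y h = 0 \<longrightarrow> h = 0" by (elim exE conjE) (rule that)
  obtain P v where Pv: "P' = to_ac \<circ> P" "v' = to_ac \<circ> v" using S_to_ac[OF P'] S_to_ac[OF v'] by blast
  define f where "f = plane_poly (\<lambda>x. x) (to_ac \<circ> P) (to_ac \<circ> v) ?e G"
  have f_tdeg: "tdeg d f" unfolding f_def by (rule plane_poly_top(1)[OF id_hom]) (rule Ghom)
  have "coeff f d = [:meval (\<lambda>x. x) ?e G:]"
    unfolding f_def by (rule plane_poly_top(2)[OF id_hom]) (rule Ghom)
  then have f_lead: "coeff f d = 1" by (simp add: eG one_pCons)
  have f_deg: "degree f = d"
    using deg.wdeg_degree[OF f_tdeg] f_lead by (intro antisym le_degree) auto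
  have fY: "curve_eval Y f = 0" using Y by (simp add: f_def Pv)
  have ker': "\<And>h. degree h < d \<Longrightarrow> curve_eval Y h = 0 \<Longrightarrow> h = 0" using ker by blast
  have q2: "2 \<le> ?q"
  proof -
    have "1 \<le> d ^ 4" using d by simp
    then show ?thesis using large by linarith
  qed
  interpret st: stepanov_curve f d ?q S
  proof
    show "degree f = d" "tdeg d f" "2 \<le> d" by fact+
    show "lead_coeff f = 1" using f_deg f_lead by simp
    have "f dvd f ^ ?q" using q2 by (intro dvd_power) auto
    then show "f dvd lift_hom (lift_hom kconst (xy ?q 0)) (xy 0 ?q) f"
      unfolding f_def G_def plane_poly_frobenius .
    show "finite S" by (simp add: S_def)
    show "(\<Prod>c\<in>S. [:- c, 1:]) = Polynomial.monom 1 ?q - [:0, 1:]"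
    proof (rule prod_linear_factors[OF \<open>finite S\<close> cS q2])
      fix c assume "c \<in> S"
      then obtain b where b: "c = to_ac b" by (auto simp: S_def)
      show "c ^ ?q = c" unfolding b to_ac_power[symmetric] finite_field_power_card_eq_same ..
    qed
  qed
  obtain k where k: "?q = CHAR('a) ^ k" using card_finite_field[where 'a = 'a] by auto
  define A where "A = {x0 \<in> S. \<exists>c\<in>S. poly (poly f [:c:]) x0 = 0}"
  have big: "2 * d < card A"
    unfolding A_def
  proof (rule st.many_rational_abscissae[OF _ _ _ cS fY ker' large])
    show "prime CHAR('a alg_closure)" by simp
    show "?q = CHAR('a alg_closure) ^ k" using k by simp
    show "\<exists>b. b ^ ?q = a" for a :: "'a alg_closure"
      using nth_root_exists[of ?q a] q2 by auto
  qed
  define B where "B = (\<lambda>\<alpha> \<beta> \<epsilon>. {x. \<exists>c. \<alpha> + \<beta> * x + \<epsilon> * c = 0 \<and> poly (poly f [:c:]) x = 0})"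
  have B: "finite (B \<alpha> \<beta> \<epsilon>)" "card (B \<alpha> \<beta> \<epsilon>) \<le> d" if "\<epsilon> \<noteq> 0" for \<alpha> \<beta> \<epsilon>
    unfolding B_def using card_line_intersection[OF f_tdeg f_deg d fY ker' that] by auto
  \<comment> \<open>The abscissae of curve points on X_0 = 0 and on X_1 = X_4. Each hyperplane cuts
    the plane in a line, and by the choice of \<open>e\<close> its coefficient of y is
    nonzero.\<close>
  define B1 where "B1 = B (to_ac (P 0)) (to_ac (v 0)) (to_ac (e 0))"
  define B2 where "B2 = B (to_ac (P 1 - P 4)) (to_ac (v 1 - v 4)) (to_ac (e 1 - e 4))"
  have "finite B1" "card B1 \<le> d" "finite B2" "card B2 \<le> d"
    unfolding B1_def B2_def using e0 e14 by (auto intro!: B)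
  then have "card (B1 \<union> B2) < card A" "finite (B1 \<union> B2)"
    using card_Un_le[of B1 B2] big by auto
  then obtain x where x: "x \<in> A" "x \<notin> B1 \<union> B2" by (metis card_mono not_less subsetI)
  then obtain c where xc: "x \<in> S" "c \<in> S" "poly (poly f [:c:]) x = 0" by (auto simp: A_def)
  then obtain x' c' where x': "x = to_ac x'" "c = to_ac c'" by (auto simp: S_def)
  define a where "a = (\<lambda>i. P i + v i * x' + e i * c')"
  have ev: "comm_ring_hom (\<lambda>p. poly (poly p [:c:]) x)"
    using comp_hom[OF poly_eval_hom[of x] poly_eval_hom[of "[:c:]"]] by (simp add: o_def)
  have "poly (poly f [:c:]) x = meval (\<lambda>x. x) (to_ac \<circ> a) G"
    unfolding f_def plane_poly_def comm_ring_hom.hom_meval[OF ev]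
    by (intro arg_cong2[of _ _ _ _ "\<lambda>c \<sigma>. meval c \<sigma> G"] ext)
       (simp_all add: kconst_def x' a_def algebra_simps)
  then have "to_ac (meval (\<lambda>x. x) a V) = 0" using xc(3) by (simp add: G_def meval_to_ac)
  then have "meval (\<lambda>x. x) a V = 0" by simp
  moreover have "a 0 \<noteq> 0"
  proof
    assume "a 0 = 0"
    then have "to_ac (a 0) = 0" by simp
    then have "to_ac (P 0) + to_ac (v 0) * x + to_ac (e 0) * c = 0" by (simp add: a_def x')
    then show False using x(2) xc(3) by (auto simp: B1_def B_def)
  qed
  moreover have "a 1 \<noteq> a 4"
  proof
    assume "a 1 = a 4"
    then have "to_ac (a 1 - a 4) = 0" by simp
    then have "to_ac (P 1 - P 4) + to_ac (v 1 - v 4) * x + to_ac (e 1 - e 4) * c = 0"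
      by (simp add: a_def x' algebra_simps)
    then show False using x(2) xc(3) by (auto simp: B2_def B_def)
  qed
  ultimately show ?thesis by blast
qed

lemma irreducible_unit_mult:
  fixes p :: "'r::idom"
  assumes "irreducible p" "u * w = 1"
  shows "irreducible (u * p)"
proof (rule irreducibleI)
  have p: "w * (u * p) = p" using assms(2) by (simp add: mult.commute mult.left_commute flip: mult.assoc)
  show "u * p \<noteq> 0" using assms by (auto simp: irreducible_def)
  show "\<not> u * p dvd 1" using assms(1) by (metis dvd_mult_right irreducible_not_unit)
  fix a b assume "u * p = a * b"
  then have "p = (w * a) * b" using p by (simp add: mult.assoc)
  then have "w * a dvd 1 \<or> b dvd 1" by (rule irreducibleD[OF assms(1)])
  then show "a dvd 1 \<or> b dvd 1" by (auto dest: dvd_mult_right)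
qed

theorem rational_point_exists:
  fixes V :: "'a::finite_field mpoly"
  assumes irr: "irreducible (Poly_Mapping.map to_ac V)" and vars: "mvars V \<subseteq> {..<7}"
    and hom: "\<And>m. m \<in> Poly_Mapping.keys V \<Longrightarrow> monom_deg m = d" and d: "2 \<le> d"
    and large: "6 * d ^ 4 < CARD('a)"
  shows "\<exists>a. meval (\<lambda>x. x) a V = 0 \<and> a 0 \<noteq> 0 \<and> a 1 \<noteq> a 4"
proof -
  have "\<exists>m\<in>Poly_Mapping.keys (Poly_Mapping.map to_ac V). \<exists>i. \<not> CHAR('a alg_closure) dvd Poly_Mapping.lookup m i"
    by (rule irreducible_exponent_not_divisible[OF irr]) (auto simp: prime_gt_0_nat intro: nth_root_exists)
  then obtain m i where m: "m \<in> Poly_Mapping.keys V" "\<not> CHAR('a) dvd Poly_Mapping.lookup m i"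
    by (auto simp: keys_map_to_ac)
  have V0: "V \<noteq> 0" using m(1) by auto
  have "total_deg V \<le> d" using hom by (simp add: total_deg_le_iff)
  moreover have "2 * d + 2 < CARD('a)"
  proof -
    have "d ^ 1 \<le> d ^ 4" using d by (intro power_increasing) auto
    then show ?thesis using large d by simp
  qed
  ultimately have "2 * total_deg V + 2 < card (UNIV :: 'a set)" by simp
  from direction_exists[OF V0 m this] obtain e P where e: "meval (\<lambda>x. x) e V \<noteq> 0"
    "coeff (line_poly P e V) 1 \<noteq> 0" "e 0 \<noteq> 0" "e 1 \<noteq> e 4" by blast
  \<comment> \<open>Rescaling \<open>V\<close> to the value 1 at \<open>e\<close> makes the plane
    sections monic in y without changing the zeros.\<close>
  define \<gamma> where "\<gamma> = inverse (meval (\<lambda>x. x) e V)"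
  define W where "W = mconst \<gamma> * V"
  have \<gamma>: "\<gamma> \<noteq> 0" using e(1) by (simp add: \<gamma>_def)
  have mevW: "meval (\<lambda>x. x) a W = \<gamma> * meval (\<lambda>x. x) a V" for a
  proof -
    interpret h: comm_ring_hom "meval (\<lambda>x. x) a :: 'a mpoly \<Rightarrow> _" by (intro comm_ring_hom.meval_hom id_hom)
    show ?thesis unfolding W_def h.hom_mult by simp
  qed
  have "line_poly P e W = [:\<gamma>:] * line_poly P e V"
  proof -
    interpret h: comm_ring_hom "line_poly P e :: 'a mpoly \<Rightarrow> _"
      unfolding line_poly_def by (intro comm_ring_hom.meval_hom const_poly_hom)
    show ?thesis unfolding W_def h.hom_mult by (simp add: line_poly_def)
  qed
  then have lW: "coeff (line_poly P e W) 1 \<noteq> 0" using e(2) \<gamma> by simp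
  have keysW: "Poly_Mapping.keys W \<subseteq> Poly_Mapping.keys V"
    using keys_mult[of "mconst \<gamma>" V] by (auto simp: W_def mconst_def split: if_splits)
  have "irreducible (Poly_Mapping.map to_ac W)"
  proof -
    interpret hm: comm_ring_hom "Poly_Mapping.map (to_ac :: 'a \<Rightarrow> _) :: 'a mpoly \<Rightarrow> _" by (rule map_to_ac_hom)
    interpret mc: comm_ring_hom "mconst :: 'a \<Rightarrow> _" by (rule mconst_hom)
    have "mconst \<gamma> * mconst (inverse \<gamma>) = (1 :: 'a mpoly)" using \<gamma> by (simp flip: mc.hom_mult add: mc.hom_one)
    then have "Poly_Mapping.map to_ac (mconst \<gamma> * mconst (inverse \<gamma>)) = 1" by (simp add: hm.hom_one)
    then have "Poly_Mapping.map to_ac (mconst \<gamma>) * Poly_Mapping.map to_ac (mconst (inverse \<gamma>)) = 1"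
      by (simp only: hm.hom_mult)
    then show ?thesis unfolding W_def hm.hom_mult by (rule irreducible_unit_mult[OF irr])
  qed
  moreover have "mvars W \<subseteq> {..<7}" using vars keysW by (auto simp: mvars_def)
  ultimately have "\<exists>a. meval (\<lambda>x. x) a W = 0 \<and> a 0 \<noteq> 0 \<and> a 1 \<noteq> a 4"
    using e(1,3,4) lW d large hom keysW
    by (intro rational_point_direction[of W d e P]) (auto simp: mevW \<gamma>_def)
  then show ?thesis using \<gamma> by (auto simp: mevW)
qed

section \<open>Homogenization\<close>

lemma meval_homogenize:
  assumes "comm_ring_hom c" "\<sigma> 0 = 1"
  shows "meval c \<sigma> (homogenize p) = meval c \<sigma> p"
proof -
  interpret c: comm_ring_hom c by (rule assms)
  interpret h: comm_ring_hom "meval c \<sigma>" by (rule c.meval_hom)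
  show ?thesis
    unfolding homogenize_def h.hom_sum
    by (simp add: c.hom_zero monom_eval_add assms(2)) (simp add: meval_def)
qed

lemma total_deg_homogenize: "total_deg (homogenize p) \<le> total_deg p"
  unfolding homogenize_def
proof (rule total_deg_sum_le)
  fix m assume "m \<in> Poly_Mapping.keys p"
  then have "monom_deg (m + Poly_Mapping.single 0 (total_deg p - monom_deg m)) = total_deg p"
    using monom_deg_le_total_deg[of m p] by (simp add: monom_deg_add)
  then show "total_deg (Poly_Mapping.single (m + Poly_Mapping.single 0 (total_deg p - monom_deg m))
      (Poly_Mapping.lookup p m)) \<le> total_deg p"
    using total_deg_single_le by metis
qed

lemma meval_scale:
  fixes V :: "'a::comm_ring_1 mpoly"
  assumes "\<And>m. m \<in> Poly_Mapping.keys V \<Longrightarrow> monom_deg m = n"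
  shows "meval (\<lambda>x. x) (\<lambda>i. t * a i) V = t ^ n * meval (\<lambda>x. x) a V"
proof -
  have "monom_eval (\<lambda>i. t * a i) m = t ^ monom_deg m * monom_eval a m" for m
    by (simp add: monom_eval_def monom_deg_def power_mult_distrib prod.distrib power_sum)
  then show ?thesis
    unfolding meval_def sum_distrib_left by (intro sum.cong refl) (simp add: assms mult_ac)
qed

lemma meval_linear_form:
  fixes V :: "'a::comm_ring_1 mpoly"
  assumes "\<And>m. m \<in> Poly_Mapping.keys V \<Longrightarrow> monom_deg m = 1" "mvars V \<subseteq> {..<N}" "c 0 = 0"
  shows "meval c \<sigma> V = (\<Sum>i<N. c (Poly_Mapping.lookup V (Poly_Mapping.single i 1)) * \<sigma> i)"
proof -
  have "Poly_Mapping.keys V \<subseteq> (\<lambda>i. Poly_Mapping.single i 1) ` {..<N}"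
  proof
    fix m assume m: "m \<in> Poly_Mapping.keys V"
    have "(\<Sum>i\<in>Poly_Mapping.keys m. Poly_Mapping.lookup m i) = 1" using assms(1)[OF m] by (simp add: monom_deg_def)
    then obtain i where i: "i \<in> Poly_Mapping.keys m" "Poly_Mapping.lookup m i = 1"
      "\<And>j. j \<in> Poly_Mapping.keys m \<Longrightarrow> i \<noteq> j \<Longrightarrow> Poly_Mapping.lookup m j = 0"
      by (auto simp: sum_eq_Suc0_iff)
    have "m = Poly_Mapping.single i 1"
      by (rule poly_mapping_eqI) (use i in \<open>auto simp: lookup_single when_def in_keys_iff\<close>)
    moreover have "i < N" using assms(2) m i(1) by (auto simp: mvars_def)
    ultimately show "m \<in> (\<lambda>i. Poly_Mapping.single i 1) ` {..<N}" by auto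
  qed
  then have "meval c \<sigma> V = (\<Sum>m\<in>(\<lambda>i. Poly_Mapping.single i 1) ` {..<N}. c (Poly_Mapping.lookup V m) * monom_eval \<sigma> m)"
    by (intro meval_superset assms(3)) auto
  also have "\<dots> = (\<Sum>i<N. c (Poly_Mapping.lookup V (Poly_Mapping.single i 1)) * \<sigma> i)"
  proof (subst sum.reindex)
    show "inj_on (\<lambda>i. Poly_Mapping.single i (1 :: nat)) {..<N}"
      by (rule inj_onI) (metis lookup_single_eq lookup_single_not_eq zero_neq_one)
  qed simp
  finally show ?thesis .
qed

section \<open>The hypersurface\<close>

lemma meval_subst3:
  assumes "f \<in> polys3" "comm_ring_hom c"
  shows "meval c \<tau> (subst3 f p1 p2 p3) = meval c ((!) [meval c \<tau> p1, meval c \<tau> p2, meval c \<tau> p3]) f"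
proof -
  interpret c: comm_ring_hom c by (rule assms)
  interpret h: comm_ring_hom "meval c \<tau>" by (rule c.meval_hom)
  have "meval c \<tau> \<circ> mconst = c" by (rule ext) (simp add: c.hom_zero)
  then have "meval c \<tau> (subst3 f p1 p2 p3) = meval c (meval c \<tau> \<circ> (!) [p1, p2, p3]) f"
    by (simp add: subst3_def mpoly_subst_conv_meval h.hom_meval)
  also have "\<dots> = meval c ((!) [meval c \<tau> p1, meval c \<tau> p2, meval c \<tau> p3]) f"
  proof (rule meval_cong)
    fix i assume "i \<in> mvars f"
    then have "i \<in> {0, 1, 2}" using assms(1) by (auto simp: polys3_def)
    then show "(meval c \<tau> \<circ> (!) [p1, p2, p3]) i = [meval c \<tau> p1, meval c \<tau> p2, meval c \<tau> p3] ! i" by auto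
  qed
  finally show ?thesis .
qed

lemma total_deg_subst3:
  fixes f :: "'a::comm_ring_1 mpoly"
  assumes "f \<in> polys3"
  shows "total_deg (subst3 f (mvar i) (mvar j) (mvar k)) \<le> total_deg f"
proof -
  let ?\<sigma> = "\<lambda>l. if l < 3 then [mvar i, mvar j, mvar k] ! l else (0 :: 'a mpoly)"
  have "subst3 f (mvar i) (mvar j) (mvar k) = meval mconst ?\<sigma> f"
    unfolding subst3_def mpoly_subst_conv_meval
    by (rule meval_cong) (use assms in \<open>auto simp: polys3_def\<close>)
  moreover have "meval mconst ?\<sigma> f \<in> {p. total_deg p \<le> total_deg f}"
  proof (rule meval_filtration[OF total_deg_filtration])
    show "?\<sigma> l \<in> {p. total_deg p \<le> 1}" for l
      using total_deg_mvar_le by (auto simp: nth_Cons split: nat.splits)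
  qed simp
  ultimately show ?thesis by simp
qed

context
  fixes f1 f2 f3 :: "'a::field mpoly"
  assumes f: "f1 \<in> polys3" "f2 \<in> polys3" "f3 \<in> polys3"
begin

lemma meval_S_affine_poly:
  assumes "comm_ring_hom c"
  shows "meval c \<tau> (S_affine_poly f1 f2 f3) =
     (\<tau> 1 - \<tau> 4) * (meval c ((!) [\<tau> 4, \<tau> 5, \<tau> 6]) f3 - meval c ((!) [\<tau> 1, \<tau> 2, \<tau> 3]) f3) +
     (\<tau> 2 - \<tau> 5) * (meval c ((!) [\<tau> 4, \<tau> 5, \<tau> 6]) f2 - meval c ((!) [\<tau> 1, \<tau> 2, \<tau> 3]) f2) +
     (\<tau> 3 - \<tau> 6) * (meval c ((!) [\<tau> 4, \<tau> 5, \<tau> 6]) f1 - meval c ((!) [\<tau> 1, \<tau> 2, \<tau> 3]) f1)"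
proof -
  interpret c: comm_ring_hom c by (rule assms)
  interpret h: comm_ring_hom "meval c \<tau>" by (rule c.meval_hom)
  have "meval c \<tau> (mvar i) = \<tau> i" for i by (simp add: c.hom_zero c.hom_one)
  then show ?thesis
    unfolding S_affine_poly_def h.hom_add h.hom_mult h.hom_minus
      meval_subst3[OF f(1) assms] meval_subst3[OF f(2) assms] meval_subst3[OF f(3) assms] by simp
qed

text \<open>Absence of X_0, expressed as invariance under X_0 := 1; dehomogenising the
  homogenization therefore gives the affine polynomial back.\<close>

lemma S_affine_poly_free:
  "meval mconst (mvar(0 := 1)) (S_affine_poly f1 f2 f3) = S_affine_poly f1 f2 f3"
proof -
  have "meval mconst (mvar(0 := 1)) (S_affine_poly f1 f2 f3) = meval mconst mvar (S_affine_poly f1 f2 f3)"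
    unfolding meval_S_affine_poly[OF mconst_hom] by simp
  then show ?thesis by simp
qed

lemma total_deg_S_affine_poly:
  assumes "total_deg f1 \<le> d" "total_deg f2 \<le> d" "total_deg f3 \<le> d"
  shows "total_deg (S_affine_poly f1 f2 f3) \<le> d + 1"
proof -
  have *: "total_deg ((mvar i - mvar j) * (subst3 g (mvar 4) (mvar 5) (mvar 6) - subst3 g (mvar 1) (mvar 2) (mvar 3))) \<le> 1 + d"
    if "g \<in> polys3" "total_deg g \<le> d" for g :: "'a mpoly" and i j
    by (intro total_deg_mult_le total_deg_diff_le total_deg_mvar_le)
       (use total_deg_subst3[OF that(1)] that(2) in \<open>auto intro: order_trans\<close>)
  show ?thesis
    unfolding S_affine_poly_def using *[OF f(1) assms(1)] *[OF f(2) assms(2)] *[OF f(3) assms(3)]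
    by (intro total_deg_add_le) (simp_all add: add.commute)
qed

end

text \<open>The curve argument requires a component of degree at least 2, so hyperplane components
  receive an explicit point. If the affine polynomial is 0, any point off the diagonal will
  do.\<close>

lemma affine_point_exists:
  fixes f1 f2 f3 V :: "'a::finite_field mpoly"
  assumes f: "f1 \<in> polys3" "f2 \<in> polys3" "f3 \<in> polys3"
    and deg: "total_deg f1 \<le> d" "total_deg f2 \<le> d" "total_deg f3 \<le> d"
    and large: "6 * (d + 1) ^ 4 < CARD('a)"
    and V: "abs_irred_component 6 (S_poly f1 f2 f3) V"
  shows "\<exists>b. meval (\<lambda>x. x) b (S_affine_poly f1 f2 f3) = 0 \<and> (b 1 \<noteq> b 4 \<or> b 2 \<noteq> b 5 \<or> b 3 \<noteq> b 6)"
proof (cases "S_affine_poly f1 f2 f3 = 0")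
  case True
  then show ?thesis by (intro exI[of _ "\<lambda>i. if i = 1 then 1 else 0"]) (simp add: meval_def)
next
  case False
  define A where "A = S_affine_poly f1 f2 f3"
  define F where "F = homogenize A"
  have A0: "A \<noteq> 0" using False by (simp add: A_def)
  define \<delta> :: "'a mpoly \<Rightarrow> 'a mpoly" where "\<delta> = meval mconst (mvar(0 := 1))"
  interpret \<delta>: comm_ring_hom \<delta> unfolding \<delta>_def by (intro comm_ring_hom.meval_hom mconst_hom)
  have \<delta>F: "\<delta> F = A"
    unfolding F_def \<delta>_def A_def using S_affine_poly_free[OF f]
    by (subst meval_homogenize[OF mconst_hom]) simp_all
  have F0: "F \<noteq> 0" using A0 \<delta>F by (auto simp: \<delta>.hom_zero)
  have dF: "total_deg F \<le> total_deg A" unfolding F_def by (rule total_deg_homogenize)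
  have dA: "total_deg A \<le> d + 1" unfolding A_def by (rule total_deg_S_affine_poly[OF f deg])
  have vars: "mvars V \<subseteq> {..<7}" and irr: "irreducible (Poly_Mapping.map to_ac V)"
    and "V dvd F" and "homogeneous V"
    using V by (auto simp: abs_irred_component_def absolutely_irreducible_def F_def A_def S_poly_def)
  obtain W where W: "F = V * W" using \<open>V dvd F\<close> by (rule dvdE)
  obtain n where hom: "\<And>m. m \<in> Poly_Mapping.keys V \<Longrightarrow> monom_deg m = n"
    using \<open>homogeneous V\<close> unfolding homogeneous_def by blast
  have V0: "V \<noteq> 0" and W0: "W \<noteq> 0" using F0 W by auto
  then obtain m0 where m0: "m0 \<in> Poly_Mapping.keys V" by fastforce
  have tV: "total_deg V = n"
    using hom monom_deg_le_total_deg[OF m0] m0 by (intro antisym) (auto simp: total_deg_le_iff)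
  have tF: "total_deg F = n + total_deg W" unfolding W using V0 W0 tV by (simp add: total_deg_mult_eq)
  have nd: "n \<le> d + 1" using tF dF dA by simp
  have n0: "n \<noteq> 0"
  proof
    assume "n = 0"
    then have k: "m = 0" if "m \<in> Poly_Mapping.keys V" for m using hom[OF that] by (simp add: monom_deg_eq_0_iff)
    have "V = mconst (Poly_Mapping.lookup V 0)"
      unfolding mconst_def by (rule poly_mapping_eqI) (use k in \<open>auto simp: lookup_single when_def in_keys_iff\<close>)
    then obtain c where c: "V = mconst c" by blast
    have "c \<noteq> 0" using V0 by (auto simp: c mconst_def)
    have map: "Poly_Mapping.map to_ac V = mconst (to_ac c)"
      unfolding c mconst_def by (rule poly_mapping_eqI) (simp add: map.rep_eq lookup_single when_def)
    interpret mc: comm_ring_hom "mconst :: 'a alg_closure \<Rightarrow> _" by (rule mconst_hom)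
    have "mconst (to_ac c) * mconst (inverse (to_ac c)) = (1 :: 'a alg_closure mpoly)"
      using \<open>c \<noteq> 0\<close> by (simp flip: mc.hom_mult add: mc.hom_one)
    then have "Poly_Mapping.map to_ac V dvd 1"
      unfolding map by (metis dvd_triv_left)
    then show False using irr by (simp add: irreducible_def)
  qed
  have zero: "meval (\<lambda>x. x) b A = 0" if "meval (\<lambda>x. x) b V = 0" "b 0 = 1" for b
  proof -
    interpret h: comm_ring_hom "meval (\<lambda>x. x) b :: 'a mpoly \<Rightarrow> _" by (intro comm_ring_hom.meval_hom id_hom)
    have "meval (\<lambda>x. x) b F = meval (\<lambda>x. x) b A"
      unfolding F_def by (rule meval_homogenize[OF id_hom]) (rule that(2))
    then show ?thesis using that(1) by (simp add: W h.hom_mult)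
  qed
  have "\<exists>b. meval (\<lambda>x. x) b V = 0 \<and> b 0 = 1 \<and> (b 1 \<noteq> b 4 \<or> b 2 \<noteq> b 5 \<or> b 3 \<noteq> b 6)"
  proof (cases "n = 1")
    case False
    then have n2: "2 \<le> n" using n0 by simp
    have "n ^ 4 \<le> (d + 1) ^ 4" using nd by (rule power_mono) simp
    then have "6 * n ^ 4 < CARD('a)" using large by linarith
    from rational_point_exists[OF irr vars hom n2 this]
    obtain a where a: "meval (\<lambda>x. x) a V = 0" "a 0 \<noteq> 0" "a 1 \<noteq> a 4" by blast
    let ?b = "\<lambda>i. inverse (a 0) * a i"
    have "meval (\<lambda>x. x) ?b V = 0" using a(1) by (subst meval_scale[OF hom]) simp_all
    then show ?thesis using a(2,3) by (intro exI[of _ ?b]) auto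
  next
    case True
    define c where "c = (\<lambda>i. Poly_Mapping.lookup V (Poly_Mapping.single i 1))"
    have lin: "meval h \<sigma> V = (\<Sum>i<7. h (c i) * \<sigma> i)" if "h 0 = 0"
      for h :: "'a \<Rightarrow> 'b::comm_ring_1" and \<sigma>
      unfolding c_def using hom True vars that by (intro meval_linear_form) auto
    \<comment> \<open>The component is not X_0 = 0: otherwise dehomogenising \<open>V\<close> would
      leave a constant, and \<open>A\<close> would have degree at most that of \<open>W\<close>, one
      less than that of its homogenization.\<close>
    have "\<exists>i. 1 \<le> i \<and> i < 7 \<and> c i \<noteq> 0"
    proof (rule ccontr)
      assume "\<not> ?thesis"
      then have c0: "c i = 0" if "1 \<le> i" "i < 7" for i using that by blast
      have "\<delta> V = (\<Sum>i<7. mconst (c i) * (mvar(0 := 1)) i)" unfolding \<delta>_def by (rule lin) (simp add: mconst_def)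
      also have "\<dots> = (\<Sum>i<(7::nat). if i = 0 then mconst (c 0) else 0)"
        by (intro sum.cong refl) (auto simp: c0 mconst_def)
      also have "\<dots> = mconst (c 0)" by simp
      finally have "A = mconst (c 0) * \<delta> W" using \<delta>F W by (simp add: \<delta>.hom_mult)
      moreover have "\<delta> W \<in> {p. total_deg p \<le> total_deg W}"
        unfolding \<delta>_def
      proof (rule meval_filtration[OF total_deg_filtration])
        show "(mvar(0 := 1)) i \<in> {p :: 'a mpoly. total_deg p \<le> 1}" for i
          using total_deg_mvar_le by auto
      qed simp
      ultimately have "total_deg A \<le> 0 + total_deg W" by (simp only: mem_Collect_eq) (intro total_deg_mult_le, simp_all)
      then show False using tF dF True by simp
    qed
    then obtain i where i: "1 \<le> i" "i < 7" "c i \<noteq> 0" by blast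
    \<comment> \<open>\<open>j\<close> avoids both \<open>i\<close> and the coordinate paired with
      \<open>i\<close> by a shift of 3. Thus b_j = 1 while its partner is 0, and b_i remains free to
      solve the equation.\<close>
    define j :: nat where "j = (if i = 1 \<or> i = 4 then 2 else 1)"
    have j: "0 < j" "j < 7" "j \<noteq> i" by (auto simp: j_def)
    define b where "b = (\<lambda>k. if k = 0 \<or> k = j then 1 else if k = i then - (c 0 + c j) / c i else 0)"
    have "meval (\<lambda>x. x) b V = (\<Sum>k<7. c k * b k)" by (rule lin) simp
    also have "\<dots> = (\<Sum>k\<in>{0, j, i}. c k * b k)"
      by (rule sum.mono_neutral_right) (use i j in \<open>auto simp: b_def\<close>)
    also have "\<dots> = 0" using i j by (simp add: b_def)
    finally have "meval (\<lambda>x. x) b V = 0" .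
    moreover have "b 0 = 1" by (simp add: b_def)
    moreover have "b 1 \<noteq> b 4 \<or> b 2 \<noteq> b 5 \<or> b 3 \<noteq> b 6"
      by (cases "i = 1 \<or> i = 4") (auto simp: b_def j_def)
    ultimately show ?thesis by blast
  qed
  then show ?thesis using zero unfolding A_def by blast
qed

section \<open>Singular lines through two points of \<open>O7\<close>\<close>

lemma vector_8:
  fixes x1 x2 x3 x4 x5 x6 x7 x8 :: "'a::zero"
  defines "v \<equiv> (vector [x1, x2, x3, x4, x5, x6, x7, x8] :: 'a ^ 8)"
  shows "vec_nth v 1 = x1" "vec_nth v 2 = x2" "vec_nth v 3 = x3" "vec_nth v 4 = x4"
    "vec_nth v 5 = x5" "vec_nth v 6 = x6" "vec_nth v 7 = x7" "vec_nth v 8 = x8"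
  unfolding v_def vector_def by simp_all

lemma totally_singular_extend:
  fixes W :: "('a::finite_field ^ 8) set"
  assumes "totally_singular W"
  shows "\<exists>U. Q_generator U \<and> W \<subseteq> U"
proof -
  have "finite {U :: ('a ^ 8) set. totally_singular U}" by (rule finite)
  from finite_has_maximal2[OF this, of W] assms obtain U where
    "totally_singular U" "W \<subseteq> U" "\<forall>U'. totally_singular U' \<longrightarrow> U \<subseteq> U' \<longrightarrow> U = U'" by auto
  then show ?thesis unfolding Q_generator_def by blast
qed

lemma not_ovoid_if_collinear:
  fixes f1 f2 f3 :: "'a::finite_field mpoly"
  assumes eq: "(x - x') * (eval3 f3 x' y' z' - eval3 f3 x y z) + (y - y') * (eval3 f2 x' y' z' - eval3 f2 x y z) +
      (z - z') * (eval3 f1 x' y' z' - eval3 f1 x y z) = 0"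
    and ne: "x \<noteq> x' \<or> y \<noteq> y' \<or> z \<noteq> z'"
  shows "\<not> Q_ovoid (O7 f1 f2 f3)"
proof
  assume ov: "Q_ovoid (O7 f1 f2 f3)"
  define w :: "'a \<Rightarrow> 'a \<Rightarrow> 'a \<Rightarrow> 'a ^ 8" where
    "w = (\<lambda>x y z. vector [1, x, y, z, eval3 f1 x y z, eval3 f2 x y z, eval3 f3 x y z,
        - z * eval3 f1 x y z - y * eval3 f2 x y z - x * eval3 f3 x y z])"
  let ?u = "w x y z" and ?v = "w x' y' z'"
  have nth: "vec_nth (w x y z) 1 = 1" "vec_nth (w x y z) 2 = x" "vec_nth (w x y z) 3 = y" "vec_nth (w x y z) 4 = z"
    "vec_nth (w x y z) 5 = eval3 f1 x y z" "vec_nth (w x y z) 6 = eval3 f2 x y z" "vec_nth (w x y z) 7 = eval3 f3 x y z"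
    "vec_nth (w x y z) 8 = - z * eval3 f1 x y z - y * eval3 f2 x y z - x * eval3 f3 x y z" for x y z
    unfolding w_def by (rule vector_8)+
  have "totally_singular (vec.span {?u, ?v})"
    unfolding totally_singular_def
  proof (intro conjI ballI)
    fix p assume "p \<in> vec.span {?u, ?v}"
    then obtain a b where "p - a *s ?u - b *s ?v = 0" by (auto simp: vec.span_insert)
    then have p: "p = a *s ?u + b *s ?v" by (simp add: algebra_simps)
    \<comment> \<open>Both points are singular, so only the polar form contributes on their span; in
      these coordinates it is the left-hand side of \<open>eq\<close>.\<close>
    have "Q_form p = a * b * ((x - x') * (eval3 f3 x' y' z' - eval3 f3 x y z) +
        (y - y') * (eval3 f2 x' y' z' - eval3 f2 x y z) + (z - z') * (eval3 f1 x' y' z' - eval3 f1 x y z))"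
      unfolding Q_form_def p vector_add_component vector_smult_component nth by (simp add: algebra_simps)
    then show "Q_form p = 0" using eq by simp
  qed simp
  then obtain U where U: "Q_generator U" "vec.span {?u, ?v} \<subseteq> U" using totally_singular_extend by blast
  have "vec.span {?u} \<subseteq> U" "vec.span {?v} \<subseteq> U"
    using U(2) vec.span_mono[of "{?u}" "{?u, ?v}"] vec.span_mono[of "{?v}" "{?u, ?v}"] by auto
  moreover have "vec.span {?u} \<in> O7 f1 f2 f3" "vec.span {?v} \<in> O7 f1 f2 f3"
    unfolding O7_def w_def by blast+
  ultimately have "vec.span {?u} = vec.span {?v}" using ov U(1) unfolding Q_ovoid_def by blast
  then have "?v \<in> vec.span {?u}" using vec.span_base[of ?v "{?v}"] by simp
  then obtain k where k: "?v = k *s ?u" by (auto simp: vec.span_singleton)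
  have "vec_nth ?v 1 = k * vec_nth ?u 1" unfolding k by simp
  then have "k = 1" by (simp add: nth)
  then have "?v = ?u" using k by simp
  then have "vec_nth ?v i = vec_nth ?u i" for i by simp
  from this[of 2] this[of 3] this[of 4] ne show False by (simp add: nth)
qed

theorem theorem2p3:
  fixes f1 f2 f3 :: "'a::finite_field mpoly" and d :: nat
  assumes "f1 \<in> polys3" and "f2 \<in> polys3" and "f3 \<in> polys3"
    and "eval3 f1 0 0 0 = 0" and "eval3 f2 0 0 0 = 0" and "eval3 f3 0 0 0 = 0"
    and "d = Max {total_deg f1, total_deg f2, total_deg f3}"
    and "real CARD('a) > 6.3 * (real d + 1) powr (13 / 3)"
    and "\<exists>V. abs_irred_component 6 (S_poly f1 f2 f3) V"
  shows "\<not> Q_ovoid (O7 f1 f2 f3)"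
proof -
  \<comment> \<open>As d + 1 bounds the degree of the affine polynomial, the assumed bound is
    brought to the form 6(d + 1)^4 < q required by the point search.\<close>
  have "(real d + 1) powr (real 4) \<le> (real d + 1) powr (13 / 3)" by (intro powr_mono) auto
  also have "(real d + 1) powr (real 4) = (real d + 1) ^ 4" by (rule powr_realpow) simp
  finally have "6 * (real d + 1) ^ 4 \<le> 6.3 * (real d + 1) powr (13 / 3)"
    by (intro mult_mono) simp_all
  then have "real (6 * (d + 1) ^ 4) \<le> 6.3 * (real d + 1) powr (13 / 3)" by (simp add: add.commute)
  then have "real (6 * (d + 1) ^ 4) < real CARD('a)" using assms(8) by linarith
  then have large: "6 * (d + 1) ^ 4 < CARD('a)" by (simp only: of_nat_less_iff)
  obtain V where V: "abs_irred_component 6 (S_poly f1 f2 f3) V" using assms(9) by blast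
  have deg: "total_deg f1 \<le> d" "total_deg f2 \<le> d" "total_deg f3 \<le> d"
    unfolding assms(7) by (auto intro: Max_ge)
  from affine_point_exists[OF assms(1-3) deg large V]
  obtain b where b: "meval (\<lambda>x. x) b (S_affine_poly f1 f2 f3) = 0" "b 1 \<noteq> b 4 \<or> b 2 \<noteq> b 5 \<or> b 3 \<noteq> b 6"
    by blast
  have "eval3 g x y z = meval (\<lambda>x. x) ((!) [x, y, z]) g" for g :: "'a mpoly" and x y z
    by (simp add: eval3_def mpoly_eval_conv_meval)
  then show ?thesis
    using b meval_S_affine_poly[OF assms(1-3) id_hom, of b]
    by (intro not_ovoid_if_collinear[of "b 1" "b 4" f3 "b 5" "b 6" "b 2" "b 3"]) auto
qed

end
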